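(* Let $P_j\in\mathbb{C}^{\gamma_j\times\gamma_j}[w,z]_{\rm h}$, $j=1,\ldots,k$, and let $\mathcal{M}_\gamma$ ($\gamma\in\mathbb{N}$) be the sets of Hermitian matrix polynomials generated by $P_1,\ldots,P_k$ as defined in the context. Suppose there exists $c>0$ such that $c^2-w_iz_i\in\mathcal{M}_1$ for all $i=1,\ldots,d$. Let $\gamma\in\mathbb{N}$ and let $P\in\mathbb{C}^{\gamma\times\gamma}[w,z]_{\rm h}$ be such that for every $d$-tuple $T=(T_1,\ldots,T_d)$ of commuting bounded linear operators on a Hilbert space satisfying $P_j(T^*,T)\ge 0$ for $j=1,\ldots,k$, we have $P(T^*,T)>0$. Then $P\in\mathcal{M}_\gamma$.
   Context: Here $\mathbb{N}=\{1,2,\ldots\}$, $w=(w_1,\ldots,w_d)$ and $z=(z_1,\ldots,z_d)$ are tuples of commuting indeterminates, and $w^\lambda=w_1^{\lambda_1}\cdots w_d^{\lambda_d}$ for a multi-index $\lambda\in\mathbb{Z}_+^d$ (similarly $z^\mu$). $\mathbb{C}^{\beta\times\gamma}[z]$ denotes the polynomials in $z$ with coefficients in $\mathbb{C}^{\beta\times\gamma}$. $\mathbb{C}^{\gamma\times\gamma}[w,z]_{\rm h}$ denotes the real vector space of polynomials $P(w,z)=\sum_{\lambda,\mu}P_{\lambda\mu}w^\lambda z^\mu$ with coefficients in $\mathbb{C}^{\gamma\times\gamma}$ satisfying $P_{\lambda\mu}=P_{\mu\lambda}^*$ for all $\lambda,\mu$. For $H(z)=\sum_\mu H_\mu z^\mu\in\mathbb{C}^{\beta\times\gamma}[z]$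 we set $H^*(w)=\sum_\mu H_\mu^*w^\mu$. Generated sets: given $P_1,\ldots,P_k$ with $P_j\in\mathbb{C}^{\gamma_j\times\gamma_j}[w,z]_{\rm h}$, and setting $\gamma_0=1$, for each $\gamma\in\mathbb{N}$ the set $\mathcal{M}_\gamma$ consists of all $P\in\mathbb{C}^{\gamma\times\gamma}[w,z]_{\rm h}$ for which there exist $n_j\in\mathbb{N}$ and $H_j\in\mathbb{C}^{\gamma_jn_j\times\gamma}[z]$, $j=0,\ldots,k$, such that $$P(w,z)=H_0^*(w)H_0(z)+\sum_{j=1}^kH_j^*(w)\,(P_j(w,z)\otimes I_{n_j})\,H_j(z).$$ Hereditary evaluation: for a $d$-tuple $T=(T_1,\ldots,T_d)$ of commuting bounded operators on a Hilbert space $\mathcal{H}$ and $P(w,z)=\sum_{\lambda,\mu}P_{\lambda\mu}w^\lambda z^\mu$ with $P_{\lambda\mu}\in\mathbb{C}^{\gamma\times\gamma}$, $P(T^*,T):=\sum_{\lambda,\mu}P_{\lambda\mu}\otimes T^{*\lambda}T^\mu$, an operator on $\mathbb{C}^\gamma\otimes\mathcal{H}$, where $T^\mu=T_1^{\mu_1}\cdots T_d^{\mu_d}$ and $T^{*\lambda}=(T_1^* )^{\lambda_1}\cdots(T_d^* )^{\lambda_d}$. For a self-adjoint operator $A$, $A\ge0$ means positive semidefinite, and $A>0$ means positive definite ($\langle Ax,x\rangle>0$ for all $x\ne0$). *)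

theory Defs
  imports
    "HOL-Library.Poly_Mapping"
    "HOL-Library.Product_Plus"
    "HOL-Library.Equipollence"
    "HOL-Library.Complex_Order"
    "Jordan_Normal_Form.Schur_Decomposition"
begin

hide_const (open) Multiset.mult Polynomial.smult

section \<open>Hermitian matrix polynomials\<close>

text \<open>
  The variables are numbered \<open>0, \<dots>, d - 1\<close>. A polynomial with matrix coefficients is represented
  by the matrix of its (scalar) polynomial entries, so that addition and multiplication are those
  of matrices over a commutative ring. In a monomial of \<open>wz_poly\<close> the first multi-index belongs
  to \<open>w\<close> and the second one to \<open>z\<close>.
\<close>

type_synonym multi_index = "nat \<Rightarrow>\<^sub>0 nat"
type_synonym z_poly = "multi_index \<Rightarrow>\<^sub>0 complex"
type_synonym wz_poly = "(multi_index \<times> multi_index) \<Rightarrow>\<^sub>0 complex"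

definition multi_indices :: "nat \<Rightarrow> multi_index set" where
  "multi_indices d = {\<mu>. Poly_Mapping.keys \<mu> \<subseteq> {..<d}}"

definition z_mat_polys :: "nat \<Rightarrow> nat \<Rightarrow> nat \<Rightarrow> z_poly mat set" where
  "z_mat_polys d \<beta> \<gamma> =
    {H \<in> carrier_mat \<beta> \<gamma>. \<forall>p \<in> elements_mat H. Poly_Mapping.keys p \<subseteq> multi_indices d}"

definition wz_mat_polys :: "nat \<Rightarrow> nat \<Rightarrow> nat \<Rightarrow> wz_poly mat set" where
  "wz_mat_polys d \<beta> \<gamma> =
    {P \<in> carrier_mat \<beta> \<gamma>.
      \<forall>p \<in> elements_mat P. Poly_Mapping.keys p \<subseteq> multi_indices d \<times> multi_indices d}"

definition mat_coeff :: "wz_poly mat \<Rightarrow> multi_index \<Rightarrow> multi_index \<Rightarrow> complex mat" where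
  "mat_coeff P \<kappa> \<mu> = map_mat (\<lambda>p. Poly_Mapping.lookup p (\<kappa>, \<mu>)) P"

definition hermitian_polys :: "nat \<Rightarrow> nat \<Rightarrow> wz_poly mat set" where
  "hermitian_polys d \<gamma> =
    {P \<in> wz_mat_polys d \<gamma> \<gamma>. \<forall>\<kappa> \<mu>. mat_coeff P \<kappa> \<mu> = mat_adjoint (mat_coeff P \<mu> \<kappa>)}"

definition poly_const :: "complex \<Rightarrow> wz_poly" where
  "poly_const a = Poly_Mapping.single 0 a"

definition var_w :: "nat \<Rightarrow> wz_poly" where
  "var_w i = Poly_Mapping.single (Poly_Mapping.single i 1, 0) 1"

definition var_z :: "nat \<Rightarrow> wz_poly" where
  "var_z i = Poly_Mapping.single (0, Poly_Mapping.single i 1) 1"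

text \<open>\<open>at_z H\<close> is $H(z)$ and \<open>star_at_w H\<close> is $H^*(w) = \sum_\mu H_\mu^* w^\mu$, both as polynomials
  in $(w, z)$.\<close>

definition at_z :: "z_poly mat \<Rightarrow> wz_poly mat" where
  "at_z H = map_mat
    (\<lambda>p. \<Sum>\<mu>\<in>Poly_Mapping.keys p. Poly_Mapping.single (0, \<mu>) (Poly_Mapping.lookup p \<mu>)) H"

definition star_at_w :: "z_poly mat \<Rightarrow> wz_poly mat" where
  "star_at_w H = map_mat
    (\<lambda>p. \<Sum>\<mu>\<in>Poly_Mapping.keys p. Poly_Mapping.single (\<mu>, 0) (cnj (Poly_Mapping.lookup p \<mu>)))
    (transpose_mat H)"

text \<open>Kronecker product, with the standard block convention.\<close>

definition kronecker :: "'a :: times mat \<Rightarrow> 'a mat \<Rightarrow> 'a mat" (infixl \<open>\<otimes>\<^sub>k\<close> 70) where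
  "A \<otimes>\<^sub>k B = mat (dim_row A * dim_row B) (dim_col A * dim_col B)
    (\<lambda>(i, j). A $$ (i div dim_row B, j div dim_col B) * B $$ (i mod dim_row B, j mod dim_col B))"

definition generated_set ::
  "nat \<Rightarrow> nat \<Rightarrow> (nat \<Rightarrow> nat) \<Rightarrow> (nat \<Rightarrow> wz_poly mat) \<Rightarrow> nat \<Rightarrow> wz_poly mat set" where
  "generated_set d k g P \<gamma> =
    {Q \<in> hermitian_polys d \<gamma>. \<exists>n H.
      n 0 \<ge> 1 \<and> H 0 \<in> z_mat_polys d (1 * n 0) \<gamma> \<and>
      (\<forall>j\<in>{1..k}. n j \<ge> 1 \<and> H j \<in> z_mat_polys d (g j * n j) \<gamma>) \<and>
      Q = star_at_w (H 0) * at_z (H 0) +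
        finsum (module_mat TYPE(wz_poly) \<gamma> \<gamma>)
          (\<lambda>j. star_at_w (H j) * (P j \<otimes>\<^sub>k 1\<^sub>m (n j)) * at_z (H j)) {1..k}}"


section \<open>Complex Hilbert spaces\<close>

text \<open>
  Hilbert spaces live on a carrier set, so that one can quantify over them inside a formula.
  The ring multiplication and unit, which the record of modules inherits, are irrelevant.
  The inner product is linear in its first argument.
\<close>

record 'h hilbert = "(complex, 'h) module" +
  hinner :: "'h \<Rightarrow> 'h \<Rightarrow> complex"

definition hnorm :: "('h, 'm) hilbert_scheme \<Rightarrow> 'h \<Rightarrow> real" where
  "hnorm H x = sqrt (Re (hinner H x x))"

locale complex_hilbert_space =
  vectorspace "class_ring :: complex ring" H for H :: "('h, 'm) hilbert_scheme" (structure) +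
  assumes hinner_add: "\<lbrakk>x \<in> carrier H; y \<in> carrier H; z \<in> carrier H\<rbrakk>
      \<Longrightarrow> hinner H (x \<oplus>\<^bsub>H\<^esub> y) z = hinner H x z + hinner H y z"
    and hinner_smult: "\<lbrakk>x \<in> carrier H; y \<in> carrier H\<rbrakk>
      \<Longrightarrow> hinner H (a \<odot>\<^bsub>H\<^esub> x) y = a * hinner H x y"
    and hinner_commute: "\<lbrakk>x \<in> carrier H; y \<in> carrier H\<rbrakk> \<Longrightarrow> hinner H y x = cnj (hinner H x y)"
    and hinner_pos: "\<lbrakk>x \<in> carrier H; x \<noteq> \<zero>\<^bsub>H\<^esub>\<rbrakk> \<Longrightarrow> hinner H x x > 0"
    and complete: "\<lbrakk>\<And>n. s n \<in> carrier H;
        \<And>e. e > 0 \<Longrightarrow> \<exists>N. \<forall>m\<ge>N. \<forall>n\<ge>N. hnorm H (s m \<ominus>\<^bsub>H\<^esub> s n) < e\<rbrakk>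
      \<Longrightarrow> \<exists>x\<in>carrier H. (\<lambda>n. hnorm H (s n \<ominus>\<^bsub>H\<^esub> x)) \<longlonglongrightarrow> 0"

definition bounded_operator :: "('h, 'm) hilbert_scheme \<Rightarrow> ('h \<Rightarrow> 'h) \<Rightarrow> bool" where
  "bounded_operator H A \<longleftrightarrow>
    A \<in> carrier H \<rightarrow> carrier H \<and>
    (\<forall>x\<in>carrier H. \<forall>y\<in>carrier H. A (x \<oplus>\<^bsub>H\<^esub> y) = A x \<oplus>\<^bsub>H\<^esub> A y) \<and>
    (\<forall>a. \<forall>x\<in>carrier H. A (a \<odot>\<^bsub>H\<^esub> x) = a \<odot>\<^bsub>H\<^esub> A x) \<and>
    (\<exists>C. \<forall>x\<in>carrier H. hnorm H (A x) \<le> C * hnorm H x)"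

definition hadjoint :: "('h, 'm) hilbert_scheme \<Rightarrow> ('h \<Rightarrow> 'h) \<Rightarrow> ('h \<Rightarrow> 'h)" where
  "hadjoint H A y =
    (THE z. z \<in> carrier H \<and> (\<forall>x\<in>carrier H. hinner H (A x) y = hinner H x z))"

text \<open>
  The relations below refer to the order of the complex numbers, in which \<open>0 \<le> a\<close> means that \<open>a\<close>
  is real and nonnegative. Hence a bounded operator satisfying either of them is self-adjoint.
\<close>

definition pos_semidefinite :: "('h, 'm) hilbert_scheme \<Rightarrow> ('h \<Rightarrow> 'h) \<Rightarrow> bool" where
  "pos_semidefinite H A \<longleftrightarrow> (\<forall>x\<in>carrier H. 0 \<le> hinner H (A x) x)"

definition pos_definite :: "('h, 'm) hilbert_scheme \<Rightarrow> ('h \<Rightarrow> 'h) \<Rightarrow> bool" where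
  "pos_definite H A \<longleftrightarrow> (\<forall>x\<in>carrier H. x \<noteq> \<zero>\<^bsub>H\<^esub> \<longrightarrow> 0 < hinner H (A x) x)"

text \<open>The Hilbert space $\mathbb{C}^\gamma \otimes \mathcal{H}$, realised as $\mathcal{H}^\gamma$;
  $e_b \otimes x$ corresponds to the family with \<open>x\<close> at position \<open>b\<close> and zero elsewhere.\<close>

definition hpower :: "nat \<Rightarrow> 'h hilbert \<Rightarrow> (nat \<Rightarrow> 'h) hilbert" where
  "hpower \<gamma> H = \<lparr>
    carrier = {..<\<gamma>} \<rightarrow>\<^sub>E carrier H,
    mult = undefined,
    one = undefined,
    zero = (\<lambda>b\<in>{..<\<gamma>}. \<zero>\<^bsub>H\<^esub>),
    add = (\<lambda>x y. \<lambda>b\<in>{..<\<gamma>}. x b \<oplus>\<^bsub>H\<^esub> y b),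
    smult = (\<lambda>a x. \<lambda>b\<in>{..<\<gamma>}. a \<odot>\<^bsub>H\<^esub> x b),
    hinner = (\<lambda>x y. \<Sum>b<\<gamma>. hinner H (x b) (y b))\<rparr>"

definition tensor_op :: "'h hilbert \<Rightarrow> complex mat \<Rightarrow> ('h \<Rightarrow> 'h) \<Rightarrow> (nat \<Rightarrow> 'h) \<Rightarrow> (nat \<Rightarrow> 'h)" where
  "tensor_op H M A x =
    (\<lambda>a\<in>{..<dim_row M}. finsum H (\<lambda>b. (M $$ (a, b)) \<odot>\<^bsub>H\<^esub> A (x b)) {..<dim_col M})"


section \<open>Hereditary evaluation\<close>

definition commuting_tuple :: "'h hilbert \<Rightarrow> nat \<Rightarrow> (nat \<Rightarrow> 'h \<Rightarrow> 'h) \<Rightarrow> bool" where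
  "commuting_tuple H d T \<longleftrightarrow>
    (\<forall>i<d. bounded_operator H (T i)) \<and>
    (\<forall>i<d. \<forall>j<d. \<forall>x\<in>carrier H. T i (T j x) = T j (T i x))"

text \<open>$T^\mu = T_1^{\mu_1} \cdots T_d^{\mu_d}$\<close>

definition op_monom :: "nat \<Rightarrow> (nat \<Rightarrow> 'h \<Rightarrow> 'h) \<Rightarrow> multi_index \<Rightarrow> 'h \<Rightarrow> 'h" where
  "op_monom d T \<mu> = foldr (\<lambda>i A. (T i ^^ Poly_Mapping.lookup \<mu> i) \<circ> A) [0..<d] id"

definition hereditary_eval ::
  "'h hilbert \<Rightarrow> nat \<Rightarrow> (nat \<Rightarrow> 'h \<Rightarrow> 'h) \<Rightarrow> wz_poly mat \<Rightarrow> (nat \<Rightarrow> 'h) \<Rightarrow> (nat \<Rightarrow> 'h)" where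
  "hereditary_eval H d T P x =
    finsum (hpower (dim_row P) H)
      (\<lambda>(\<kappa>, \<mu>). tensor_op H (mat_coeff P \<kappa> \<mu>)
        (op_monom d (\<lambda>i. hadjoint H (T i)) \<kappa> \<circ> op_monom d T \<mu>) x)
      (\<Union>p\<in>elements_mat P. Poly_Mapping.keys p)"

end

theory Submission
  imports
    Defs
    "HOL-Analysis.Abstract_Topology_2"
    "HOL-Analysis.Elementary_Normed_Spaces"
    "HOL-Library.Function_Algebras"
begin

text \<open>
  The theorem is proved by separation and a GNS construction. If \<open>Q\<close> does not belong to
  $\mathcal{M}_\gamma$, a linear functional \<open>L\<close> separates it from that cone, and \<open>L\<close> is turned into a
  commuting tuple that satisfies all the constraints and at which \<open>Q\<close> is not positive.

  Separation (\<open>cone_separation\<close>) takes place in a vector space without topology and uses an algebraic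
  interior point of the cone. The archimedean hypothesis provides one, the identity matrix
  (\<open>order_unit\<close>). Indeed, sandwiching
  $c^2 - w_i z_i \in \mathcal{M}_1$ between $h^*(w)$ and $h(z)$ shows that multiplication of a row
  vector \<open>h\<close> of polynomials by $z_i$ enlarges the square $h^*(w) h(z)$ at most by the factor $c^2$, so
  the squares of all rows with one monomial entry are dominated by multiples of the identity; by
  polarization the same holds for every matrix polynomial.

  Let \<open>L\<close> be a complex linear functional with nonnegative real part on the cone, with
  $\mathrm{Re}\,L(I) = 1$ and $\mathrm{Re}\,L(Q) \<le> 0$ (\<open>separating_functional\<close>). On the row vectors of
  polynomials, $\langle u, v\rangle = L(v^*(w) u(z))$ is a positive semidefinite form, for which
  multiplication by $z_i$ is bounded. The tuple \<open>T\<close> of the induced operators on the completion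
  commutes. For polynomial rows $X_1, \dots, X_m$ and an $m \times m$ matrix polynomial \<open>R\<close>,
  the quadratic form of $R(T^*, T)$ at $(X_1, \dots, X_m)$ is $L(X^*(w) R(w, z) X(z))$
  (\<open>L_gram_expansion\<close>). For $R = P_j$ this is nonnegative because $X^* P_j X$ lies in the cone, and
  $P_j(T^*, T) \<ge> 0$ follows by density. For $R = Q$ and the tuple of the constant unit rows the value is
  $L(Q)$, whose real part is not positive (\<open>cyclic_vector\<close>): this contradicts the hypothesis on \<open>Q\<close>.

  The hypothesis speaks of Hilbert spaces carried by subsets of one given type, which is at least as
  large as the continuum. The completion is therefore realised as the space of bounded antilinear
  functionals on the polynomial rows. Such a functional is determined by its values on the countably many monomial rows,
  hence there are at most continuum many of them and they can be relabelled by elements of that type.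
  This realisation also makes adjoints explicit: the adjoint of the operator induced by \<open>A\<close> is
  composition with \<open>A\<close>.

  Matrix polynomials are handled as functions \<open>nat \<Rightarrow> nat \<Rightarrow> wz_poly\<close>, of which only the entries below
  the size in question matter, so that they form an abelian group. Likewise polynomials in any number
  of variables are admitted throughout, and the substitution \<open>prune d\<close> of zero for the variables of
  index at least \<open>d\<close> takes care of the difference.
\<close>

(* mat is the constructor of matrices with explicit dimensions throughout *)
hide_const (open) Finite_Cartesian_Product.mat

section \<open>Separating a point from a convex cone with an order unit\<close>

text \<open>
  Zorn's lemma applied to the cones that contain \<open>C\<close> and \<open>- q\<close> but not \<open>- e\<close>. Maximality makes such a cone
  decide the sign of every vector, which is what a linear functional has to do.
\<close>

lemma maximal_proper_cone:
  fixes sc :: "real \<Rightarrow> 'b::ab_group_add \<Rightarrow> 'b"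
  assumes vs: "vector_space sc"
    and C_add: "\<And>x y. x \<in> C \<Longrightarrow> y \<in> C \<Longrightarrow> x + y \<in> C"
    and C_scale: "\<And>r x. 0 \<le> r \<Longrightarrow> x \<in> C \<Longrightarrow> sc r x \<in> C"
    and e: "e \<in> C"
    and unit: "\<And>x. \<exists>r. sc r e - x \<in> C"
    and q: "q \<notin> C"
  obtains K where "C \<subseteq> K" "- q \<in> K" "- e \<notin> K" "\<And>x. x \<in> K \<or> - x \<in> K"
    "\<And>x y. x \<in> K \<Longrightarrow> y \<in> K \<Longrightarrow> x + y \<in> K"
    "\<And>r x. 0 \<le> r \<Longrightarrow> x \<in> K \<Longrightarrow> sc r x \<in> K"
proof -
  interpret V: vector_space sc by (rule vs)
  have zero: "0 \<in> C" using C_scale[of 0 e] e by simp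
  define cone where "cone K \<longleftrightarrow> (\<forall>x\<in>K. \<forall>y\<in>K. x + y \<in> K) \<and> (\<forall>r\<ge>0. \<forall>x\<in>K. sc r x \<in> K)" for K
  define A where "A = {K. C \<subseteq> K \<and> - q \<in> K \<and> - e \<notin> K \<and> cone K}"
  \<comment> \<open>the starting point of Zorn's lemma: the cone generated by \<open>C\<close> and \<open>- q\<close>\<close>
  define K0 where "K0 = {m - sc t q | m t. m \<in> C \<and> 0 \<le> t}"
  have e_neg: "- e \<notin> C"
  proof
    assume m: "- e \<in> C"
    obtain r where r: "sc r e - (- q) \<in> C" using unit by blast
    have "sc \<bar>r\<bar> (- e) + (sc (\<bar>r\<bar> - r) e + (sc r e - (- q))) \<in> C"
      using r m e by (intro C_add C_scale) auto
    also have "sc \<bar>r\<bar> (- e) + (sc (\<bar>r\<bar> - r) e + (sc r e - (- q))) = q"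
      by (simp add: V.scale_left_diff_distrib)
    finally show False using q by simp
  qed
  have "K0 \<in> A"
  proof -
    have "m \<in> K0" if "m \<in> C" for m
    proof -
      have "m = m - sc 0 q" by simp
      then show ?thesis unfolding K0_def using that by blast
    qed
    moreover have "- q \<in> K0"
    proof -
      have "- q = 0 - sc 1 q" by simp
      then show ?thesis unfolding K0_def using zero zero_le_one by blast
    qed
    moreover have "- e \<notin> K0"
    proof
      assume "- e \<in> K0"
      then obtain m t where m: "m \<in> C" "0 \<le> t" "- e = m - sc t q" by (auto simp: K0_def)
      then have tq: "sc t q = m + e" by (simp add: algebra_simps)
      show False
      proof (cases "t = 0")
        case True
        then show False using m e_neg by simp
      next
        case False
        have "sc (inverse t) (m + e) \<in> C" using m e C_add C_scale by simp
        then show False using False q by (simp add: tq[symmetric])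
      qed
    qed
    moreover have "cone K0" unfolding cone_def
    proof (intro conjI ballI allI impI)
      fix x y assume "x \<in> K0" "y \<in> K0"
      then obtain m t n s where "m \<in> C" "0 \<le> t" "x = m - sc t q" "n \<in> C" "0 \<le> s" "y = n - sc s q"
        by (auto simp: K0_def)
      then show "x + y \<in> K0" unfolding K0_def
        by (auto intro!: exI[of _ "m + n"] exI[of _ "t + s"] C_add simp: V.scale_left_distrib)
    next
      fix r x assume "0 \<le> (r::real)" "x \<in> K0"
      then obtain m t where "m \<in> C" "0 \<le> t" "x = m - sc t q" by (auto simp: K0_def)
      then show "sc r x \<in> K0" unfolding K0_def using \<open>0 \<le> r\<close>
        by (auto intro!: exI[of _ "sc r m"] exI[of _ "r * t"] C_scale simp: V.scale_right_diff_distrib)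
    qed
    ultimately show ?thesis by (auto simp: A_def)
  qed
  have "\<exists>K\<in>A. \<forall>X\<in>A. K \<subseteq> X \<longrightarrow> X = K"
  proof (rule subset_Zorn_nonempty)
    show "A \<noteq> {}" using \<open>K0 \<in> A\<close> by auto
    fix \<C> assume ne: "\<C> \<noteq> {}" and ch: "subset.chain A \<C>"
    have sub: "\<C> \<subseteq> A" and lin: "\<And>X Y. X \<in> \<C> \<Longrightarrow> Y \<in> \<C> \<Longrightarrow> X \<subseteq> Y \<or> Y \<subseteq> X"
      using ch by (auto simp: subset_chain_def)
    have "cone (\<Union>\<C>)" unfolding cone_def
    proof (intro conjI ballI allI impI)
      fix x y assume "x \<in> \<Union>\<C>" "y \<in> \<Union>\<C>"
      then obtain X Y where X: "X \<in> \<C>" "x \<in> X" "Y \<in> \<C>" "y \<in> Y" by auto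
      then obtain Z where Z: "Z \<in> \<C>" "x \<in> Z" "y \<in> Z" using lin by (metis subsetD)
      then have "x + y \<in> Z" using sub by (auto simp: A_def cone_def)
      then show "x + y \<in> \<Union>\<C>" using Z by auto
    next
      fix r x assume "0 \<le> (r::real)" "x \<in> \<Union>\<C>"
      then obtain X where "X \<in> \<C>" "x \<in> X" by auto
      then show "sc r x \<in> \<Union>\<C>" using sub \<open>0 \<le> r\<close> by (intro UnionI[of X]) (auto simp: A_def cone_def)
    qed
    then show "\<Union>\<C> \<in> A" using ne sub by (auto simp: A_def)
  qed
  then obtain K where K: "K \<in> A" and max: "\<And>X. X \<in> A \<Longrightarrow> K \<subseteq> X \<Longrightarrow> X = K" by blast
  have K_add: "x + y \<in> K" if "x \<in> K" "y \<in> K" for x y using K that by (auto simp: A_def cone_def)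
  have K_scale: "sc r x \<in> K" if "0 \<le> r" "x \<in> K" for r x using K that by (auto simp: A_def cone_def)
  have K_neg: "- e \<notin> K" and K_e: "e \<in> K" and K_zero: "0 \<in> K" and K_q: "- q \<in> K" and CK: "C \<subseteq> K"
    using K e zero by (auto simp: A_def)
  \<comment> \<open>if \<open>x\<close> cannot be adjoined to the maximal cone, this is because it would bring in \<open>- e\<close>\<close>
  have adjoin: "\<exists>m\<in>K. \<exists>t>0. - e = m + sc t x" if "x \<notin> K" for x
  proof -
    define X where "X = {m + sc t x | m t. m \<in> K \<and> 0 \<le> t}"
    have KX: "m \<in> X" if "m \<in> K" for m
    proof -
      have "m = m + sc 0 x" by simp
      then show ?thesis unfolding X_def using that by blast
    qed
    have "x = 0 + sc 1 x" by simp
    then have "x \<in> X" unfolding X_def using K_zero zero_le_one by blast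
    then have "X \<notin> A" using max[of X] KX that by auto
    moreover have "cone X" unfolding cone_def
    proof (intro conjI ballI allI impI)
      fix u v assume "u \<in> X" "v \<in> X"
      then obtain m t n s where "m \<in> K" "0 \<le> t" "u = m + sc t x" "n \<in> K" "0 \<le> s" "v = n + sc s x"
        by (auto simp: X_def)
      then show "u + v \<in> X" unfolding X_def
        by (auto intro!: exI[of _ "m + n"] exI[of _ "t + s"] K_add simp: V.scale_left_distrib algebra_simps)
    next
      fix r u assume "0 \<le> (r::real)" "u \<in> X"
      then obtain m t where "m \<in> K" "0 \<le> t" "u = m + sc t x" by (auto simp: X_def)
      then show "sc r u \<in> X" unfolding X_def using \<open>0 \<le> r\<close>
        by (auto intro!: exI[of _ "sc r m"] exI[of _ "r * t"] K_scale simp: V.scale_right_distrib)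
    qed
    ultimately have "- e \<in> X" using KX CK K_q by (auto simp: A_def)
    then obtain m t where m: "m \<in> K" "0 \<le> t" "- e = m + sc t x" by (auto simp: X_def)
    moreover have "t \<noteq> 0" using m K_neg by auto
    ultimately show ?thesis by force
  qed
  have total: "x \<in> K \<or> - x \<in> K" for x
  proof (rule ccontr)
    assume "\<not> ?thesis"
    then obtain m t n s where m: "m \<in> K" "0 < t" "- e = m + sc t x" and n: "n \<in> K" "0 < s" "- e = n + sc s (- x)"
      using adjoin by meson
    have "sc (s + t) (- e) = sc s (- e) + sc t (- e)" by (rule V.scale_left_distrib)
    also have "\<dots> = sc s (m + sc t x) + sc t (n + sc s (- x))" using m(3) n(3) by simp
    also have "\<dots> = sc s m + sc t n" by (simp add: V.scale_right_distrib V.scale_right_diff_distrib mult.commute)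
    also have "\<dots> \<in> K" using m(1,2) n(1,2) by (intro K_add K_scale) auto
    finally have "sc (s + t) (- e) \<in> K" .
    then have "sc (inverse (s + t)) (sc (s + t) (- e)) \<in> K"
      by (rule K_scale[rotated]) (use m(2) n(2) in simp)
    moreover have "sc (inverse (s + t)) (sc (s + t) (- e)) = - e"
      using m(2) n(2) by (subst V.scale_scale) simp
    ultimately show False using K_neg by simp
  qed
  show ?thesis by (rule that[of K]) (use CK K_q K_neg total K_add K_scale in auto)
qed

text \<open>
  The functional is read off from the maximal cone \<open>K\<close> as $l(x) = \sup \{r.\; x - r e \in K\}$. The order
  unit makes the supremum finite, and since \<open>K\<close> contains \<open>x\<close> or \<open>- x\<close> for each \<open>x\<close>, the supremum is also the
  infimum of the \<open>r\<close> with $r e - x \in K$. The first description gives superadditivity, the second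
  subadditivity.
\<close>

theorem cone_separation:
  fixes sc :: "real \<Rightarrow> 'b::ab_group_add \<Rightarrow> 'b"
  assumes vs: "vector_space sc"
    and C_add: "\<And>x y. x \<in> C \<Longrightarrow> y \<in> C \<Longrightarrow> x + y \<in> C"
    and C_scale: "\<And>r x. 0 \<le> r \<Longrightarrow> x \<in> C \<Longrightarrow> sc r x \<in> C"
    and e: "e \<in> C"
    and unit: "\<And>x. \<exists>r. sc r e - x \<in> C"
    and q: "q \<notin> C"
  obtains l where "\<And>x y. l (x + y) = l x + l y" "\<And>r x. l (sc r x) = r * l x"
    "\<And>x. x \<in> C \<Longrightarrow> 0 \<le> l x" "l e = (1::real)" "l q \<le> 0"
proof -
  interpret V: vector_space sc by (rule vs)
  obtain K where CK: "C \<subseteq> K" and K_q: "- q \<in> K" and K_neg: "- e \<notin> K"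
    and total: "\<And>x. x \<in> K \<or> - x \<in> K"
    and K_add: "\<And>x y. x \<in> K \<Longrightarrow> y \<in> K \<Longrightarrow> x + y \<in> K"
    and K_scale: "\<And>r x. 0 \<le> r \<Longrightarrow> x \<in> K \<Longrightarrow> sc r x \<in> K"
  proof (rule maximal_proper_cone[of sc C e q])
    show "x + y \<in> C" if "x \<in> C" "y \<in> C" for x y using that by (rule C_add)
    show "sc r x \<in> C" if "0 \<le> r" "x \<in> C" for r x using that by (rule C_scale)
  qed (use vs e q unit in auto)
  define l where "l x = Sup {r. x - sc r e \<in> K}" for x
  have order: "r \<le> s" if "x - sc r e \<in> K" "sc s e - x \<in> K" for r s x
  proof (rule ccontr)
    assume "\<not> r \<le> s"
    then have "sc (inverse (r - s)) ((x - sc r e) + (sc s e - x)) \<in> K"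
      using that by (intro K_scale K_add) auto
    also have "(x - sc r e) + (sc s e - x) = sc (r - s) (- e)"
      by (simp add: V.scale_left_diff_distrib)
    also have "sc (inverse (r - s)) (sc (r - s) (- e)) = - e"
      using \<open>\<not> r \<le> s\<close> by (subst V.scale_scale) simp
    finally show False using K_neg by simp
  qed
  have bdd: "bdd_above {r. x - sc r e \<in> K}" for x
  proof -
    obtain s where "sc s e - x \<in> K" using unit CK by blast
    then show ?thesis using order by (auto simp: bdd_above_def)
  qed
  have ne: "{r. x - sc r e \<in> K} \<noteq> {}" for x
  proof -
    obtain s where "sc s e - (- x) \<in> K" using unit CK by blast
    then have "x - sc (- s) e \<in> K" by (simp add: add.commute)
    then show ?thesis by blast
  qed
  have lower: "r \<le> l x" if "x - sc r e \<in> K" for r x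
    unfolding l_def using that by (intro cSup_upper bdd) simp
  have upper: "l x \<le> s" if "sc s e - x \<in> K" for s x
    unfolding l_def by (intro cSup_least ne) (use order that in auto)
  have below: "x - sc r e \<in> K" if "r < l x" for r x
  proof -
    have "- (x - sc r e) \<notin> K" using upper[of r x] that by auto
    then show ?thesis using total by blast
  qed
  have above: "sc s e - x \<in> K" if "l x < s" for s x
  proof -
    have "x - sc s e \<notin> K" using lower[of x s] that by auto
    then have "- (x - sc s e) \<in> K" using total by blast
    then show ?thesis by simp
  qed
  have add: "l (x + y) = l x + l y" for x y
  proof (rule antisym)
    show "l (x + y) \<le> l x + l y"
    proof (rule field_le_epsilon)
      fix \<epsilon> :: real assume "0 < \<epsilon>"
      then have "(sc (l x + \<epsilon>/2) e - x) + (sc (l y + \<epsilon>/2) e - y) \<in> K"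
        by (intro K_add above) auto
      also have "(sc (l x + \<epsilon>/2) e - x) + (sc (l y + \<epsilon>/2) e - y)
          = (sc (l x + \<epsilon>/2) e + sc (l y + \<epsilon>/2) e) - (x + y)" by (simp add: algebra_simps)
      also have "sc (l x + \<epsilon>/2) e + sc (l y + \<epsilon>/2) e = sc (l x + l y + \<epsilon>) e"
        by (subst V.scale_left_distrib[symmetric]) simp
      finally show "l (x + y) \<le> l x + l y + \<epsilon>" by (rule upper)
    qed
    show "l x + l y \<le> l (x + y)"
    proof (rule field_le_epsilon)
      fix \<epsilon> :: real assume "0 < \<epsilon>"
      then have "(x - sc (l x - \<epsilon>/2) e) + (y - sc (l y - \<epsilon>/2) e) \<in> K"
        by (intro K_add below) auto
      also have "(x - sc (l x - \<epsilon>/2) e) + (y - sc (l y - \<epsilon>/2) e)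
          = (x + y) - (sc (l x - \<epsilon>/2) e + sc (l y - \<epsilon>/2) e)" by (simp add: algebra_simps)
      also have "sc (l x - \<epsilon>/2) e + sc (l y - \<epsilon>/2) e = sc (l x + l y - \<epsilon>) e"
        by (subst V.scale_left_distrib[symmetric]) simp
      finally show "l x + l y \<le> l (x + y) + \<epsilon>" using lower by fastforce
    qed
  qed
  have l0: "l 0 = 0" using add[of 0 0] by simp
  have neg: "l (- x) = - l x" for x using add[of x "- x"] l0 by simp
  have scale_pos: "l (sc r x) = r * l x" if r: "0 < r" for r x
  proof (rule antisym)
    show "l (sc r x) \<le> r * l x"
    proof (rule field_le_epsilon)
      fix \<epsilon> :: real assume "0 < \<epsilon>"
      then have "sc r (sc (l x + \<epsilon>/r) e - x) \<in> K" using r by (intro K_scale above) auto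
      also have "sc r (sc (l x + \<epsilon>/r) e - x) = sc (r * l x + \<epsilon>) e - sc r x"
        using r by (simp add: V.scale_right_diff_distrib distrib_left right_diff_distrib)
      finally show "l (sc r x) \<le> r * l x + \<epsilon>" by (rule upper)
    qed
    show "r * l x \<le> l (sc r x)"
    proof (rule field_le_epsilon)
      fix \<epsilon> :: real assume "0 < \<epsilon>"
      then have "sc r (x - sc (l x - \<epsilon>/r) e) \<in> K" using r by (intro K_scale below) auto
      also have "sc r (x - sc (l x - \<epsilon>/r) e) = sc r x - sc (r * l x - \<epsilon>) e"
        using r by (simp add: V.scale_right_diff_distrib distrib_left right_diff_distrib)
      finally show "r * l x \<le> l (sc r x) + \<epsilon>" using lower by fastforce
    qed
  qed
  have scale: "l (sc r x) = r * l x" for r x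
  proof (cases "r = 0 \<or> 0 < r")
    case True
    then show ?thesis using scale_pos l0 by auto
  next
    case False
    then have "l (sc (- r) x) = - r * l x" using scale_pos[of "- r" x] by simp
    then show ?thesis using neg[of "sc r x"] by simp
  qed
  have pos: "0 \<le> l x" if "x \<in> K" for x using lower[of x 0] that by simp
  have K_zero: "0 \<in> K" using K_scale[of 0 e] e CK by auto
  have "l e = 1" using lower[of e 1] upper[of 1 e] K_zero by simp
  moreover have "l q \<le> 0" using pos[OF K_q] neg[of q] by simp
  ultimately show ?thesis using that[of l] add scale pos CK by blast
qed

section \<open>The completion of a semi-inner product space as its antidual\<close>

text \<open>
  The inequality behind the Cauchy-Schwarz inequality and behind the Riesz theorem below: both come from
  perturbing a vector by a real multiple of another one.
\<close>

lemma discriminant_bound: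
  fixes s c m :: real
  assumes "0 \<le> s" "0 \<le> c" "0 \<le> m" and pos: "\<And>t. 0 \<le> t\<^sup>2 * s * c - 2 * t * s + m"
  shows "s \<le> m * c"
proof (cases "c = 0")
  case True
  show ?thesis
  proof (rule ccontr)
    assume "\<not> ?thesis"
    then have "s > 0" using True by simp
    then show False using pos[of "(m + 1) / s"] True \<open>0 \<le> m\<close> by simp
  qed
next
  case False
  then have c: "c > 0" using assms by simp
  then have "0 \<le> (1/c)\<^sup>2 * s * c - 2 * (1/c) * s + m" using pos by blast
  also have "\<dots> = m - s / c" using c by (simp add: power2_eq_square field_simps)
  finally show ?thesis using c by (simp add: field_simps)
qed

locale semi_inner_space = vector_space sc
  for sc :: "complex \<Rightarrow> 'v::ab_group_add \<Rightarrow> 'v" +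
  fixes B :: "'v \<Rightarrow> 'v \<Rightarrow> complex"
  assumes B_add: "B (u + u') v = B u v + B u' v"
    and B_scale: "B (sc a u) v = a * B u v"
    and B_cnj: "B v u = cnj (B u v)"
    and B_nonneg: "0 \<le> Re (B u u)"
begin

lemma B_add_right: "B u (v + v') = B u v + B u v'"
  using B_add[of v v' u] B_cnj by (metis complex_cnj_add)

lemma B_scale_right: "B u (sc a v) = cnj a * B u v"
  using B_scale[of a v u] B_cnj by (metis complex_cnj_mult)

lemma B_minus: "B (- u) v = - B u v"
  using B_scale[of "-1" u v] by simp

lemma B_diff: "B (u - u') v = B u v - B u' v"
  using B_add[of u "- u'" v] B_minus by simp

definition seminorm :: "'v \<Rightarrow> real" where
  "seminorm u = sqrt (Re (B u u))"

lemma seminorm_nonneg: "0 \<le> seminorm u"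
  by (simp add: seminorm_def B_nonneg)

lemma seminorm_sq: "of_real ((seminorm u)\<^sup>2) = B u u"
proof -
  have "Im (B u u) = 0" using arg_cong[OF B_cnj[of u u], of Im] by simp
  then show ?thesis by (simp add: seminorm_def B_nonneg complex_eq_iff)
qed

lemma B_perturb:
  "Re (B (u + sc c v) (u + sc c v)) = Re (B u u) + (cmod c)\<^sup>2 * Re (B v v) + 2 * Re (cnj c * B u v)"
proof -
  have "B (u + sc c v) (u + sc c v) = B u u + cnj c * B u v + (c * B v u + c * cnj c * B v v)"
    by (simp add: B_add B_add_right B_scale B_scale_right algebra_simps)
  moreover have "c * cnj c = of_real ((cmod c)\<^sup>2)" by (rule complex_norm_square[symmetric])
  moreover have "c * B v u = cnj (cnj c * B u v)" using B_cnj[of v u] by simp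
  ultimately show ?thesis by simp
qed

lemma B_Cauchy_Schwarz: "cmod (B u v) \<le> seminorm u * seminorm v"
proof -
  have "(cmod (B u v))\<^sup>2 \<le> Re (B u u) * Re (B v v)"
  proof (rule discriminant_bound)
    fix t :: real
    have "cnj (- of_real t * B u v) * B u v = - of_real (t * (cmod (B u v))\<^sup>2)"
      using complex_norm_square[of "B u v"] by (simp add: mult.commute)
    from arg_cong[OF this, of Re]
    have "Re (cnj (- of_real t * B u v) * B u v) = - (t * (cmod (B u v))\<^sup>2)"
      by (simp only: uminus_complex.simps Re_complex_of_real)
    then show "0 \<le> t\<^sup>2 * (cmod (B u v))\<^sup>2 * Re (B v v) - 2 * t * (cmod (B u v))\<^sup>2 + Re (B u u)"
      using B_perturb[of u "- of_real t * B u v" v] B_nonneg[of "u + sc (- of_real t * B u v) v"]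
      by (simp add: norm_mult power_mult_distrib)
  qed (use B_nonneg in auto)
  then have "(cmod (B u v))\<^sup>2 \<le> (seminorm u * seminorm v)\<^sup>2"
    by (simp add: seminorm_def power_mult_distrib B_nonneg)
  then show ?thesis
    by (rule power2_le_imp_le) (simp add: seminorm_nonneg)
qed

lemma le_seminorm_cancel: "seminorm u \<le> c" if "cmod (B u u) \<le> c * seminorm u" "0 \<le> c"
proof (cases "seminorm u = 0")
  case False
  have "cmod (B u u) = (seminorm u)\<^sup>2" using seminorm_sq[of u] by (metis norm_of_real abs_power2)
  then show ?thesis using that False seminorm_nonneg[of u] by (simp add: power2_eq_square)
qed (use that in simp)

definition antilinear :: "('v \<Rightarrow> complex) \<Rightarrow> bool" where
  "antilinear f \<longleftrightarrow> (\<forall>u v. f (u + v) = f u + f v) \<and> (\<forall>a u. f (sc a u) = cnj a * f u)"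

definition dual :: "('v \<Rightarrow> complex) set" where
  "dual = {f. antilinear f \<and> (\<exists>c. \<forall>v. cmod (f v) \<le> c * seminorm v)}"

lemma dual_add: "f \<in> dual \<Longrightarrow> f (u + v) = f u + f v"
  and dual_scale: "f \<in> dual \<Longrightarrow> f (sc a u) = cnj a * f u"
  by (auto simp: dual_def antilinear_def)

lemma dual_diff: "f \<in> dual \<Longrightarrow> f (u - v) = f u - f v"
  using dual_add[of f "u - v" v] by simp

lemma dualI:
  assumes "\<And>u v. f (u + v) = f u + f v" "\<And>a u. f (sc a u) = cnj a * f u"
    "\<And>v. cmod (f v) \<le> c * seminorm v"
  shows "f \<in> dual"
  using assms by (auto simp: dual_def antilinear_def)

lemma dual_bound:
  assumes "f \<in> dual"
  obtains c where "0 \<le> c" "\<And>v. cmod (f v) \<le> c * seminorm v"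
proof -
  obtain c where c: "\<And>v. cmod (f v) \<le> c * seminorm v" using assms by (auto simp: dual_def)
  have "cmod (f v) \<le> max 0 c * seminorm v" for v
    using c[of v] mult_right_mono[OF max.cobounded2[of c 0] seminorm_nonneg[of v]] by linarith
  then show ?thesis using that[of "max 0 c"] by auto
qed

lemma dual_plus: "f \<in> dual \<Longrightarrow> g \<in> dual \<Longrightarrow> (\<lambda>v. f v + g v) \<in> dual"
proof -
  assume fg: "f \<in> dual" "g \<in> dual"
  obtain c where c: "\<And>v. cmod (f v) \<le> c * seminorm v" using fg dual_bound by blast
  obtain c' where c': "\<And>v. cmod (g v) \<le> c' * seminorm v" using fg dual_bound by blast
  show ?thesis
  proof (rule dualI[of _ "c + c'"])
    show "cmod (f v + g v) \<le> (c + c') * seminorm v" for v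
      using c[of v] c'[of v] norm_triangle_ineq[of "f v" "g v"] by (simp add: distrib_right)
  qed (use fg in \<open>auto simp: dual_add dual_scale algebra_simps\<close>)
qed

lemma dual_times: "f \<in> dual \<Longrightarrow> (\<lambda>v. a * f v) \<in> dual"
proof -
  assume f: "f \<in> dual"
  obtain c where c: "\<And>v. cmod (f v) \<le> c * seminorm v" using f dual_bound by blast
  show ?thesis
  proof (rule dualI[of _ "cmod a * c"])
    show "cmod (a * f v) \<le> (cmod a * c) * seminorm v" for v
      using mult_left_mono[OF c[of v] norm_ge_zero[of a]] by (simp add: norm_mult mult.assoc)
  qed (use f in \<open>auto simp: dual_add dual_scale algebra_simps\<close>)
qed

lemma dual_minus: "f \<in> dual \<Longrightarrow> g \<in> dual \<Longrightarrow> (\<lambda>v. f v - g v) \<in> dual"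
  using dual_plus[of f "\<lambda>v. -1 * g v"] dual_times[of g "-1"] by simp

lemma dual_zero: "(\<lambda>v. 0) \<in> dual"
  by (rule dualI[of _ 0]) auto

lemma B_dual: "B u \<in> dual"
  by (rule dualI[of _ "seminorm u"]) (auto simp: B_add_right B_scale_right B_Cauchy_Schwarz)

text \<open>
  The distance of \<open>f\<close> from the functional represented by \<open>u\<close> in the dual norm is at most \<open>\<epsilon>\<close>.
\<close>

definition close :: "('v \<Rightarrow> complex) \<Rightarrow> 'v \<Rightarrow> real \<Rightarrow> bool" where
  "close f u \<epsilon> \<longleftrightarrow> (\<forall>v. cmod (f v - B u v) \<le> \<epsilon> * seminorm v)"

text \<open>
  The Riesz representation theorem in approximate form. In an incomplete space the functional
  $J(u) = \|u\|^2 - 2\,\mathrm{Re}\,f(u)$ need not attain its infimum, but at an almost minimal point its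
  first variation, which is the difference between \<open>f\<close> and \<open>B u\<close>, is small.
\<close>

lemma ex_close:
  assumes f: "f \<in> dual" and e: "0 < \<epsilon>"
  shows "\<exists>u. close f u \<epsilon>"
proof -
  define J where "J u = Re (B u u) - 2 * Re (f u)" for u
  obtain c where c: "0 \<le> c" "\<And>v. cmod (f v) \<le> c * seminorm v" using f dual_bound by blast
  have "- (c\<^sup>2) \<le> J u" for u
  proof -
    have "0 \<le> (seminorm u - c)\<^sup>2" by simp
    also have "\<dots> = Re (B u u) - 2 * (c * seminorm u) + c\<^sup>2"
      by (simp add: power2_diff seminorm_def B_nonneg mult.commute)
    also have "\<dots> \<le> J u + c\<^sup>2"
      using c(2)[of u] complex_Re_le_cmod[of "f u"] by (simp add: J_def)
    finally show ?thesis by simp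
  qed
  then have bdd: "bdd_below (range J)" by (auto simp: bdd_below_def)
  have "\<exists>x\<in>range J. x < Inf (range J) + \<epsilon>\<^sup>2"
    by (rule cInf_lessD) (use e in auto)
  then obtain u where u: "J u < Inf (range J) + \<epsilon>\<^sup>2" by blast
  have "cmod (f v - B u v) \<le> \<epsilon> * seminorm v" for v
  proof -
    define z where "z = B u v - f v"
    have "(cmod z)\<^sup>2 \<le> \<epsilon>\<^sup>2 * Re (B v v)"
    proof (rule discriminant_bound)
      fix t :: real
      \<comment> \<open>the phase of \<open>z\<close> makes the first variation real, namely $- 2 t |z|^2$\<close>
      define a where "a = - of_real t * z"
      have "J (u + sc a v) = J u + (cmod a)\<^sup>2 * Re (B v v) + 2 * Re (cnj a * z)"
        unfolding J_def B_perturb by (simp add: dual_add[OF f] dual_scale[OF f] z_def algebra_simps)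
      also have "cnj a * z = - of_real (t * (cmod z)\<^sup>2)"
        using complex_norm_square[of z] by (simp add: a_def mult.commute)
      also have "(cmod a)\<^sup>2 = t\<^sup>2 * (cmod z)\<^sup>2" by (simp add: a_def norm_mult power_mult_distrib)
      finally have "J (u + sc a v) = J u + t\<^sup>2 * (cmod z)\<^sup>2 * Re (B v v) - 2 * t * (cmod z)\<^sup>2"
        by simp
      moreover have "Inf (range J) \<le> J (u + sc a v)" by (rule cInf_lower[OF _ bdd]) simp
      ultimately show "0 \<le> t\<^sup>2 * (cmod z)\<^sup>2 * Re (B v v) - 2 * t * (cmod z)\<^sup>2 + \<epsilon>\<^sup>2"
        using u by simp
    qed (use B_nonneg in auto)
    then have "(cmod z)\<^sup>2 \<le> (\<epsilon> * seminorm v)\<^sup>2"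
      by (simp add: seminorm_def power_mult_distrib B_nonneg)
    then have "cmod z \<le> \<epsilon> * seminorm v"
      by (rule power2_le_imp_le) (use e seminorm_nonneg in auto)
    then show ?thesis by (simp add: z_def norm_minus_commute)
  qed
  then show ?thesis unfolding close_def by blast
qed

lemma close_B: "close (B u) u 0"
  by (simp add: close_def)

lemma close_seminorm_diff:
  assumes "close f u \<epsilon>" "close f v \<delta>" "0 \<le> \<epsilon>" "0 \<le> \<delta>"
  shows "seminorm (u - v) \<le> \<epsilon> + \<delta>"
proof (rule le_seminorm_cancel)
  have "cmod (B (u - v) (u - v)) = cmod ((f (u - v) - B v (u - v)) - (f (u - v) - B u (u - v)))"
    by (simp add: B_diff)
  also have "\<dots> \<le> cmod (f (u - v) - B v (u - v)) + cmod (f (u - v) - B u (u - v))"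
    by (rule norm_triangle_ineq4)
  also have "\<dots> \<le> \<delta> * seminorm (u - v) + \<epsilon> * seminorm (u - v)"
    using assms by (intro add_mono) (auto simp: close_def)
  finally show "cmod (B (u - v) (u - v)) \<le> (\<epsilon> + \<delta>) * seminorm (u - v)"
    by (simp add: distrib_right)
qed (use assms in simp)

lemma close_seminorm_le:
  assumes "close f u \<epsilon>" "\<And>v. cmod (f v) \<le> c * seminorm v" "0 \<le> \<epsilon>" "0 \<le> c"
  shows "seminorm u \<le> c + \<epsilon>"
proof (rule le_seminorm_cancel)
  have "cmod (B u u) = cmod (f u - (f u - B u u))" by simp
  also have "\<dots> \<le> cmod (f u) + cmod (f u - B u u)" by (rule norm_triangle_ineq4)
  also have "\<dots> \<le> c * seminorm u + \<epsilon> * seminorm u"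
    using assms by (intro add_mono) (auto simp: close_def)
  finally show "cmod (B u u) \<le> (c + \<epsilon>) * seminorm u" by (simp add: distrib_right)
qed (use assms in simp)

definition approx :: "('v \<Rightarrow> complex) \<Rightarrow> nat \<Rightarrow> 'v" where
  "approx f n = (SOME u. close f u (inverse (real (Suc n))))"

lemma approx_close: "f \<in> dual \<Longrightarrow> close f (approx f n) (inverse (real (Suc n)))"
  unfolding approx_def by (rule someI_ex, rule ex_close) auto

text \<open>
  The inner product on the antidual that makes \<open>B\<close> an isometric embedding. The value does not depend on the
  approximating sequence (\<open>hin_limit\<close>).
\<close>

definition hin :: "('v \<Rightarrow> complex) \<Rightarrow> ('v \<Rightarrow> complex) \<Rightarrow> complex" where
  "hin f g = lim (\<lambda>n. f (approx g n))"

lemma hin_limit_approx: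
  assumes f: "f \<in> dual" and g: "g \<in> dual"
  shows "(\<lambda>n. f (approx g n)) \<longlonglongrightarrow> hin f g"
proof -
  obtain c where c: "0 \<le> c" "\<And>v. cmod (f v) \<le> c * seminorm v" using f dual_bound by blast
  have "Cauchy (\<lambda>n. f (approx g n))"
  proof (rule CauchyI)
    fix e :: real assume e: "0 < e"
    have "(\<lambda>n. c * (2 * inverse (real (Suc n)))) \<longlonglongrightarrow> c * (2 * 0)"
      by (intro tendsto_mult tendsto_const LIMSEQ_inverse_real_of_nat)
    then have "\<forall>\<^sub>F n in sequentially. c * (2 * inverse (real (Suc n))) < e"
      using e by (intro order_tendstoD) auto
    then obtain N where N: "c * (2 * inverse (real (Suc N))) < e"
      by (auto simp: eventually_sequentially)
    have "norm (f (approx g m) - f (approx g n)) < e" if "N \<le> m" "N \<le> n" for m n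
    proof -
      have "norm (f (approx g m) - f (approx g n)) \<le> c * seminorm (approx g m - approx g n)"
        using c dual_diff[OF f] by metis
      also have "\<dots> \<le> c * (inverse (real (Suc m)) + inverse (real (Suc n)))"
        using c(1) by (intro mult_left_mono close_seminorm_diff[OF approx_close[OF g] approx_close[OF g]]) auto
      also have "\<dots> \<le> c * (inverse (real (Suc N)) + inverse (real (Suc N)))"
        using c(1) that by (intro mult_left_mono add_mono le_imp_inverse_le) auto
      finally show ?thesis using N by simp
    qed
    then show "\<exists>M. \<forall>m\<ge>M. \<forall>n\<ge>M. norm (f (approx g m) - f (approx g n)) < e" by blast
  qed
  then show ?thesis unfolding hin_def
    by (simp add: Cauchy_convergent_iff convergent_LIMSEQ_iff)
qed

lemma hin_limit:
  assumes f: "f \<in> dual" and g: "g \<in> dual"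
    and s: "\<And>n. close g (s n) (\<epsilon> n)" "\<And>n. 0 \<le> \<epsilon> n" "\<epsilon> \<longlonglongrightarrow> 0"
  shows "(\<lambda>n. f (s n)) \<longlonglongrightarrow> hin f g"
proof -
  obtain c where c: "0 \<le> c" "\<And>v. cmod (f v) \<le> c * seminorm v" using f dual_bound by blast
  have "(\<lambda>n. c * (\<epsilon> n + inverse (real (Suc n)))) \<longlonglongrightarrow> c * (0 + 0)"
    by (intro tendsto_mult tendsto_add tendsto_const LIMSEQ_inverse_real_of_nat s)
  then have lim: "(\<lambda>n. c * (\<epsilon> n + inverse (real (Suc n)))) \<longlonglongrightarrow> 0" by simp
  have "(\<lambda>n. f (s n) - f (approx g n)) \<longlonglongrightarrow> 0"
  proof (rule Lim_null_comparison[OF _ lim], rule always_eventually, rule allI)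
    fix n
    have "norm (f (s n) - f (approx g n)) \<le> c * seminorm (s n - approx g n)"
      using c dual_diff[OF f] by metis
    also have "\<dots> \<le> c * (\<epsilon> n + inverse (real (Suc n)))"
      using c(1) s by (intro mult_left_mono close_seminorm_diff[OF _ approx_close[OF g]]) auto
    finally show "norm (f (s n) - f (approx g n)) \<le> c * (\<epsilon> n + inverse (real (Suc n)))" .
  qed
  from tendsto_add[OF this hin_limit_approx[OF f g]] show ?thesis by simp
qed

lemma hin_B_right: "f \<in> dual \<Longrightarrow> hin f (B u) = f u"
  using hin_limit[of f "B u" "\<lambda>_. u" "\<lambda>_. 0"] B_dual close_B
  by (simp add: LIMSEQ_const_iff)

lemma hin_limit_B:
  assumes f: "f \<in> dual" and g: "g \<in> dual"
  shows "(\<lambda>n. B (approx f n) (approx g n)) \<longlonglongrightarrow> hin f g"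
proof -
  obtain c where c: "0 \<le> c" "\<And>v. cmod (g v) \<le> c * seminorm v" using g dual_bound by blast
  let ?e = "\<lambda>n. inverse (real (Suc n))"
  have "(\<lambda>n. ?e n * (c + ?e n)) \<longlonglongrightarrow> 0 * (c + 0)"
    by (intro tendsto_mult tendsto_add tendsto_const LIMSEQ_inverse_real_of_nat)
  then have lim: "(\<lambda>n. ?e n * (c + ?e n)) \<longlonglongrightarrow> 0" by simp
  have "(\<lambda>n. f (approx g n) - B (approx f n) (approx g n)) \<longlonglongrightarrow> 0"
  proof (rule Lim_null_comparison[OF _ lim], rule always_eventually, rule allI)
    fix n
    have "norm (f (approx g n) - B (approx f n) (approx g n)) \<le> ?e n * seminorm (approx g n)"
      using approx_close[OF f, of n] by (simp add: close_def)
    also have "\<dots> \<le> ?e n * (c + ?e n)"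
      using c by (intro mult_left_mono close_seminorm_le[OF approx_close[OF g]]) auto
    finally show "norm (f (approx g n) - B (approx f n) (approx g n)) \<le> ?e n * (c + ?e n)" .
  qed
  from tendsto_diff[OF hin_limit_approx[OF f g] this] show ?thesis by simp
qed

lemma hin_cnj:
  assumes f: "f \<in> dual" and g: "g \<in> dual"
  shows "hin g f = cnj (hin f g)"
proof (rule LIMSEQ_unique[OF hin_limit_B[OF g f]])
  have "(\<lambda>n. cnj (B (approx f n) (approx g n))) \<longlonglongrightarrow> cnj (hin f g)"
    by (intro tendsto_cnj hin_limit_B f g)
  then show "(\<lambda>n. B (approx g n) (approx f n)) \<longlonglongrightarrow> cnj (hin f g)"
    by (simp add: B_cnj[symmetric])
qed

lemma hin_add:
  assumes "f \<in> dual" "f' \<in> dual" "g \<in> dual"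
  shows "hin (\<lambda>v. f v + f' v) g = hin f g + hin f' g"
  by (rule LIMSEQ_unique[OF hin_limit_approx])
     (use assms in \<open>auto intro!: dual_plus tendsto_add hin_limit_approx\<close>)

lemma hin_times:
  assumes "f \<in> dual" "g \<in> dual"
  shows "hin (\<lambda>v. a * f v) g = a * hin f g"
  by (rule LIMSEQ_unique[OF hin_limit_approx])
     (use assms in \<open>auto intro!: dual_times tendsto_mult hin_limit_approx\<close>)

lemma hin_add_right:
  assumes "f \<in> dual" "g \<in> dual" "g' \<in> dual"
  shows "hin f (\<lambda>v. g v + g' v) = hin f g + hin f g'"
  using hin_cnj[OF dual_plus[OF assms(2,3)] assms(1)] hin_cnj[OF assms(2,1)] hin_cnj[OF assms(3,1)]
    hin_add[OF assms(2,3,1)] by simp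

lemma hin_times_right:
  assumes "f \<in> dual" "g \<in> dual"
  shows "hin f (\<lambda>v. a * g v) = cnj a * hin f g"
  using hin_cnj[OF dual_times[OF assms(2)] assms(1)] hin_cnj[OF assms(2,1)] hin_times[OF assms(2,1), of a]
  by simp

lemma hin_diff_right:
  assumes "f \<in> dual" "g \<in> dual" "g' \<in> dual"
  shows "hin f (\<lambda>v. g v - g' v) = hin f g - hin f g'"
  using hin_add_right[of f g "\<lambda>v. - 1 * g' v"] hin_times_right[of f g' "-1"] dual_times[of g' "-1"] assms by simp

definition dnorm :: "('v \<Rightarrow> complex) \<Rightarrow> real" where
  "dnorm f = sqrt (Re (hin f f))"

lemma hin_self_limit:
  assumes f: "f \<in> dual"
  shows "(\<lambda>n. (seminorm (approx f n))\<^sup>2) \<longlonglongrightarrow> Re (hin f f)"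
  using tendsto_Re[OF hin_limit_B[OF f f]] by (simp add: seminorm_sq[symmetric])

lemma hin_self_nonneg:
  assumes f: "f \<in> dual"
  shows "0 \<le> Re (hin f f)"
  using hin_self_limit[OF f] by (rule LIMSEQ_le_const) auto

lemma dnorm_nonneg: "f \<in> dual \<Longrightarrow> 0 \<le> dnorm f"
  by (simp add: dnorm_def hin_self_nonneg)

lemma dnorm_sq: "f \<in> dual \<Longrightarrow> hin f f = of_real ((dnorm f)\<^sup>2)"
  using arg_cong[OF hin_cnj[of f f], of Im] by (simp add: dnorm_def hin_self_nonneg complex_eq_iff)

lemma seminorm_approx_limit:
  assumes f: "f \<in> dual"
  shows "(\<lambda>n. seminorm (approx f n)) \<longlonglongrightarrow> dnorm f"
  using tendsto_real_sqrt[OF hin_self_limit[OF f]] by (simp add: dnorm_def seminorm_nonneg)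

lemma le_dnorm:
  assumes f: "f \<in> dual"
  shows "cmod (f v) \<le> dnorm f * seminorm v"
proof -
  let ?e = "\<lambda>n. inverse (real (Suc n))"
  have "(\<lambda>n. (seminorm (approx f n) + ?e n) * seminorm v) \<longlonglongrightarrow> (dnorm f + 0) * seminorm v"
    by (intro tendsto_mult tendsto_add tendsto_const LIMSEQ_inverse_real_of_nat seminorm_approx_limit f)
  then have "cmod (f v) \<le> (dnorm f + 0) * seminorm v"
  proof (rule LIMSEQ_le_const, intro exI[of _ 0] allI impI)
    fix n
    have "cmod (f v) \<le> cmod (B (approx f n) v) + cmod (f v - B (approx f n) v)"
      using norm_triangle_ineq[of "B (approx f n) v" "f v - B (approx f n) v"] by simp
    also have "\<dots> \<le> seminorm (approx f n) * seminorm v + ?e n * seminorm v"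
      using approx_close[OF f, of n] by (intro add_mono B_Cauchy_Schwarz) (auto simp: close_def)
    finally show "cmod (f v) \<le> (seminorm (approx f n) + ?e n) * seminorm v" by (simp add: distrib_right)
  qed
  then show ?thesis by simp
qed

lemma hin_Cauchy_Schwarz:
  assumes f: "f \<in> dual" and g: "g \<in> dual"
  shows "cmod (hin f g) \<le> dnorm f * dnorm g"
proof (rule LIMSEQ_le)
  show "(\<lambda>n. cmod (f (approx g n))) \<longlonglongrightarrow> cmod (hin f g)"
    by (intro tendsto_norm hin_limit_approx f g)
  show "(\<lambda>n. dnorm f * seminorm (approx g n)) \<longlonglongrightarrow> dnorm f * dnorm g"
    by (intro tendsto_mult tendsto_const seminorm_approx_limit g)
qed (use le_dnorm[OF f] in blast)

lemma dnorm_le: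
  assumes f: "f \<in> dual" and c: "0 \<le> c" "\<And>v. cmod (f v) \<le> c * seminorm v"
  shows "dnorm f \<le> c"
proof -
  have "cmod (hin f f) \<le> c * dnorm f"
  proof (rule LIMSEQ_le)
    show "(\<lambda>n. cmod (f (approx f n))) \<longlonglongrightarrow> cmod (hin f f)"
      by (intro tendsto_norm hin_limit_approx f)
    show "(\<lambda>n. c * seminorm (approx f n)) \<longlonglongrightarrow> c * dnorm f"
      by (intro tendsto_mult tendsto_const seminorm_approx_limit f)
  qed (use c in blast)
  then have "(dnorm f)\<^sup>2 \<le> c * dnorm f" by (simp add: dnorm_sq[OF f] norm_power)
  then show ?thesis using c(1) dnorm_nonneg[OF f]
    by (cases "dnorm f = 0") (auto simp: power2_eq_square)
qed

lemma dnorm_eq_0: "f \<in> dual \<Longrightarrow> dnorm f = 0 \<Longrightarrow> f = (\<lambda>v. 0)"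
  using le_dnorm[of f] by auto

text \<open>
  A Cauchy sequence of functionals converges pointwise, and uniformly on bounded sets.
\<close>

lemma dual_complete:
  assumes F: "\<And>n. F n \<in> dual"
    and Cau: "\<And>e. 0 < e \<Longrightarrow> \<exists>N. \<forall>m\<ge>N. \<forall>n\<ge>N. dnorm (\<lambda>v. F m v - F n v) < e"
  obtains f where "f \<in> dual" "(\<lambda>n. dnorm (\<lambda>v. F n v - f v)) \<longlonglongrightarrow> 0"
proof -
  have diff: "cmod (F m v - F n v) \<le> dnorm (\<lambda>v. F m v - F n v) * seminorm v" for m n v
    using le_dnorm[OF dual_minus[OF F F]] .
  have "Cauchy (\<lambda>n. F n v)" for v
  proof (rule CauchyI)
    fix e :: real assume "0 < e"
    have sp: "0 < seminorm v + 1" using seminorm_nonneg[of v] by simp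
    then have "0 < e / (seminorm v + 1)" using \<open>0 < e\<close> by simp
    then obtain N where N: "\<And>m n. N \<le> m \<Longrightarrow> N \<le> n \<Longrightarrow> dnorm (\<lambda>v. F m v - F n v) < e / (seminorm v + 1)"
      using Cau by meson
    have "norm (F m v - F n v) < e" if "N \<le> m" "N \<le> n" for m n
    proof -
      have "norm (F m v - F n v) \<le> e / (seminorm v + 1) * seminorm v"
        using diff[of m v n] mult_right_mono[OF less_imp_le[OF N[OF that]] seminorm_nonneg[of v]] by linarith
      also have "\<dots> < e / (seminorm v + 1) * (seminorm v + 1)"
        using \<open>0 < e / (seminorm v + 1)\<close> by (intro mult_strict_left_mono) auto
      also have "\<dots> = e" using sp by simp
      finally show ?thesis .
    qed
    then show "\<exists>M. \<forall>m\<ge>M. \<forall>n\<ge>M. norm (F m v - F n v) < e" by blast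
  qed
  then have "\<exists>l. (\<lambda>n. F n v) \<longlonglongrightarrow> l" for v
    by (simp add: Cauchy_convergent_iff convergent_def)
  then obtain f where f: "\<And>v. (\<lambda>n. F n v) \<longlonglongrightarrow> f v" by metis
  have unif: "cmod (F n v - f v) \<le> e * seminorm v"
    if "\<forall>m\<ge>N. \<forall>n\<ge>N. dnorm (\<lambda>v. F m v - F n v) < e" "N \<le> n" for e N n v
  proof (rule LIMSEQ_le_const2)
    show "(\<lambda>m. cmod (F n v - F m v)) \<longlonglongrightarrow> cmod (F n v - f v)"
      by (intro tendsto_norm tendsto_diff tendsto_const f)
    have "cmod (F n v - F m v) \<le> e * seminorm v" if "N \<le> m" for m
      using diff[of n v m] mult_right_mono[OF less_imp_le seminorm_nonneg[of v]] that
        \<open>\<forall>m\<ge>N. \<forall>n\<ge>N. dnorm (\<lambda>v. F m v - F n v) < e\<close> \<open>N \<le> n\<close> by (meson order_trans)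
    then show "\<exists>N. \<forall>m\<ge>N. cmod (F n v - F m v) \<le> e * seminorm v" by blast
  qed
  have f_add: "f (u + v) = f u + f v" for u v
    by (rule LIMSEQ_unique[OF f]) (use tendsto_add[OF f[of u] f[of v]] dual_add[OF F] in simp)
  have f_scale: "f (sc a u) = cnj a * f u" for a u
    by (rule LIMSEQ_unique[OF f]) (use tendsto_mult[OF tendsto_const[of "cnj a"] f[of u]] dual_scale[OF F] in simp)
  have f_dual: "f \<in> dual"
  proof -
    obtain N where "\<forall>m\<ge>N. \<forall>n\<ge>N. dnorm (\<lambda>v. F m v - F n v) < 1" using Cau[of 1] by auto
    then have "cmod (F N v - f v) \<le> 1 * seminorm v" for v using unif by blast
    then have "(\<lambda>v. F N v - f v) \<in> dual"
      by (intro dualI[of _ 1]) (auto simp: f_add f_scale dual_add[OF F] dual_scale[OF F] algebra_simps)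
    then show ?thesis using dual_minus[OF F[of N]] by fastforce
  qed
  have "(\<lambda>n. dnorm (\<lambda>v. F n v - f v)) \<longlonglongrightarrow> 0"
  proof (rule LIMSEQ_I)
    fix e :: real assume e: "0 < e"
    then obtain N where N: "\<forall>m\<ge>N. \<forall>n\<ge>N. dnorm (\<lambda>v. F m v - F n v) < e/2" using Cau[of "e/2"] by auto
    have "norm (dnorm (\<lambda>v. F n v - f v) - 0) < e" if "N \<le> n" for n
    proof -
      have "dnorm (\<lambda>v. F n v - f v) \<le> e/2"
        using unif[OF N that] e by (intro dnorm_le dual_minus F f_dual) auto
      then show ?thesis using e dnorm_nonneg[OF dual_minus[OF F f_dual, of n]] by simp
    qed
    then show "\<exists>N. \<forall>n\<ge>N. norm (dnorm (\<lambda>v. F n v - f v) - 0) < e" by blast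
  qed
  then show ?thesis using that f_dual by blast
qed

text \<open>
  The continuous extension of \<open>A\<close>, defined as the adjoint of \<open>\<lambda>g. g \<circ> A\<close>: the inner product of the
  extension at \<open>f\<close> with \<open>B v\<close> has to be that of \<open>f\<close> with \<open>B v \<circ> A\<close>.
\<close>

definition extend :: "('v \<Rightarrow> 'v) \<Rightarrow> ('v \<Rightarrow> complex) \<Rightarrow> ('v \<Rightarrow> complex)" where
  "extend A f = (\<lambda>v. hin f (\<lambda>x. B v (A x)))"

context
  fixes A :: "'v \<Rightarrow> 'v" and c :: real
  assumes A_add: "A (u + v) = A u + A v"
    and A_scale: "A (sc a u) = sc a (A u)"
    and A_bound: "seminorm (A u) \<le> c * seminorm u"
    and c_nonneg: "0 \<le> c"
begin

lemma dual_comp_bound: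
  assumes "\<And>v. cmod (f v) \<le> r * seminorm v" "0 \<le> r"
  shows "cmod (f (A v)) \<le> (r * c) * seminorm v"
proof -
  have "cmod (f (A v)) \<le> r * seminorm (A v)" by (rule assms)
  also have "\<dots> \<le> r * (c * seminorm v)" using assms(2) by (intro mult_left_mono A_bound)
  finally show ?thesis by (simp add: mult.assoc)
qed

lemma dual_comp:
  assumes f: "f \<in> dual"
  shows "(\<lambda>x. f (A x)) \<in> dual"
  by (rule dualI[of _ "dnorm f * c"])
     (use dual_comp_bound[OF le_dnorm[OF f] dnorm_nonneg[OF f]] in
      \<open>simp_all add: A_add A_scale dual_add[OF f] dual_scale[OF f]\<close>)

lemma extend_bound:
  assumes f: "f \<in> dual"
  shows "cmod (extend A f v) \<le> (c * dnorm f) * seminorm v"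
proof -
  have "cmod (extend A f v) \<le> dnorm f * dnorm (\<lambda>x. B v (A x))"
    unfolding extend_def by (intro hin_Cauchy_Schwarz f dual_comp B_dual)
  also have "\<dots> \<le> dnorm f * (seminorm v * c)"
    using B_Cauchy_Schwarz c_nonneg seminorm_nonneg dnorm_nonneg[OF f]
    by (intro mult_left_mono dnorm_le dual_comp B_dual dual_comp_bound mult_nonneg_nonneg) auto
  finally show ?thesis by (simp add: mult.commute mult.left_commute)
qed

lemma extend_dual:
  assumes f: "f \<in> dual"
  shows "extend A f \<in> dual"
proof (rule dualI)
  show "cmod (extend A f v) \<le> (c * dnorm f) * seminorm v" for v by (rule extend_bound[OF f])
  show "extend A f (u + v) = extend A f u + extend A f v" for u v
    using hin_add_right[OF f dual_comp[OF B_dual[of u]] dual_comp[OF B_dual[of v]]]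
    by (simp add: extend_def B_add)
  show "extend A f (sc a u) = cnj a * extend A f u" for a u
    using hin_times_right[OF f dual_comp[OF B_dual[of u]], of a] by (simp add: extend_def B_scale)
qed

lemma dnorm_extend: "f \<in> dual \<Longrightarrow> dnorm (extend A f) \<le> c * dnorm f"
  by (rule dnorm_le) (use extend_dual extend_bound c_nonneg dnorm_nonneg in auto)

lemma extend_plus:
  "f \<in> dual \<Longrightarrow> g \<in> dual \<Longrightarrow> extend A (\<lambda>v. f v + g v) = (\<lambda>v. extend A f v + extend A g v)"
  unfolding extend_def by (intro ext hin_add dual_comp B_dual)

lemma extend_times: "f \<in> dual \<Longrightarrow> extend A (\<lambda>v. a * f v) = (\<lambda>v. a * extend A f v)"
  unfolding extend_def by (intro ext hin_times dual_comp B_dual)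

lemma extend_B: "extend A (B u) = B (A u)"
proof
  fix v
  have "extend A (B u) v = cnj (hin (\<lambda>x. B v (A x)) (B u))"
    unfolding extend_def by (rule hin_cnj[OF dual_comp[OF B_dual] B_dual])
  also have "\<dots> = B (A u) v" by (simp add: hin_B_right dual_comp[OF B_dual] B_cnj[symmetric])
  finally show "extend A (B u) v = B (A u) v" .
qed

text \<open>
  True for \<open>g = B v\<close> by the definition of \<open>extend\<close>; both sides are continuous in \<open>g\<close>.
\<close>

lemma hin_extend:
  assumes f: "f \<in> dual" and g: "g \<in> dual"
  shows "hin (extend A f) g = hin f (\<lambda>x. g (A x))"
proof (rule LIMSEQ_unique[OF hin_limit_approx[OF extend_dual[OF f] g]])
  let ?e = "\<lambda>n. inverse (real (Suc n))"
  have "(\<lambda>n. dnorm f * (?e n * c)) \<longlonglongrightarrow> dnorm f * (0 * c)"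
    by (intro tendsto_mult tendsto_const LIMSEQ_inverse_real_of_nat)
  then have lim: "(\<lambda>n. dnorm f * (?e n * c)) \<longlonglongrightarrow> 0" by simp
  have "(\<lambda>n. hin f (\<lambda>x. g (A x)) - extend A f (approx g n)) \<longlonglongrightarrow> 0"
  proof (rule Lim_null_comparison[OF _ lim], rule always_eventually, rule allI)
    fix n
    let ?h = "\<lambda>x. g (A x) - B (approx g n) (A x)"
    have h: "?h \<in> dual" by (intro dual_minus dual_comp g B_dual)
    have close: "cmod (g x - B (approx g n) x) \<le> ?e n * seminorm x" for x
      using approx_close[OF g, of n, unfolded close_def] by (rule spec)
    have "cmod (?h v) \<le> (?e n * c) * seminorm v" for v
      using dual_comp_bound[of "\<lambda>x. g x - B (approx g n) x" "?e n" v] close by simp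
    then have h_le: "dnorm ?h \<le> ?e n * c"
      using dnorm_le[OF h, of "?e n * c"] c_nonneg by simp
    have eq: "hin f (\<lambda>x. g (A x)) - extend A f (approx g n) = hin f ?h"
      unfolding extend_def by (intro hin_diff_right[symmetric] f dual_comp g B_dual)
    have "norm (hin f (\<lambda>x. g (A x)) - extend A f (approx g n)) \<le> dnorm f * dnorm ?h"
      unfolding eq by (rule hin_Cauchy_Schwarz[OF f h])
    also have "\<dots> \<le> dnorm f * (?e n * c)"
      using h_le dnorm_nonneg[OF f] by (rule mult_left_mono)
    finally show "norm (hin f (\<lambda>x. g (A x)) - extend A f (approx g n)) \<le> dnorm f * (?e n * c)" .
  qed
  from tendsto_diff[OF tendsto_const[of "hin f (\<lambda>x. g (A x))"] this]
  show "(\<lambda>n. extend A f (approx g n)) \<longlonglongrightarrow> hin f (\<lambda>x. g (A x))" by simp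
qed

end

end

subsection \<open>The completion on a given carrier type\<close>

context semi_inner_space
begin

context
  fixes \<iota> :: "('v \<Rightarrow> complex) \<Rightarrow> 'h"
  assumes inj: "inj_on \<iota> dual"
begin

text \<open>
  The elements of the Hilbert space are labels of functionals, and this reads off the functional.
\<close>

definition coord :: "'h \<Rightarrow> ('v \<Rightarrow> complex)" where
  "coord = inv_into dual \<iota>"

definition completion :: "'h hilbert" where
  "completion = \<lparr>
    carrier = \<iota> ` dual,
    mult = undefined,
    one = undefined,
    zero = \<iota> (\<lambda>v. 0),
    add = (\<lambda>x y. \<iota> (\<lambda>v. coord x v + coord y v)),
    smult = (\<lambda>a x. \<iota> (\<lambda>v. a * coord x v)),
    hinner = (\<lambda>x y. hin (coord x) (coord y))\<rparr>"

lemma coord_inverse [simp]: "f \<in> dual \<Longrightarrow> coord (\<iota> f) = f"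
  by (simp add: coord_def inj inv_into_f_f)

lemma carrier_completion: "carrier completion = \<iota> ` dual"
  by (simp add: completion_def)

lemma coord_dual [simp]: "x \<in> carrier completion \<Longrightarrow> coord x \<in> dual"
  by (auto simp: carrier_completion)

lemma \<iota>_carrier [simp]: "f \<in> dual \<Longrightarrow> \<iota> f \<in> carrier completion"
  by (auto simp: carrier_completion)

lemma \<iota>_coord [simp]: "x \<in> carrier completion \<Longrightarrow> \<iota> (coord x) = x"
  by (auto simp: carrier_completion)

lemma completion_eqI: "x \<in> carrier completion \<Longrightarrow> y \<in> carrier completion \<Longrightarrow> coord x = coord y \<Longrightarrow> x = y"
  by (metis \<iota>_coord)

lemma hinner_completion: "hinner completion x y = hin (coord x) (coord y)"
  by (simp add: completion_def)

lemma hnorm_completion: "hnorm completion x = dnorm (coord x)"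
  by (simp add: hnorm_def dnorm_def hinner_completion)

lemma coord_zero [simp]: "coord \<zero>\<^bsub>completion\<^esub> = (\<lambda>v. 0)"
  by (simp add: completion_def dual_zero)

lemma coord_add [simp]:
  "x \<in> carrier completion \<Longrightarrow> y \<in> carrier completion \<Longrightarrow>
    coord (x \<oplus>\<^bsub>completion\<^esub> y) = (\<lambda>v. coord x v + coord y v)"
  by (simp add: completion_def dual_plus carrier_completion)

lemma coord_smult [simp]:
  "x \<in> carrier completion \<Longrightarrow> coord (a \<odot>\<^bsub>completion\<^esub> x) = (\<lambda>v. a * coord x v)"
  by (simp add: completion_def dual_times carrier_completion)

lemma add_closed: "x \<in> carrier completion \<Longrightarrow> y \<in> carrier completion \<Longrightarrow> x \<oplus>\<^bsub>completion\<^esub> y \<in> carrier completion"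
  using \<iota>_carrier[OF dual_plus[of "coord x" "coord y"]] by (simp add: completion_def[THEN arg_cong[of _ _ add]])

lemma smult_closed: "x \<in> carrier completion \<Longrightarrow> a \<odot>\<^bsub>completion\<^esub> x \<in> carrier completion"
  using \<iota>_carrier[OF dual_times[of "coord x" a]] by (simp add: completion_def[THEN arg_cong[of _ _ smult]])

lemma zero_closed: "\<zero>\<^bsub>completion\<^esub> \<in> carrier completion"
  using \<iota>_carrier[OF dual_zero] by (simp add: completion_def[THEN arg_cong[of _ _ zero]])

lemma abelian_group_completion: "abelian_group completion"
proof (rule abelian_groupI)
  fix x assume x: "x \<in> carrier completion"
  have "(-1) \<odot>\<^bsub>completion\<^esub> x \<oplus>\<^bsub>completion\<^esub> x = \<zero>\<^bsub>completion\<^esub>"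
    by (rule completion_eqI) (use x in \<open>simp_all add: add_closed smult_closed zero_closed\<close>)
  then show "\<exists>y\<in>carrier completion. y \<oplus>\<^bsub>completion\<^esub> x = \<zero>\<^bsub>completion\<^esub>"
    using smult_closed[OF x] by blast
qed (auto intro!: completion_eqI simp: add_closed zero_closed algebra_simps)

lemma coord_minus:
  assumes x: "x \<in> carrier completion" and y: "y \<in> carrier completion"
  shows "coord (x \<ominus>\<^bsub>completion\<^esub> y) = (\<lambda>v. coord x v - coord y v)"
proof -
  interpret abelian_group completion by (rule abelian_group_completion)
  have c: "x \<ominus>\<^bsub>completion\<^esub> y \<in> carrier completion" using x y by (rule minus_closed)
  have "(x \<ominus>\<^bsub>completion\<^esub> y) \<oplus>\<^bsub>completion\<^esub> y = x"
    using x y by (simp add: a_minus_def a_assoc l_neg)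
  then have "coord x v = coord (x \<ominus>\<^bsub>completion\<^esub> y) v + coord y v" for v
    using coord_add[OF c y] by metis
  then show ?thesis by (simp add: fun_eq_iff)
qed

lemma vectorspace_completion: "vectorspace class_ring completion"
  unfolding vectorspace_def
proof (intro conjI Module.module.intro)
  show "field (class_ring :: complex ring)" by (rule class_field)
  then show "cring (class_ring :: complex ring)" by (rule domain.axioms(1)[OF field.axioms(1)])
  show "abelian_group completion" by (rule abelian_group_completion)
  show "module_axioms class_ring completion"
    by unfold_locales
       (auto intro!: completion_eqI simp: smult_closed add_closed class_ring_simps algebra_simps)
qed

text \<open>
  All properties are inherited from the antidual through the labelling.
\<close>

theorem complex_hilbert_space_completion: "complex_hilbert_space completion"
proof (intro complex_hilbert_space.intro complex_hilbert_space_axioms.intro vectorspace_completion)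
  fix x y z a
  assume x: "x \<in> carrier completion" and y: "y \<in> carrier completion"
  show "hinner completion (x \<oplus>\<^bsub>completion\<^esub> y) z = hinner completion x z + hinner completion y z"
    if "z \<in> carrier completion" using x y that by (simp add: hinner_completion hin_add)
  show "hinner completion (a \<odot>\<^bsub>completion\<^esub> x) y = a * hinner completion x y"
    using x y by (simp add: hinner_completion hin_times)
  show "hinner completion y x = cnj (hinner completion x y)"
    using hin_cnj[of "coord x" "coord y"] x y by (simp add: hinner_completion)
next
  fix x assume x: "x \<in> carrier completion" and nz: "x \<noteq> \<zero>\<^bsub>completion\<^esub>"
  have "coord x \<noteq> (\<lambda>v. 0)" using completion_eqI[OF x zero_closed] nz by auto
  then have "dnorm (coord x) \<noteq> 0" using dnorm_eq_0 x by auto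
  then have "0 < (dnorm (coord x))\<^sup>2" by simp
  then show "0 < hinner completion x x"
    using dnorm_sq[of "coord x"] x by (simp add: hinner_completion less_complex_def)
next
  fix s assume s: "\<And>n::nat. s n \<in> carrier completion"
    and "\<And>e. 0 < e \<Longrightarrow> \<exists>N. \<forall>m\<ge>N. \<forall>n\<ge>N. hnorm completion (s m \<ominus>\<^bsub>completion\<^esub> s n) < e"
  then obtain f where f: "f \<in> dual" "(\<lambda>n. dnorm (\<lambda>v. coord (s n) v - f v)) \<longlonglongrightarrow> 0"
    by (rule_tac dual_complete[of "\<lambda>n. coord (s n)"]) (auto simp: hnorm_completion coord_minus)
  show "\<exists>x\<in>carrier completion. (\<lambda>n. hnorm completion (s n \<ominus>\<^bsub>completion\<^esub> x)) \<longlonglongrightarrow> 0"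
    by (rule bexI[of _ "\<iota> f"]) (use f s in \<open>simp_all add: hnorm_completion coord_minus\<close>)
qed

definition embed :: "'v \<Rightarrow> 'h" where
  "embed u = \<iota> (B u)"

lemma embed_carrier [simp]: "embed u \<in> carrier completion"
  by (simp add: embed_def B_dual)

lemma hinner_embed: "hinner completion (embed u) (embed v) = B u v"
  by (simp add: hinner_completion embed_def B_dual hin_B_right)

lemma embed_dense:
  assumes x: "x \<in> carrier completion" and e: "0 < e"
  shows "\<exists>u. hnorm completion (x \<ominus>\<^bsub>completion\<^esub> embed u) < e"
proof -
  have cx: "coord x \<in> dual" using x by simp
  obtain u where u: "close (coord x) u (e/2)" using ex_close[OF cx, of "e/2"] e by auto
  have "dnorm (\<lambda>v. coord x v - B u v) \<le> e/2"
    using u e by (intro dnorm_le dual_minus cx B_dual) (auto simp: close_def)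
  then have "hnorm completion (x \<ominus>\<^bsub>completion\<^esub> embed u) < e"
    using x e by (simp add: hnorm_completion coord_minus embed_def B_dual)
  then show ?thesis by blast
qed

lemma operator_extension:
  assumes A_add: "\<And>u v. A (u + v) = A u + A v"
    and A_scale: "\<And>a u. A (sc a u) = sc a (A u)"
    and A_bound: "\<And>u. seminorm (A u) \<le> c * seminorm u"
    and c: "0 \<le> c"
  obtains T T' where "bounded_operator completion T" "T' \<in> carrier completion \<rightarrow> carrier completion"
    "\<And>x y. x \<in> carrier completion \<Longrightarrow> y \<in> carrier completion \<Longrightarrow>
      hinner completion (T x) y = hinner completion x (T' y)"
    "\<And>u. T (embed u) = embed (A u)"
proof -
  define T where "T x = \<iota> (extend A (coord x))" for x
  define T' where "T' x = \<iota> (\<lambda>v. coord x (A v))" for x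
  note ext_rules = extend_dual[OF A_add A_scale A_bound c] dual_comp[OF A_add A_scale A_bound c]
  have T_carrier: "T x \<in> carrier completion" if "x \<in> carrier completion" for x
    using that by (simp add: T_def ext_rules)
  have coord_T: "coord (T x) = extend A (coord x)" if "x \<in> carrier completion" for x
    using that by (simp add: T_def ext_rules)
  have T'_carrier: "T' x \<in> carrier completion" if "x \<in> carrier completion" for x
    using that by (simp add: T'_def ext_rules)
  have coord_T': "coord (T' x) = (\<lambda>v. coord x (A v))" if "x \<in> carrier completion" for x
    using that by (simp add: T'_def ext_rules)
  show ?thesis
  proof (rule that)
    show "bounded_operator completion T" unfolding bounded_operator_def
    proof (intro conjI ballI allI funcsetI)
      fix x y a assume x: "x \<in> carrier completion" and y: "y \<in> carrier completion"
      show "T (x \<oplus>\<^bsub>completion\<^esub> y) = T x \<oplus>\<^bsub>completion\<^esub> T y"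
        by (rule completion_eqI)
           (use x y extend_plus[OF A_add A_scale A_bound c, of "coord x" "coord y"] in
            \<open>simp_all add: T_carrier add_closed coord_T\<close>)
    next
      fix x a assume x: "x \<in> carrier completion"
      show "T (a \<odot>\<^bsub>completion\<^esub> x) = a \<odot>\<^bsub>completion\<^esub> T x"
        by (rule completion_eqI)
           (use x extend_times[OF A_add A_scale A_bound c, of "coord x" a] in
            \<open>simp_all add: T_carrier smult_closed coord_T\<close>)
    next
      show "\<exists>C. \<forall>x\<in>carrier completion. hnorm completion (T x) \<le> C * hnorm completion x"
        using dnorm_extend[OF A_add A_scale A_bound c]
        by (intro exI[of _ c]) (simp add: hnorm_completion coord_T)
    qed (rule T_carrier)
    show "T' \<in> carrier completion \<rightarrow> carrier completion" using T'_carrier by blast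
    show "hinner completion (T x) y = hinner completion x (T' y)"
      if "x \<in> carrier completion" "y \<in> carrier completion" for x y
      using that hin_extend[OF A_add A_scale A_bound c] by (simp add: hinner_completion coord_T coord_T')
    show "T (embed u) = embed (A u)" for u
      by (simp add: T_def embed_def B_dual extend_B[OF A_add A_scale A_bound c])
  qed
qed

end

end

text \<open>
  A function is coded by the real and imaginary parts of its values on \<open>S\<close>, that is, by a sequence of
  reals, hence by a set of triples of natural numbers and booleans, hence by a real number.
\<close>

lemma inj_on_functions_determined_on_countable:
  fixes F :: "('v \<Rightarrow> complex) set"
  assumes big: "(UNIV :: real set) \<lesssim> (UNIV :: 'h set)"
    and S: "countable S"
    and det: "\<And>f g. f \<in> F \<Longrightarrow> g \<in> F \<Longrightarrow> (\<And>x. x \<in> S \<Longrightarrow> f x = g x) \<Longrightarrow> f = g"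
  shows "\<exists>\<iota> :: ('v \<Rightarrow> complex) \<Rightarrow> 'h. inj_on \<iota> F"
proof -
  obtain \<phi> :: "real \<Rightarrow> nat set" where \<phi>: "inj \<phi>"
    using eqpoll_imp_lepoll[OF eqpoll_sym[OF nat_sets_eqpoll_reals]] unfolding lepoll_def by auto
  obtain \<psi> :: "nat set \<Rightarrow> real" where \<psi>: "inj \<psi>"
    using eqpoll_imp_lepoll[OF nat_sets_eqpoll_reals] unfolding lepoll_def by auto
  obtain \<theta> :: "real \<Rightarrow> 'h" where \<theta>: "inj \<theta>"
    using big unfolding lepoll_def by auto
  define e where "e = from_nat_into S"
  define code :: "('v \<Rightarrow> complex) \<Rightarrow> (nat \<times> bool \<times> nat) set" where
    "code f = {(n, b, m). m \<in> \<phi> (if b then Re (f (e n)) else Im (f (e n)))}" for f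
  have code_eq: "\<phi> (if b then Re (f (e n)) else Im (f (e n))) = {m. (n, b, m) \<in> code f}" for f n b
    by (auto simp: code_def)
  have inj_code: "inj_on code F"
  proof (rule inj_onI)
    fix f g assume f: "f \<in> F" and g: "g \<in> F" and eq: "code f = code g"
    show "f = g"
    proof (rule det[OF f g])
      fix x assume "x \<in> S"
      then obtain n where x: "x = e n" unfolding e_def using S by (metis from_nat_into_to_nat_on)
      show "f x = g x"
        using code_eq[of True f n] code_eq[of True g n] code_eq[of False f n] code_eq[of False g n] eq
          injD[OF \<phi>] by (auto simp: x complex_eq_iff)
    qed
  qed
  have inj_image: "inj (image (to_nat :: nat \<times> bool \<times> nat \<Rightarrow> nat))"
    by (simp add: inj_def inj_image_eq_iff)
  have "inj_on (\<lambda>f. \<theta> (\<psi> (to_nat ` code f))) F"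
  proof (rule inj_onI)
    fix f g assume f: "f \<in> F" and g: "g \<in> F"
      and eq: "\<theta> (\<psi> (to_nat ` code f)) = \<theta> (\<psi> (to_nat ` code g))"
    have "to_nat ` code f = to_nat ` code g" by (rule injD[OF \<psi> injD[OF \<theta> eq]])
    then have "code f = code g" by (rule injD[OF inj_image])
    then show "f = g" using inj_code f g by (auto dest: inj_onD)
  qed
  then show ?thesis by blast
qed

section \<open>Polynomials in $z$ and in $(w, z)$\<close>

lemma poly_mapping_sum_induct [case_names zero single add]:
  fixes p :: "'a \<Rightarrow>\<^sub>0 'b::comm_monoid_add"
  assumes "P 0" "\<And>k a. P (Poly_Mapping.single k a)" "\<And>p q. P p \<Longrightarrow> P q \<Longrightarrow> P (p + q)"
  shows "P p"
proof (induction p rule: update_induct)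
  case const
  show ?case by (rule assms(1))
next
  case (update f a b)
  have "Poly_Mapping.update a b f = f + Poly_Mapping.single a b"
    using update(1) by (intro poly_mapping_eqI) (auto simp: lookup_update lookup_add lookup_single when_def in_keys_iff)
  then show ?case using assms(2,3) update(3) by metis
qed

text \<open>
  The additive map that sends the monomial with exponent \<open>k\<close> and coefficient \<open>a\<close> to \<open>h k a\<close>. Evaluation in
  \<open>z\<close>, conjugation and the omission of variables are all of this form.
\<close>

definition map_monomials :: "('a \<Rightarrow> complex \<Rightarrow> 'b) \<Rightarrow> ('a \<Rightarrow>\<^sub>0 complex) \<Rightarrow> 'b::ab_group_add" where
  "map_monomials h p = (\<Sum>k\<in>Poly_Mapping.keys p. h k (Poly_Mapping.lookup p k))"

lemma additive_zero:
  fixes h :: "'a::monoid_add \<Rightarrow> 'b::ab_group_add"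
  assumes "\<And>a b. h (a + b) = h a + h b"
  shows "h 0 = 0"
  using assms[of 0 0] by simp

lemma map_monomials_single:
  assumes "\<And>k a b. h k (a + b) = h k a + h k b"
  shows "map_monomials h (Poly_Mapping.single k a) = h k a"
  using additive_zero[of "h k", OF assms] by (cases "a = 0") (auto simp: map_monomials_def)

lemma map_monomials_add:
  assumes "\<And>k a b. h k (a + b) = h k a + h k b"
  shows "map_monomials h (p + q) = map_monomials h p + map_monomials h q"
  unfolding map_monomials_def
  by (rule setsum_keys_plus_distrib) (use assms additive_zero[of "h _"] in auto)

lemma map_monomials_zero: "map_monomials h 0 = 0"
  by (simp add: map_monomials_def)

lemma map_monomials_mult:
  fixes h :: "'a::comm_monoid_add \<Rightarrow> complex \<Rightarrow> 'b::comm_ring"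
  assumes add: "\<And>k a b. h k (a + b) = h k a + h k b"
    and mult: "\<And>k l a b. h (k + l) (a * b) = h k a * h l b"
  shows "map_monomials h (p * q) = map_monomials h p * map_monomials h q"
proof (induction p rule: poly_mapping_sum_induct)
  case (single k a)
  show ?case
  proof (induction q rule: poly_mapping_sum_induct)
    case (single l b)
    then show ?case by (simp add: mult_single map_monomials_single add mult)
  qed (simp_all add: map_monomials_zero map_monomials_add add distrib_left)
qed (simp_all add: map_monomials_zero map_monomials_add add distrib_right)

text \<open>
  The embeddings $h \mapsto h(z)$ and $h \mapsto h^*(w)$ of the polynomials in one set of variables, and the
  involution that swaps \<open>w\<close> with \<open>z\<close> and conjugates the coefficients. For a matrix polynomial, hermitian
  means that \<open>star\<close> of each entry is the transposed entry.
\<close>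

definition in_z :: "z_poly \<Rightarrow> wz_poly" where
  "in_z = map_monomials (\<lambda>\<mu> a. Poly_Mapping.single (0, \<mu>) a)"

definition star_w :: "z_poly \<Rightarrow> wz_poly" where
  "star_w = map_monomials (\<lambda>\<mu> a. Poly_Mapping.single (\<mu>, 0) (cnj a))"

definition star :: "wz_poly \<Rightarrow> wz_poly" where
  "star = map_monomials (\<lambda>(\<kappa>, \<mu>) a. Poly_Mapping.single (\<mu>, \<kappa>) (cnj a))"

text \<open>
  Zero is substituted for the variables of index at least \<open>d\<close>; this is a ring homomorphism that commutes
  with the maps above.
\<close>

definition prune_z :: "nat \<Rightarrow> z_poly \<Rightarrow> z_poly" where
  "prune_z d = map_monomials (\<lambda>\<mu> a. Poly_Mapping.single \<mu> (if \<mu> \<in> multi_indices d then a else 0))"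

definition prune :: "nat \<Rightarrow> wz_poly \<Rightarrow> wz_poly" where
  "prune d = map_monomials (\<lambda>k a. Poly_Mapping.single k (if k \<in> multi_indices d \<times> multi_indices d then a else 0))"

lemma multi_indices_add: "\<mu> + \<nu> \<in> multi_indices d \<longleftrightarrow> \<mu> \<in> multi_indices d \<and> \<nu> \<in> multi_indices d"
  by (auto simp: multi_indices_def in_keys_iff lookup_add subset_iff)

lemma zero_multi_indices: "0 \<in> multi_indices d"
  by (simp add: multi_indices_def)

lemma
  shows in_z_add: "in_z (p + q) = in_z p + in_z q"
    and in_z_zero: "in_z 0 = 0"
    and in_z_single: "in_z (Poly_Mapping.single \<mu> a) = Poly_Mapping.single (0, \<mu>) a"
    and in_z_mult: "in_z (p * q) = in_z p * in_z q"
  unfolding in_z_def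
  by (simp_all add: map_monomials_add map_monomials_zero map_monomials_single map_monomials_mult
      single_add mult_single)

lemma
  shows star_w_add: "star_w (p + q) = star_w p + star_w q"
    and star_w_zero: "star_w 0 = 0"
    and star_w_single: "star_w (Poly_Mapping.single \<mu> a) = Poly_Mapping.single (\<mu>, 0) (cnj a)"
    and star_w_mult: "star_w (p * q) = star_w p * star_w q"
  unfolding star_w_def
  by (simp_all add: map_monomials_add map_monomials_zero map_monomials_single map_monomials_mult
      single_add mult_single)

lemma
  shows star_add: "star (p + q) = star p + star q"
    and star_zero: "star 0 = 0"
    and star_single: "star (Poly_Mapping.single (\<kappa>, \<mu>) a) = Poly_Mapping.single (\<mu>, \<kappa>) (cnj a)"
    and star_mult: "star (p * q) = star p * star q"
  unfolding star_def
  by (simp_all add: map_monomials_add map_monomials_zero map_monomials_single map_monomials_mult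
      single_add mult_single split: prod.split)

lemma
  shows prune_z_add: "prune_z d (p + q) = prune_z d p + prune_z d q"
    and prune_z_zero: "prune_z d 0 = 0"
    and prune_z_single: "prune_z d (Poly_Mapping.single \<mu> a) = Poly_Mapping.single \<mu> (if \<mu> \<in> multi_indices d then a else 0)"
  unfolding prune_z_def
  by (simp_all add: map_monomials_add map_monomials_zero map_monomials_single single_add)

lemma
  shows prune_add: "prune d (p + q) = prune d p + prune d q"
    and prune_zero: "prune d 0 = 0"
    and prune_single: "prune d (Poly_Mapping.single k a)
      = Poly_Mapping.single k (if k \<in> multi_indices d \<times> multi_indices d then a else 0)"
    and prune_mult: "prune d (p * q) = prune d p * prune d q"
  unfolding prune_def
  by (simp_all add: map_monomials_add map_monomials_zero map_monomials_single map_monomials_mult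
      single_add mult_single multi_indices_add mem_Times_iff)

lemma additive_sum:
  fixes h :: "'a::comm_monoid_add \<Rightarrow> 'b::ab_group_add"
  assumes "\<And>a b. h (a + b) = h a + h b"
  shows "h (sum f A) = (\<Sum>x\<in>A. h (f x))"
  by (induction A rule: infinite_finite_induct) (auto simp: assms additive_zero[of h, OF assms])

lemma additive_uminus:
  fixes h :: "'a::ab_group_add \<Rightarrow> 'b::ab_group_add"
  assumes "\<And>a b. h (a + b) = h a + h b"
  shows "h (- a) = - h a"
  using assms[of a "- a"] additive_zero[of h, OF assms] by (simp add: eq_neg_iff_add_eq_0 add.commute)

lemma additive_diff:
  fixes h :: "'a::ab_group_add \<Rightarrow> 'b::ab_group_add"
  assumes "\<And>a b. h (a + b) = h a + h b"
  shows "h (a - b) = h a - h b"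
  using assms[of "a - b" b] by simp

lemmas prune_sum = additive_sum[of "prune _", OF prune_add]
lemmas star_sum = additive_sum[of star, OF star_add]
lemmas in_z_diff = additive_diff[of in_z, OF in_z_add]
lemmas star_w_diff = additive_diff[of star_w, OF star_w_add]

lemma star_star: "star (star p) = p"
  by (induction p rule: poly_mapping_sum_induct) (auto simp: star_zero star_add star_single)

lemma star_star_w: "star (star_w p) = in_z p"
  by (induction p rule: poly_mapping_sum_induct)
     (auto simp: star_zero star_add star_single star_w_zero star_w_add star_w_single in_z_zero in_z_add in_z_single)

lemma star_in_z: "star (in_z p) = star_w p"
  using star_star[of "star_w p"] by (simp add: star_star_w)

lemma lookup_star: "Poly_Mapping.lookup (star p) (\<kappa>, \<mu>) = cnj (Poly_Mapping.lookup p (\<mu>, \<kappa>))"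
proof (induction p rule: poly_mapping_sum_induct)
  case (single k a)
  then show ?case by (cases k) (auto simp: star_single lookup_single when_def)
qed (auto simp: star_zero star_add lookup_add)

lemma lookup_prune:
  "Poly_Mapping.lookup (prune d p) k = (if k \<in> multi_indices d \<times> multi_indices d then Poly_Mapping.lookup p k else 0)"
  by (induction p rule: poly_mapping_sum_induct)
     (auto simp: prune_zero prune_add prune_single lookup_add lookup_single when_def)

lemma prune_id: "Poly_Mapping.keys p \<subseteq> multi_indices d \<times> multi_indices d \<Longrightarrow> prune d p = p"
  by (rule poly_mapping_eqI) (auto simp: lookup_prune in_keys_iff subset_iff)

lemma prune_in_z: "prune d (in_z p) = in_z (prune_z d p)"
  by (induction p rule: poly_mapping_sum_induct)
     (auto simp: in_z_zero in_z_add in_z_single prune_zero prune_add prune_single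
       prune_z_zero prune_z_add prune_z_single zero_multi_indices)

lemma prune_star_w: "prune d (star_w p) = star_w (prune_z d p)"
  by (induction p rule: poly_mapping_sum_induct)
     (auto simp: star_w_zero star_w_add star_w_single prune_zero prune_add prune_single
       prune_z_zero prune_z_add prune_z_single zero_multi_indices)

lemma keys_prune_z: "Poly_Mapping.keys (prune_z d p) \<subseteq> multi_indices d"
proof (induction p rule: poly_mapping_sum_induct)
  case (add p q)
  then show ?case using Poly_Mapping.keys_add[of "prune_z d p" "prune_z d q"] by (auto simp: prune_z_add)
qed (auto simp: prune_z_zero prune_z_single)

lemma poly_const_mult: "poly_const (a * b) = poly_const a * poly_const b"
  by (simp add: poly_const_def mult_single)

lemma poly_const_add: "poly_const (a + b) = poly_const a + poly_const b"
  by (simp add: poly_const_def single_add)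

lemma poly_const_one [simp]: "poly_const 1 = 1"
  by (simp add: poly_const_def)

lemma star_poly_const: "star (poly_const a) = poly_const (cnj a)"
  by (simp add: poly_const_def zero_prod_def star_single)

lemma prune_poly_const: "prune d (poly_const a) = poly_const a"
  by (simp add: poly_const_def prune_single zero_prod_def zero_multi_indices)

lemma in_z_const: "in_z (Poly_Mapping.single 0 a) = poly_const a"
  by (simp add: in_z_single poly_const_def zero_prod_def)

lemma star_w_const: "star_w (Poly_Mapping.single 0 a) = poly_const (cnj a)"
  by (simp add: star_w_single poly_const_def zero_prod_def)

lemma in_z_one: "in_z 1 = 1" and star_w_one: "star_w 1 = 1"
  using in_z_const[of 1] star_w_const[of 1] by simp_all

section \<open>Sums of hermitian squares weighted by the constraints\<close>

text \<open>
  The matrix polynomial $X^*(w)\,p(w, z)\,X(z)$ for an $m \times m$ matrix \<open>p\<close> and a matrix \<open>X\<close> with \<open>m\<close> rows and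
  infinitely many columns.
\<close>

definition gram :: "nat \<Rightarrow> (nat \<Rightarrow> nat \<Rightarrow> wz_poly) \<Rightarrow> (nat \<Rightarrow> nat \<Rightarrow> z_poly) \<Rightarrow> nat \<Rightarrow> nat \<Rightarrow> wz_poly" where
  "gram m p X a b = (\<Sum>i<m. \<Sum>j<m. star_w (X i a) * p i j * in_z (X j b))"

lemma at_z_eq: "at_z H = map_mat in_z H"
  by (simp add: at_z_def in_z_def map_monomials_def[abs_def])

lemma star_at_w_eq: "star_at_w H = map_mat star_w (transpose_mat H)"
  by (simp add: star_at_w_def star_w_def map_monomials_def[abs_def])

lemma sum_blocks:
  fixes f :: "nat \<Rightarrow> 'a::comm_monoid_add"
  shows "(\<Sum>r<m * n. f r) = (\<Sum>i<m. \<Sum>t<n. f (i * n + t))"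
proof -
  have "(\<Sum>r<m * n. f r) = (\<Sum>i<m. sum f {i * n..<i * n + n})"
    by (rule sum.nat_group[symmetric])
  also have "\<dots> = (\<Sum>i<m. \<Sum>t<n. f (i * n + t))"
  proof (rule sum.cong[OF refl])
    fix i
    show "sum f {i * n..<i * n + n} = (\<Sum>t<n. f (i * n + t))"
      using sum.shift_bounds_nat_ivl[of f 0 "i * n" n] by (simp add: lessThan_atLeast0 add.commute)
  qed
  finally show ?thesis .
qed

text \<open>
  With the block convention of the Kronecker product, $p \otimes I_n$ couples the row $i n + t$ only with
  the rows $j n + t$. Hence \<open>H\<close> splits into the \<open>n\<close> matrices that consist of the rows with a fixed \<open>t\<close>.
\<close>

lemma sandwich_entry:
  assumes H: "H \<in> carrier_mat (m * n) \<gamma>" and p: "p \<in> carrier_mat m m" and a: "a < \<gamma>" and b: "b < \<gamma>"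
  shows "(star_at_w H * (p \<otimes>\<^sub>k 1\<^sub>m n) * at_z H) $$ (a, b)
    = (\<Sum>t<n. gram m (\<lambda>i j. p $$ (i, j)) (\<lambda>i c. H $$ (i * n + t, c)) a b)"
proof -
  let ?K = "p \<otimes>\<^sub>k 1\<^sub>m n :: wz_poly mat"
  have K: "?K \<in> carrier_mat (m * n) (m * n)" using p by (simp add: kronecker_def)
  have K_entry: "?K $$ (i * n + t, j * n + u) = (if t = u then p $$ (i, j) else 0)"
    if "i < m" "t < n" "j < m" "u < n" for i t j u
  proof -
    have "i * n + t < m * n" "j * n + u < m * n"
      using that mult_le_mono1[of "Suc i" m n] mult_le_mono1[of "Suc j" m n] by auto
    then show ?thesis using p that by (simp add: kronecker_def)
  qed
  have idx: "i * n + t < m * n" if "i < m" "t < n" for i t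
    using that mult_le_mono1[of "Suc i" m n] by auto
  have "(star_at_w H * ?K * at_z H) $$ (a, b)
      = (\<Sum>s<m * n. (\<Sum>r<m * n. star_w (H $$ (r, a)) * ?K $$ (r, s)) * in_z (H $$ (s, b)))"
    using H K a b
    by (simp add: at_z_eq star_at_w_eq scalar_prod_def lessThan_atLeast0 del: assoc_mult_mat)
  also have "\<dots> = (\<Sum>j<m. \<Sum>u<n. (\<Sum>i<m. \<Sum>t<n. star_w (H $$ (i * n + t, a)) * ?K $$ (i * n + t, j * n + u))
      * in_z (H $$ (j * n + u, b)))"
    by (simp add: sum_blocks)
  also have "\<dots> = (\<Sum>j<m. \<Sum>u<n. (\<Sum>i<m. star_w (H $$ (i * n + u, a)) * p $$ (i, j)) * in_z (H $$ (j * n + u, b)))"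
  proof (intro sum.cong refl arg_cong2[of _ _ _ _ "(*)"])
    fix j u i assume "j \<in> {..<m}" "u \<in> {..<n}" "i \<in> {..<m}"
    then have "(\<Sum>t<n. star_w (H $$ (i * n + t, a)) * ?K $$ (i * n + t, j * n + u))
       = (\<Sum>t<n. if t = u then star_w (H $$ (i * n + u, a)) * p $$ (i, j) else 0)"
      by (intro sum.cong) (auto simp: K_entry)
    then show "(\<Sum>t<n. star_w (H $$ (i * n + t, a)) * ?K $$ (i * n + t, j * n + u))
        = star_w (H $$ (i * n + u, a)) * p $$ (i, j)" using \<open>u \<in> {..<n}\<close> by simp
  qed
  also have "\<dots> = (\<Sum>u<n. \<Sum>j<m. \<Sum>i<m. star_w (H $$ (i * n + u, a)) * p $$ (i, j) * in_z (H $$ (j * n + u, b)))"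
    by (subst sum.swap) (simp add: sum_distrib_right)
  also have "\<dots> = (\<Sum>u<n. \<Sum>i<m. \<Sum>j<m. star_w (H $$ (i * n + u, a)) * p $$ (i, j) * in_z (H $$ (j * n + u, b)))"
    by (intro sum.cong refl sum.swap)
  finally show ?thesis by (simp add: gram_def)
qed

lemma square_entry:
  assumes H: "H \<in> carrier_mat n \<gamma>" and a: "a < \<gamma>" and b: "b < \<gamma>"
  shows "(star_at_w H * at_z H) $$ (a, b) = (\<Sum>t<n. gram 1 (\<lambda>i j. 1) (\<lambda>i c. H $$ (t, c)) a b)"
  using H a b by (simp add: at_z_eq star_at_w_eq scalar_prod_def lessThan_atLeast0 gram_def)

lemma finsum_module_mat_entry:
  fixes f :: "'i \<Rightarrow> 'a::comm_ring_1 mat"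
  assumes "finite A" "\<And>x. x \<in> A \<Longrightarrow> f x \<in> carrier_mat m n" "a < m" "b < n"
  shows "finsum (module_mat TYPE('a) m n) f A \<in> carrier_mat m n"
    and "finsum (module_mat TYPE('a) m n) f A $$ (a, b) = (\<Sum>x\<in>A. f x $$ (a, b))"
proof -
  interpret abelian_group "module_mat TYPE('a) m n" by (rule abelian_group_mat)
  have "finsum (module_mat TYPE('a) m n) f A \<in> carrier_mat m n
      \<and> finsum (module_mat TYPE('a) m n) f A $$ (a, b) = (\<Sum>x\<in>A. f x $$ (a, b))"
    using assms(1,2)
  proof (induction A rule: finite_induct)
    case empty
    then show ?case using assms(3,4) by (simp add: module_mat_simps)
  next
    case (insert x A)
    then have "finsum (module_mat TYPE('a) m n) f (insert x A) = f x + finsum (module_mat TYPE('a) m n) f A"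
      by (subst finsum_insert) (auto simp: module_mat_simps)
    then show ?case using insert assms(3,4) by auto
  qed
  then show "finsum (module_mat TYPE('a) m n) f A \<in> carrier_mat m n"
    and "finsum (module_mat TYPE('a) m n) f A $$ (a, b) = (\<Sum>x\<in>A. f x $$ (a, b))" by auto
qed

locale hereditary_constraints =
  fixes d k :: nat and g :: "nat \<Rightarrow> nat" and P :: "nat \<Rightarrow> wz_poly mat"
  assumes hermitian: "\<And>j. j \<in> {1..k} \<Longrightarrow> P j \<in> hermitian_polys d (g j)"
begin

text \<open>
  The unweighted squares of the generated sets are treated as one more family, with index \<open>0\<close> and the
  $1 \times 1$ weight \<open>1\<close>.
\<close>

definition form_size :: "nat \<Rightarrow> nat" where
  "form_size j = (if j = 0 then 1 else g j)"

definition form :: "nat \<Rightarrow> nat \<Rightarrow> nat \<Rightarrow> wz_poly" where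
  "form j a b = (if j = 0 then 1 else P j $$ (a, b))"

text \<open>
  The elements of the generated sets for all matrix sizes at once, built by adding one term at a time:
  the inflation of \<open>P j\<close> by an identity matrix amounts to a repetition of terms. The entries of \<open>X\<close> may
  contain any variables.
\<close>

inductive_set sos :: "(nat \<Rightarrow> nat \<Rightarrow> wz_poly) set" where
  zero: "(\<lambda>a b. 0) \<in> sos"
| step: "F \<in> sos \<Longrightarrow> j \<le> k \<Longrightarrow> (\<lambda>a b. F a b + gram (form_size j) (form j) X a b) \<in> sos"

lemma sos_gram: "j \<le> k \<Longrightarrow> gram (form_size j) (form j) X \<in> sos"
  using sos.step[OF sos.zero, of j X] by simp

lemma sos_add:
  assumes "F \<in> sos" "G \<in> sos"
  shows "(\<lambda>a b. F a b + G a b) \<in> sos"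
  using assms(2)
proof induction
  case zero
  then show ?case using assms(1) by simp
next
  case (step G j X)
  from sos.step[OF step.IH step.hyps(2), of X] show ?case by (simp add: add.assoc)
qed

lemma sos_sum:
  "finite A \<Longrightarrow> (\<And>x. x \<in> A \<Longrightarrow> F x \<in> sos) \<Longrightarrow> (\<lambda>a b. \<Sum>x\<in>A. F x a b) \<in> sos"
  by (induction A rule: finite_induct) (auto intro: sos.zero sos_add)

lemma form_keys:
  assumes "j \<le> k" "a < form_size j" "b < form_size j"
  shows "Poly_Mapping.keys (form j a b) \<subseteq> multi_indices d \<times> multi_indices d"
proof (cases "j = 0")
  case True
  then show ?thesis by (auto simp: form_def zero_prod_def zero_multi_indices)
next
  case False
  then have "P j \<in> wz_mat_polys d (g j) (g j)" using hermitian assms by (simp add: hermitian_polys_def)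
  moreover from this have "P j $$ (a, b) \<in> elements_mat (P j)"
    using assms False by (intro elements_matI[of _ "g j" "g j"]) (auto simp: wz_mat_polys_def form_size_def)
  ultimately show ?thesis using False by (simp add: wz_mat_polys_def form_def)
qed

lemma generated_set_imp_sos:
  assumes Q: "Q \<in> generated_set d k g P \<gamma>"
  shows "\<exists>F\<in>sos. \<forall>a<\<gamma>. \<forall>b<\<gamma>. Q $$ (a, b) = F a b"
proof -
  from Q obtain n H where H0: "H 0 \<in> z_mat_polys d (1 * n 0) \<gamma>"
    and H: "\<forall>j\<in>{1..k}. n j \<ge> 1 \<and> H j \<in> z_mat_polys d (g j * n j) \<gamma>"
    and Qeq: "Q = star_at_w (H 0) * at_z (H 0) +
        finsum (module_mat TYPE(wz_poly) \<gamma> \<gamma>)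
          (\<lambda>j. star_at_w (H j) * (P j \<otimes>\<^sub>k 1\<^sub>m (n j)) * at_z (H j)) {1..k}"
    unfolding generated_set_def by blast
  define F where "F a b = (\<Sum>j\<le>k. \<Sum>t<n j. gram (form_size j) (form j) (\<lambda>i c. H j $$ (i * n j + t, c)) a b)" for a b
  have "F \<in> sos" unfolding F_def by (intro sos_sum sos_gram) auto
  moreover have "Q $$ (a, b) = F a b" if ab: "a < \<gamma>" "b < \<gamma>" for a b
  proof -
    have c0: "H 0 \<in> carrier_mat (n 0) \<gamma>" using H0 by (simp add: z_mat_polys_def)
    have Pc: "P j \<in> carrier_mat (g j) (g j)" if "j \<in> {1..k}" for j
      using hermitian[OF that] by (simp add: hermitian_polys_def wz_mat_polys_def)
    have cj: "H j \<in> carrier_mat (g j * n j) \<gamma>" if "j \<in> {1..k}" for j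
      using H that by (auto simp: z_mat_polys_def)
    have carr: "star_at_w (H j) * (P j \<otimes>\<^sub>k 1\<^sub>m (n j)) * at_z (H j) \<in> carrier_mat \<gamma> \<gamma>" if "j \<in> {1..k}" for j
      using cj[OF that] by (auto simp: at_z_eq star_at_w_eq)
    note fin = finsum_module_mat_entry[of "{1..k}" "\<lambda>j. star_at_w (H j) * (P j \<otimes>\<^sub>k 1\<^sub>m (n j)) * at_z (H j)",
        OF _ carr ab, simplified]
    have "Q $$ (a, b) = (star_at_w (H 0) * at_z (H 0)) $$ (a, b) +
        (\<Sum>j\<in>{1..k}. (star_at_w (H j) * (P j \<otimes>\<^sub>k 1\<^sub>m (n j)) * at_z (H j)) $$ (a, b))"
      unfolding Qeq using fin ab by simp
    also have "(star_at_w (H 0) * at_z (H 0)) $$ (a, b) = (\<Sum>t<n 0. gram (form_size 0) (form 0) (\<lambda>i c. H 0 $$ (i * n 0 + t, c)) a b)"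
      by (simp add: square_entry[OF c0 ab] gram_def form_size_def form_def)
    also have "(\<Sum>j\<in>{1..k}. (star_at_w (H j) * (P j \<otimes>\<^sub>k 1\<^sub>m (n j)) * at_z (H j)) $$ (a, b))
       = (\<Sum>j\<in>{1..k}. \<Sum>t<n j. gram (form_size j) (form j) (\<lambda>i c. H j $$ (i * n j + t, c)) a b)"
      by (intro sum.cong refl) (simp add: sandwich_entry[OF cj Pc ab] gram_def form_size_def form_def)
    also have "(\<Sum>t<n 0. gram (form_size 0) (form 0) (\<lambda>i c. H 0 $$ (i * n 0 + t, c)) a b) + \<dots> = F a b"
    proof -
      have "{..k} = insert 0 {1..k}" by auto
      then show ?thesis by (simp add: F_def)
    qed
    finally show ?thesis .
  qed
  ultimately show ?thesis by blast
qed

lemma prune_gram: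
  assumes "j \<le> k"
  shows "prune d (gram (form_size j) (form j) X a b) = gram (form_size j) (form j) (\<lambda>i c. prune_z d (X i c)) a b"
  unfolding gram_def prune_sum prune_mult prune_in_z prune_star_w
  by (intro sum.cong refl) (use prune_id[OF form_keys[OF assms]] in auto)

text \<open>
  Terms with the same \<open>j\<close> are collected: \<open>Y j t\<close> is the \<open>t\<close>-th of \<open>n j\<close> matrices. Starting with the zero matrix
  for every \<open>j\<close> ensures \<open>n j \<ge> 1\<close>.
\<close>

lemma sos_prune_expansion:
  assumes "F \<in> sos"
  shows "\<exists>(n :: nat \<Rightarrow> nat) Y. (\<forall>j. 1 \<le> n j) \<and> (\<forall>j t i a. Poly_Mapping.keys (Y j t i a) \<subseteq> multi_indices d) \<and>
    (\<forall>a b. prune d (F a b) = (\<Sum>j\<le>k. \<Sum>t<n j. gram (form_size j) (form j) (Y j t) a b))"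
  using assms
proof induction
  case zero
  show ?case
    by (rule exI[where x = "\<lambda>_. 1"], rule exI[where x = "\<lambda>_ _ _ _. 0"])
       (simp add: prune_zero gram_def in_z_zero)
next
  case (step F j X)
  then obtain n :: "nat \<Rightarrow> nat" and Y :: "nat \<Rightarrow> nat \<Rightarrow> nat \<Rightarrow> nat \<Rightarrow> z_poly" where n: "\<forall>j. 1 \<le> n j"
    and Y: "\<forall>j t i a. Poly_Mapping.keys (Y j t i a) \<subseteq> multi_indices d"
    and F: "\<And>a b. prune d (F a b) = (\<Sum>j\<le>k. \<Sum>t<n j. gram (form_size j) (form j) (Y j t) a b)"
    by blast
  define n' where "n' = n(j := Suc (n j))"
  define Y' where "Y' = Y(j := (Y j)(n j := (\<lambda>i c. prune_z d (X i c))))"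
  have "(\<Sum>i\<le>k. \<Sum>t<n' i. gram (form_size i) (form i) (Y' i t) a b)
     = (\<Sum>i\<le>k. \<Sum>t<n i. gram (form_size i) (form i) (Y i t) a b) + gram (form_size j) (form j) (\<lambda>i c. prune_z d (X i c)) a b" for a b
  proof -
    have "(\<Sum>i\<le>k. \<Sum>t<n' i. gram (form_size i) (form i) (Y' i t) a b)
      = (\<Sum>t<n' j. gram (form_size j) (form j) (Y' j t) a b) + (\<Sum>i\<in>{..k} - {j}. \<Sum>t<n' i. gram (form_size i) (form i) (Y' i t) a b)"
      using step.hyps(2) by (intro sum.remove) auto
    also have "(\<Sum>t<n' j. gram (form_size j) (form j) (Y' j t) a b)
      = (\<Sum>t<n j. gram (form_size j) (form j) (Y j t) a b) + gram (form_size j) (form j) (\<lambda>i c. prune_z d (X i c)) a b"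
      by (simp add: n'_def Y'_def)
    also have "(\<Sum>i\<in>{..k} - {j}. \<Sum>t<n' i. gram (form_size i) (form i) (Y' i t) a b)
       = (\<Sum>i\<in>{..k} - {j}. \<Sum>t<n i. gram (form_size i) (form i) (Y i t) a b)"
      by (intro sum.cong refl) (auto simp: n'_def Y'_def)
    finally show ?thesis
      using sum.remove[of "{..k}" j "\<lambda>i. \<Sum>t<n i. gram (form_size i) (form i) (Y i t) a b"] step.hyps(2)
      by (simp add: algebra_simps)
  qed
  then have "\<forall>a b. prune d (F a b + gram (form_size j) (form j) X a b) = (\<Sum>i\<le>k. \<Sum>t<n' i. gram (form_size i) (form i) (Y' i t) a b)"
    using step.hyps(2) by (simp add: prune_add F prune_gram)
  moreover have "\<forall>j. 1 \<le> n' j" using n by (simp add: n'_def)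
  moreover have "\<forall>j t i a. Poly_Mapping.keys (Y' j t i a) \<subseteq> multi_indices d"
    using Y keys_prune_z by (simp add: Y'_def)
  ultimately show ?case by blast
qed

lemma sos_imp_generated_set:
  assumes Q: "Q \<in> hermitian_polys d \<gamma>" and F: "F \<in> sos"
    and eq: "\<And>a b. a < \<gamma> \<Longrightarrow> b < \<gamma> \<Longrightarrow> Q $$ (a, b) = prune d (F a b)"
  shows "Q \<in> generated_set d k g P \<gamma>"
proof -
  obtain n :: "nat \<Rightarrow> nat" and Y :: "nat \<Rightarrow> nat \<Rightarrow> nat \<Rightarrow> nat \<Rightarrow> z_poly" where n: "\<And>j. 1 \<le> n j"
    and Y: "\<And>j t i a. Poly_Mapping.keys (Y j t i a) \<subseteq> multi_indices d"
    and FY: "\<And>a b. prune d (F a b) = (\<Sum>j\<le>k. \<Sum>t<n j. gram (form_size j) (form j) (Y j t) a b)"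
    using sos_prune_expansion[OF F] by blast
  define H where "H j = mat (form_size j * n j) \<gamma> (\<lambda>(r, a). Y j (r mod n j) (r div n j) a)" for j
  have Hc: "H j \<in> carrier_mat (form_size j * n j) \<gamma>" for j by (simp add: H_def)
  have Hp: "H j \<in> z_mat_polys d (form_size j * n j) \<gamma>" for j
    using Y by (auto simp: z_mat_polys_def H_def elements_mat_def)
  have He: "H j $$ (i * n j + t, a) = Y j t i a" if "i < form_size j" "t < n j" "a < \<gamma>" for j i t a
  proof -
    have "i * n j + t < form_size j * n j" using that mult_le_mono1[of "Suc i" "form_size j" "n j"] by auto
    then show ?thesis using that by (simp add: H_def)
  qed
  have gram_eq: "gram (form_size j) p (\<lambda>i c. H j $$ (i * n j + t, c)) a b = gram (form_size j) p (Y j t) a b"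
    if "t < n j" "a < \<gamma>" "b < \<gamma>" for j t a b p
    unfolding gram_def using that by (intro sum.cong refl) (simp add: He)
  let ?R = "star_at_w (H 0) * at_z (H 0) +
        finsum (module_mat TYPE(wz_poly) \<gamma> \<gamma>)
          (\<lambda>j. star_at_w (H j) * (P j \<otimes>\<^sub>k 1\<^sub>m (n j)) * at_z (H j)) {1..k}"
  have carr: "star_at_w (H j) * (P j \<otimes>\<^sub>k 1\<^sub>m (n j)) * at_z (H j) \<in> carrier_mat \<gamma> \<gamma>" for j
    using Hc[of j] by (auto simp: at_z_eq star_at_w_eq)
  have Pc: "P j \<in> carrier_mat (g j) (g j)" if "j \<in> {1..k}" for j
    using hermitian[OF that] by (simp add: hermitian_polys_def wz_mat_polys_def)
  have Qc: "Q \<in> carrier_mat \<gamma> \<gamma>" using Q by (simp add: hermitian_polys_def wz_mat_polys_def)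
  have c0: "H 0 \<in> carrier_mat (n 0) \<gamma>" using Hc[of 0] by (simp add: form_size_def)
  have cj: "H j \<in> carrier_mat (g j * n j) \<gamma>" if "j \<in> {1..k}" for j
    using Hc[of j] that by (simp add: form_size_def)
  have fin_carr: "finsum (module_mat TYPE(wz_poly) \<gamma> \<gamma>)
          (\<lambda>j. star_at_w (H j) * (P j \<otimes>\<^sub>k 1\<^sub>m (n j)) * at_z (H j)) {1..k} \<in> carrier_mat \<gamma> \<gamma>"
  proof -
    interpret abelian_group "module_mat TYPE(wz_poly) \<gamma> \<gamma>" by (rule abelian_group_mat)
    show ?thesis using finsum_closed[of "\<lambda>j. star_at_w (H j) * (P j \<otimes>\<^sub>k 1\<^sub>m (n j)) * at_z (H j)" "{1..k}"] carr
      by (simp add: module_mat_simps)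
  qed
  have "Q = ?R"
  proof (rule eq_matI)
    show "dim_row Q = dim_row ?R" "dim_col Q = dim_col ?R" using Qc fin_carr by auto
    fix a b assume "a < dim_row ?R" "b < dim_col ?R"
    then have ab: "a < \<gamma>" "b < \<gamma>" using fin_carr by auto
    note fin = finsum_module_mat_entry[of "{1..k}" "\<lambda>j. star_at_w (H j) * (P j \<otimes>\<^sub>k 1\<^sub>m (n j)) * at_z (H j)",
        OF _ carr ab, simplified]
    have "Q $$ (a, b) = (\<Sum>j\<le>k. \<Sum>t<n j. gram (form_size j) (form j) (Y j t) a b)"
      using eq ab FY by simp
    also have "{..k} = insert 0 {1..k}" by auto
    also have "(\<Sum>j\<in>insert 0 {1..k}. \<Sum>t<n j. gram (form_size j) (form j) (Y j t) a b)
       = (\<Sum>t<n 0. gram (form_size 0) (form 0) (Y 0 t) a b) + (\<Sum>j\<in>{1..k}. \<Sum>t<n j. gram (form_size j) (form j) (Y j t) a b)"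
      by simp
    also have "(\<Sum>t<n 0. gram (form_size 0) (form 0) (Y 0 t) a b) = (star_at_w (H 0) * at_z (H 0)) $$ (a, b)"
      unfolding square_entry[OF c0 ab] using gram_eq[of _ 0 a b "form 0"] ab
      by (intro sum.cong refl) (simp add: gram_def form_size_def form_def)
    also have "(\<Sum>j\<in>{1..k}. \<Sum>t<n j. gram (form_size j) (form j) (Y j t) a b)
       = (\<Sum>j\<in>{1..k}. (star_at_w (H j) * (P j \<otimes>\<^sub>k 1\<^sub>m (n j)) * at_z (H j)) $$ (a, b))"
    proof (rule sum.cong[OF refl])
      fix j assume j: "j \<in> {1..k}"
      have f: "form j = (\<lambda>i l. P j $$ (i, l))" and s: "form_size j = g j" using j by (auto simp: form_def form_size_def fun_eq_iff)
      show "(\<Sum>t<n j. gram (form_size j) (form j) (Y j t) a b) = (star_at_w (H j) * (P j \<otimes>\<^sub>k 1\<^sub>m (n j)) * at_z (H j)) $$ (a, b)"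
        unfolding sandwich_entry[OF cj[OF j] Pc[OF j] ab]
        using gram_eq[of _ j a b "form j"] ab by (intro sum.cong refl) (simp add: f s)
    qed
    finally show "Q $$ (a, b) = ?R $$ (a, b)" using fin ab by simp
  qed
  moreover have "H 0 \<in> z_mat_polys d (1 * n 0) \<gamma>" using Hp[of 0] by (simp add: form_size_def)
  moreover have "\<forall>j\<in>{1..k}. n j \<ge> 1 \<and> H j \<in> z_mat_polys d (g j * n j) \<gamma>"
  proof
    fix j assume "j \<in> {1..k}"
    then have "form_size j = g j" by (simp add: form_size_def)
    then show "n j \<ge> 1 \<and> H j \<in> z_mat_polys d (g j * n j) \<gamma>" using Hp[of j] n[of j] by simp
  qed
  ultimately show ?thesis unfolding generated_set_def using Q n by blast
qed

end

section \<open>The cone of a matrix size and its order unit\<close>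

definition fscale :: "complex \<Rightarrow> (nat \<Rightarrow> nat \<Rightarrow> wz_poly) \<Rightarrow> nat \<Rightarrow> nat \<Rightarrow> wz_poly" where
  "fscale c F = (\<lambda>a b. poly_const c * F a b)"

definition rscale :: "complex \<Rightarrow> (nat \<Rightarrow> z_poly) \<Rightarrow> nat \<Rightarrow> z_poly" where
  "rscale c u = (\<lambda>a. Poly_Mapping.single 0 c * u a)"

text \<open>
  For row vectors \<open>v\<close> and \<open>u\<close> this is the matrix polynomial $v^*(w) u(z)$.
\<close>

definition outer :: "(nat \<Rightarrow> z_poly) \<Rightarrow> (nat \<Rightarrow> z_poly) \<Rightarrow> nat \<Rightarrow> nat \<Rightarrow> wz_poly" where
  "outer v u = (\<lambda>a b. star_w (v a) * in_z (u b))"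

definition fstar :: "(nat \<Rightarrow> nat \<Rightarrow> wz_poly) \<Rightarrow> nat \<Rightarrow> nat \<Rightarrow> wz_poly" where
  "fstar F = (\<lambda>a b. star (F b a))"

definition funit :: "nat \<Rightarrow> nat \<Rightarrow> wz_poly" where
  "funit = (\<lambda>a b. if a = b then 1 else 0)"

text \<open>
  The row vector with the entry \<open>p\<close> at position \<open>b\<close> and zeros elsewhere.
\<close>

definition entry_row :: "nat \<Rightarrow> z_poly \<Rightarrow> nat \<Rightarrow> z_poly" where
  "entry_row b p = (\<lambda>a. if a = b then p else 0)"

definition zmult :: "nat \<Rightarrow> (nat \<Rightarrow> z_poly) \<Rightarrow> nat \<Rightarrow> z_poly" where
  "zmult i u = (\<lambda>a. Poly_Mapping.single (Poly_Mapping.single i 1) 1 * u a)"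

lemma poly_const_minus: "poly_const (- a) = - poly_const a"
  by (simp add: poly_const_def single_uminus)

lemma vector_space_fscale: "vector_space (\<lambda>r. fscale (of_real r))"
  by unfold_locales
     (auto simp: fscale_def fun_eq_iff poly_const_add poly_const_mult algebra_simps)

lemma vector_space_rscale: "vector_space rscale"
  by unfold_locales
     (auto simp: rscale_def fun_eq_iff single_add mult_single algebra_simps simp flip: mult.assoc)

lemma fscale_add_left: "fscale (a + b) F = fscale a F + fscale b F"
  and fscale_mult: "fscale (a * b) F = fscale a (fscale b F)"
  and fscale_minus_left: "fscale (- a) F = - fscale a F"
  and fscale_one: "fscale 1 F = F"
  by (simp_all add: fscale_def fun_eq_iff poly_const_add poly_const_mult poly_const_minus algebra_simps)

lemma fstar_fscale: "fstar (fscale c F) = fscale (cnj c) (fstar F)"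
  by (simp add: fstar_def fscale_def star_mult star_poly_const)

lemma fstar_add: "fstar (F + G) = fstar F + fstar G"
  by (simp add: fstar_def star_add fun_eq_iff)

lemma fstar_fstar: "fstar (fstar F) = F"
  by (simp add: fstar_def star_star)

lemma fstar_outer: "fstar (outer v u) = outer u v"
  by (simp add: fstar_def outer_def star_mult star_star_w star_in_z mult.commute)

lemma outer_add_right: "outer v (u + u') = outer v u + outer v u'"
  by (simp add: outer_def in_z_add fun_eq_iff algebra_simps)

lemma outer_rscale_right: "outer v (rscale c u) = fscale c (outer v u)"
  by (simp add: outer_def rscale_def fscale_def in_z_mult in_z_const fun_eq_iff algebra_simps)

lemma star_hermitian_poly:
  assumes P: "P \<in> hermitian_polys d m" and a: "a < m" and b: "b < m"
  shows "star (P $$ (a, b)) = P $$ (b, a)"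
proof (rule poly_mapping_eqI)
  fix k :: "multi_index \<times> multi_index"
  obtain \<kappa> \<mu> where k: "k = (\<kappa>, \<mu>)" by (cases k)
  have Pc: "P \<in> carrier_mat m m" using P by (simp add: hermitian_polys_def wz_mat_polys_def)
  have "mat_coeff P \<kappa> \<mu> = mat_adjoint (mat_coeff P \<mu> \<kappa>)"
    using P unfolding hermitian_polys_def by blast
  then have "mat_coeff P \<kappa> \<mu> $$ (b, a) = mat_adjoint (mat_coeff P \<mu> \<kappa>) $$ (b, a)" by (rule arg_cong)
  then show "Poly_Mapping.lookup (star (P $$ (a, b))) k = Poly_Mapping.lookup (P $$ (b, a)) k"
    using Pc a b by (simp add: k lookup_star mat_coeff_def mat_adjoint_def mat_of_rows_def)
qed

context hereditary_constraints
begin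

lemma star_form:
  assumes "j \<le> k" "a < form_size j" "b < form_size j"
  shows "star (form j a b) = form j b a"
proof (cases "j = 0")
  case True
  then show ?thesis using star_poly_const[of 1] by (simp add: form_def)
next
  case False
  then show ?thesis using star_hermitian_poly[OF hermitian[of j]] assms by (simp add: form_def form_size_def)
qed

lemma fstar_gram:
  assumes "j \<le> k"
  shows "fstar (gram (form_size j) (form j) X) = gram (form_size j) (form j) X"
proof (intro ext)
  fix a b
  have "fstar (gram (form_size j) (form j) X) a b
     = (\<Sum>i<form_size j. \<Sum>l<form_size j. star_w (X l a) * form j l i * in_z (X i b))"
    unfolding fstar_def gram_def star_sum
    by (intro sum.cong refl) (simp add: star_mult star_form assms star_star_w star_in_z algebra_simps)
  also have "\<dots> = gram (form_size j) (form j) X a b"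
    unfolding gram_def by (rule sum.swap)
  finally show "fstar (gram (form_size j) (form j) X) a b = gram (form_size j) (form j) X a b" .
qed

lemma fstar_sos: "G \<in> sos \<Longrightarrow> fstar G = G"
proof (induction rule: sos.induct)
  case (step F j X)
  have "fstar (F + gram (form_size j) (form j) X) = F + gram (form_size j) (form j) X"
    using step fstar_gram by (simp add: fstar_add)
  then show ?case by (simp add: plus_fun_def)
qed (simp add: fstar_def star_zero)

lemma sos_fscale:
  assumes "0 \<le> r" "G \<in> sos"
  shows "fscale (of_real r) G \<in> sos"
  using assms(2)
proof induction
  case zero
  then show ?case using sos.zero by (simp add: fscale_def)
next
  case (step F j X)
  \<comment> \<open>a nonnegative factor is absorbed into both sides of the congruence\<close>
  let ?X = "\<lambda>i. rscale (of_real (sqrt r)) (X i)"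
  have "poly_const (of_real r) = poly_const (of_real (sqrt r)) * poly_const (of_real (sqrt r))"
    using assms(1) by (simp add: of_real_mult[symmetric] del: of_real_mult flip: poly_const_mult)
  then have "gram (form_size j) (form j) ?X = fscale (of_real r) (gram (form_size j) (form j) X)"
    by (auto simp: gram_def fscale_def rscale_def fun_eq_iff star_w_mult in_z_mult star_w_const in_z_const
        sum_distrib_left intro!: sum.cong)
  moreover have "(\<lambda>a b. fscale (of_real r) F a b + gram (form_size j) (form j) ?X a b) \<in> sos"
    using step by (intro sos.step)
  ultimately show ?case by (simp add: fscale_def distrib_left)
qed

lemma sos_outer: "outer u u \<in> sos"
proof -
  have "gram (form_size 0) (form 0) (\<lambda>_. u) = outer u u"
    by (simp add: gram_def form_size_def form_def outer_def fun_eq_iff)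
  then show ?thesis using sos_gram[of 0 "\<lambda>_. u"] by simp
qed

text \<open>
  An element of $\mathcal{M}_1$ times the square of a row vector \<open>u\<close>: each $X^* P_j X$ becomes
  $(X u)^* P_j (X u)$.
\<close>

lemma sos_sandwich:
  assumes "G \<in> sos"
  shows "(\<lambda>a b. star_w (u a) * G 0 0 * in_z (u b)) \<in> sos"
  using assms
proof induction
  case zero
  then show ?case using sos.zero by simp
next
  case (step F j X)
  have "(\<lambda>a b. star_w (u a) * gram (form_size j) (form j) X 0 0 * in_z (u b))
     = gram (form_size j) (form j) (\<lambda>i a. X i 0 * u a)"
    by (auto simp: gram_def fun_eq_iff star_w_mult in_z_mult sum_distrib_left sum_distrib_right
        algebra_simps intro!: sum.cong)
  then show ?case
    using sos.step[OF step.IH step.hyps(2), of "\<lambda>i a. X i 0 * u a"] by (simp add: fun_eq_iff algebra_simps)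
qed

text \<open>
  All matrix polynomials whose hermitian part belongs to $\mathcal{M}_\gamma$, up to the entries outside
  the $\gamma \times \gamma$ block and the variables of index at least \<open>d\<close>. As antihermitian polynomials
  are included, separation takes place in a complex vector space of all matrix polynomials.
\<close>

definition cone :: "nat \<Rightarrow> (nat \<Rightarrow> nat \<Rightarrow> wz_poly) set" where
  "cone \<gamma> = {F. \<exists>G\<in>sos. \<forall>a<\<gamma>. \<forall>b<\<gamma>. prune d ((F + fstar F) a b) = prune d (G a b)}"

lemma cone_cong:
  assumes "F \<in> cone \<gamma>"
    and "\<And>a b. a < \<gamma> \<Longrightarrow> b < \<gamma> \<Longrightarrow> prune d ((F + fstar F) a b) = prune d ((F' + fstar F') a b)"
  shows "F' \<in> cone \<gamma>"
  using assms unfolding cone_def by force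

lemma cone_cong_entries:
  assumes "F \<in> cone \<gamma>" and "\<And>a b. a < \<gamma> \<Longrightarrow> b < \<gamma> \<Longrightarrow> F a b = F' a b"
  shows "F' \<in> cone \<gamma>"
  using assms(1) by (rule cone_cong) (simp add: assms(2) fstar_def)

lemma cone_add:
  assumes "F \<in> cone \<gamma>" "F' \<in> cone \<gamma>"
  shows "F + F' \<in> cone \<gamma>"
proof -
  obtain G G' where "G \<in> sos" "G' \<in> sos"
    "\<forall>a<\<gamma>. \<forall>b<\<gamma>. prune d ((F + fstar F) a b) = prune d (G a b)"
    "\<forall>a<\<gamma>. \<forall>b<\<gamma>. prune d ((F' + fstar F') a b) = prune d (G' a b)"
    using assms by (auto simp: cone_def)
  then show ?thesis unfolding cone_def
    by (auto intro!: bexI[OF _ sos_add[of G G']] simp: fstar_add prune_add algebra_simps)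
qed

lemma cone_fscale:
  assumes "0 \<le> r" "F \<in> cone \<gamma>"
  shows "fscale (of_real r) F \<in> cone \<gamma>"
proof -
  obtain G where "G \<in> sos" "\<forall>a<\<gamma>. \<forall>b<\<gamma>. prune d ((F + fstar F) a b) = prune d (G a b)"
    using assms by (auto simp: cone_def)
  moreover have "(fscale (of_real r) F + fstar (fscale (of_real r) F)) a b
      = poly_const (of_real r) * ((F + fstar F) a b)" for a b
    unfolding fstar_fscale by (simp add: fscale_def distrib_left)
  ultimately show ?thesis unfolding cone_def
    by (auto intro!: bexI[OF _ sos_fscale[OF assms(1), of G]]
        simp: prune_mult fscale_def simp del: plus_fun_apply)
qed

lemma sos_cone: "G \<in> sos \<Longrightarrow> G \<in> cone \<gamma>"
  unfolding cone_def using fstar_sos sos_add[of G G] by force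

lemma antihermitian_cone:
  assumes "\<And>a b. a < \<gamma> \<Longrightarrow> b < \<gamma> \<Longrightarrow> prune d ((F + fstar F) a b) = 0"
  shows "F \<in> cone \<gamma>"
  unfolding cone_def using assms by (auto intro!: bexI[OF _ sos.zero] simp: prune_zero)

lemma diagonal_sum:
  "a < \<gamma> \<Longrightarrow> (\<Sum>c\<in>{..<\<gamma>} - A. outer (entry_row c p) (entry_row c p) a b) = (if a = b \<and> a \<notin> A then star_w p * in_z p else 0)"
proof -
  assume a: "a < \<gamma>"
  have "(\<Sum>c\<in>{..<\<gamma>} - A. outer (entry_row c p) (entry_row c p) a b)
    = (\<Sum>c\<in>{..<\<gamma>} - A. if c = a then (if a = b then star_w p * in_z p else 0) else 0)"
    by (intro sum.cong refl) (auto simp: outer_def entry_row_def star_w_zero in_z_zero)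
  then show ?thesis using a by auto
qed

lemma funit_cone: "funit \<in> cone \<gamma>"
proof (rule cone_cong_entries)
  show "(\<lambda>a b. \<Sum>c\<in>{..<\<gamma>} - {}. outer (entry_row c 1) (entry_row c 1) a b) \<in> cone \<gamma>"
    by (intro sos_cone sos_sum sos_outer) auto
  show "(\<Sum>c\<in>{..<\<gamma>} - {}. outer (entry_row c 1) (entry_row c 1) a b) = funit a b" if "a < \<gamma>" for a b
    by (subst diagonal_sum[OF that]) (auto simp: funit_def star_w_one in_z_one)
qed

end

locale archimedean_constraints = hereditary_constraints +
  fixes c :: real
  assumes archimedean: "\<And>i. i < d \<Longrightarrow>
    mat 1 1 (\<lambda>_. poly_const (of_real (c\<^sup>2)) - var_w i * var_z i) \<in> generated_set d k g P 1"
begin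

text \<open>
  For \<open>i < d\<close> this is the sandwiched archimedean hypothesis. For the other variables the second square is
  killed by pruning.
\<close>

lemma zmult_bounded: "fscale (of_real (c\<^sup>2)) (outer u u) - outer (zmult i u) (zmult i u) \<in> cone \<gamma>"
proof -
  have w: "star_w (zmult i u a) = var_w i * star_w (u a)" and z: "in_z (zmult i u a) = var_z i * in_z (u a)" for a
    by (simp_all add: zmult_def star_w_mult in_z_mult star_w_single in_z_single var_w_def var_z_def)
  show ?thesis
  proof (cases "i < d")
    case True
    obtain G where G: "G \<in> sos" "poly_const (of_real (c\<^sup>2)) - var_w i * var_z i = G 0 0"
      using generated_set_imp_sos[OF archimedean[OF True]] by auto
    have "(\<lambda>a b. star_w (u a) * G 0 0 * in_z (u b)) = fscale (of_real (c\<^sup>2)) (outer u u) - outer (zmult i u) (zmult i u)"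
      by (simp add: G(2)[symmetric] fun_eq_iff fscale_def outer_def w z algebra_simps)
    then show ?thesis using sos_cone[OF sos_sandwich[OF G(1), of u]] by simp
  next
    case False
    then have z0: "prune d (var_z i) = 0"
      by (simp add: var_z_def prune_single multi_indices_def)
    show ?thesis
    proof (rule cone_cong)
      show "fscale (of_real (c\<^sup>2)) (outer u u) \<in> cone \<gamma>"
        by (intro cone_fscale sos_cone sos_outer) auto
      have "prune d (outer (zmult i u) (zmult i u) a b) = 0" for a b
        by (simp add: outer_def z prune_mult z0)
      then show "prune d ((fscale (of_real (c\<^sup>2)) (outer u u) + fstar (fscale (of_real (c\<^sup>2)) (outer u u))) a b)
        = prune d ((fscale (of_real (c\<^sup>2)) (outer u u) - outer (zmult i u) (zmult i u)
          + fstar (fscale (of_real (c\<^sup>2)) (outer u u) - outer (zmult i u) (zmult i u))) a b)" for a b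
        using fstar_outer[of "zmult i u" "zmult i u"]
        by (simp add: additive_diff[of fstar, OF fstar_add] prune_add prune_mult additive_diff[of "prune d", OF prune_add])
    qed
  qed
qed

text \<open>
  The polynomials that lie below some multiple of the identity.
\<close>

definition order_bounded :: "nat \<Rightarrow> (nat \<Rightarrow> nat \<Rightarrow> wz_poly) set" where
  "order_bounded \<gamma> = {F. \<exists>r. fscale (of_real r) funit - F \<in> cone \<gamma>}"

lemma bounded_add:
  assumes "F \<in> order_bounded \<gamma>" "G \<in> order_bounded \<gamma>"
  shows "F + G \<in> order_bounded \<gamma>"
proof -
  obtain r s where "fscale (of_real r) funit - F \<in> cone \<gamma>" "fscale (of_real s) funit - G \<in> cone \<gamma>"
    using assms by (auto simp: order_bounded_def)
  then have "(fscale (of_real r) funit - F) + (fscale (of_real s) funit - G) \<in> cone \<gamma>" by (rule cone_add)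
  also have "(fscale (of_real r) funit - F) + (fscale (of_real s) funit - G) = fscale (of_real (r + s)) funit - (F + G)"
    by (simp add: fscale_add_left algebra_simps)
  finally show ?thesis unfolding order_bounded_def by blast
qed

lemma bounded_cong:
  assumes "F \<in> order_bounded \<gamma>" and "\<And>a b. a < \<gamma> \<Longrightarrow> b < \<gamma> \<Longrightarrow> F a b = F' a b"
  shows "F' \<in> order_bounded \<gamma>"
proof -
  obtain r where "fscale (of_real r) funit - F \<in> cone \<gamma>" using assms by (auto simp: order_bounded_def)
  then have "fscale (of_real r) funit - F' \<in> cone \<gamma>" by (rule cone_cong_entries) (simp add: assms(2))
  then show ?thesis unfolding order_bounded_def by blast
qed

lemma bounded_zero: "0 \<in> order_bounded \<gamma>"
  unfolding order_bounded_def using funit_cone by (auto intro!: exI[of _ 1] simp: fscale_one)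

lemma bounded_sum: "(\<And>x. x \<in> A \<Longrightarrow> F x \<in> order_bounded \<gamma>) \<Longrightarrow> (\<Sum>x\<in>A. F x) \<in> order_bounded \<gamma>"
  by (induction A rule: infinite_finite_induct) (auto intro: bounded_add simp: bounded_zero)

text \<open>
  By induction on the monomial: a constant is dominated by the identity since the difference is a sum of
  squares of the remaining diagonal entries, and \<open>zmult_bounded\<close> admits one more variable.
\<close>

lemma bounded_square_row:
  "outer (entry_row b (Poly_Mapping.single \<mu> a)) (entry_row b (Poly_Mapping.single \<mu> a)) \<in> order_bounded \<gamma>"
proof -
  define Q where "Q \<nu> \<longleftrightarrow> outer (entry_row b (Poly_Mapping.single \<nu> a)) (entry_row b (Poly_Mapping.single \<nu> a)) \<in> order_bounded \<gamma>" for \<nu>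
  have "Q 0"
  proof -
    let ?p = "Poly_Mapping.single 0 a :: z_poly"
    have "fscale (of_real ((cmod a)\<^sup>2)) funit - outer (entry_row b ?p) (entry_row b ?p) \<in> cone \<gamma>"
    proof (rule cone_cong_entries)
      show "(\<lambda>x y. \<Sum>c\<in>{..<\<gamma>} - {b}. outer (entry_row c ?p) (entry_row c ?p) x y) \<in> cone \<gamma>"
        by (intro sos_cone sos_sum sos_outer) auto
      show "(\<Sum>c\<in>{..<\<gamma>} - {b}. outer (entry_row c ?p) (entry_row c ?p) x y)
         = (fscale (of_real ((cmod a)\<^sup>2)) funit - outer (entry_row b ?p) (entry_row b ?p)) x y" if "x < \<gamma>" for x y
      proof -
        have "poly_const (of_real ((cmod a)\<^sup>2)) = star_w ?p * in_z ?p"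
          unfolding complex_norm_square
          by (simp add: star_w_const in_z_const mult.commute flip: poly_const_mult)
        then show ?thesis
          by (subst diagonal_sum[OF that])
             (auto simp: fscale_def funit_def outer_def entry_row_def star_w_zero in_z_zero)
      qed
    qed
    then show ?thesis unfolding Q_def order_bounded_def by blast
  qed
  have step: "Q (Poly_Mapping.single i 1 + \<nu>)" if Q: "Q \<nu>" for i \<nu>
  proof -
    let ?u = "entry_row b (Poly_Mapping.single \<nu> a)" and ?v = "entry_row b (Poly_Mapping.single (Poly_Mapping.single i 1 + \<nu>) a)"
    obtain r where r: "fscale (of_real r) funit - outer ?u ?u \<in> cone \<gamma>"
      using Q unfolding Q_def order_bounded_def by blast
    have "fscale (of_real (c\<^sup>2)) (fscale (of_real r) funit - outer ?u ?u)
        + (fscale (of_real (c\<^sup>2)) (outer ?u ?u) - outer (zmult i ?u) (zmult i ?u)) \<in> cone \<gamma>"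
      by (intro cone_add cone_fscale r zmult_bounded) auto
    also have "zmult i ?u = ?v" by (auto simp: zmult_def entry_row_def mult_single)
    also have "fscale (of_real (c\<^sup>2)) (fscale (of_real r) funit - outer ?u ?u)
        + (fscale (of_real (c\<^sup>2)) (outer ?u ?u) - outer ?v ?v) = fscale (of_real (c\<^sup>2 * r)) funit - outer ?v ?v"
      by (simp add: fscale_def fun_eq_iff poly_const_mult algebra_simps)
    finally show ?thesis unfolding Q_def order_bounded_def by blast
  qed
  have "\<forall>\<nu>'. Q \<nu>' \<longrightarrow> Q (\<nu> + \<nu>')" for \<nu> :: multi_index
  proof (induction \<nu> rule: poly_mapping_sum_induct)
    case (single i n)
    show ?case
    proof (induction n)
      case (Suc n)
      have "Poly_Mapping.single i (Suc n) + \<nu>' = Poly_Mapping.single i 1 + (Poly_Mapping.single i n + \<nu>')" for \<nu>'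
        by (simp add: single_add[symmetric] add.assoc[symmetric])
      then show ?case using Suc step by metis
    qed simp
  next
    case (add p q)
    then show ?case by (metis add.assoc)
  qed simp
  then have "Q (\<mu> + 0)" using \<open>Q 0\<close> by blast
  then show ?thesis unfolding Q_def by simp
qed

text \<open>
  Polarization: the hermitian parts of $v^* u$ and of $\frac12 (v^* v + u^* u - (v - u)^*(v - u))$ agree.
\<close>

lemma bounded_outer:
  assumes "outer v v \<in> order_bounded \<gamma>" "outer u u \<in> order_bounded \<gamma>"
  shows "outer v u \<in> order_bounded \<gamma>"
proof -
  obtain r s where rs: "fscale (of_real r) funit - outer v v \<in> cone \<gamma>" "fscale (of_real s) funit - outer u u \<in> cone \<gamma>"
    using assms by (auto simp: order_bounded_def)
  define W where "W = (fscale (of_real r) funit - outer v v) + (fscale (of_real s) funit - outer u u) + outer (v - u) (v - u)"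
  let ?T = "fscale (of_real ((r + s) / 2)) funit - outer v u"
  have "W \<in> cone \<gamma>" unfolding W_def by (intro cone_add rs sos_cone sos_outer)
  then have "fscale (of_real (1/2)) W \<in> cone \<gamma>" by (intro cone_fscale) auto
  then have "?T \<in> cone \<gamma>"
  proof (rule cone_cong)
    have u: "fstar funit = funit" using star_poly_const[of 1] by (auto simp: fstar_def funit_def fun_eq_iff star_zero)
    note fd = additive_diff[of fstar, OF fstar_add]
    have "fstar W = W" unfolding W_def by (simp add: fstar_add fd fstar_fscale u fstar_outer)
    then have "fscale (of_real (1/2)) W + fstar (fscale (of_real (1/2)) W) = W"
      by (simp add: fstar_fscale fscale_one flip: fscale_add_left)
    also have "W = ?T + fstar ?T"
    proof -
      have "?T + fstar ?T = fscale (of_real ((r + s) / 2)) funit + fscale (of_real ((r + s) / 2)) funit - outer v u - outer u v"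
        by (simp add: fd fstar_fscale u fstar_outer)
      also have "fscale (of_real ((r + s) / 2)) funit + fscale (of_real ((r + s) / 2)) funit = fscale (of_real (r + s)) funit"
        by (simp add: fscale_add_left[symmetric] of_real_add[symmetric] del: of_real_add)
      also have "fscale (of_real (r + s)) funit - outer v u - outer u v = W"
        unfolding W_def by (simp add: fscale_add_left outer_def fun_eq_iff star_w_diff in_z_diff algebra_simps)
      finally show ?thesis by (rule sym)
    qed
    finally have "fscale (of_real (1/2)) W + fstar (fscale (of_real (1/2)) W) = ?T + fstar ?T" .
    then show "prune d ((fscale (of_real (1/2)) W + fstar (fscale (of_real (1/2)) W)) a b) = prune d ((?T + fstar ?T) a b)" for a b
      by (simp only:)
  qed
  then show ?thesis unfolding order_bounded_def by blast
qed

lemma bounded_entry: "(\<lambda>x y. if x = a \<and> y = b then p else 0) \<in> order_bounded \<gamma>"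
proof (induction p rule: poly_mapping_sum_induct)
  case zero
  then show ?case using bounded_zero by (simp add: zero_fun_def)
next
  case (single k e)
  obtain \<kappa> \<mu> where k: "k = (\<kappa>, \<mu>)" by (cases k)
  have "outer (entry_row a (Poly_Mapping.single \<kappa> 1)) (entry_row b (Poly_Mapping.single \<mu> e))
    = (\<lambda>x y. if x = a \<and> y = b then Poly_Mapping.single k e else 0)"
    by (auto simp: outer_def entry_row_def fun_eq_iff star_w_zero in_z_zero star_w_single in_z_single mult_single k)
  then show ?case using bounded_outer[OF bounded_square_row bounded_square_row] by metis
next
  case (add p q)
  then have "(\<lambda>x y. if x = a \<and> y = b then p else 0) + (\<lambda>x y. if x = a \<and> y = b then q else 0) \<in> order_bounded \<gamma>"
    by (rule bounded_add)
  then show ?case by (rule bounded_cong) simp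
qed

text \<open>
  Every matrix polynomial is, on the $\gamma \times \gamma$ block, a finite sum of entries, and those of
  monomials, hence products $v^* u$ of rows with one monomial entry.
\<close>

theorem order_unit: "\<exists>r. fscale (of_real r) funit - F \<in> cone \<gamma>"
proof -
  have "(\<Sum>a<\<gamma>. \<Sum>b<\<gamma>. (\<lambda>x y. if x = a \<and> y = b then F a b else 0)) \<in> order_bounded \<gamma>"
    by (intro bounded_sum bounded_entry)
  then have "F \<in> order_bounded \<gamma>"
  proof (rule bounded_cong)
    fix x y assume xy: "x < \<gamma>" "y < \<gamma>"
    have app: "(\<Sum>a\<in>A. G a) x = (\<Sum>a\<in>A. G a x)" for A :: "nat set" and G :: "nat \<Rightarrow> nat \<Rightarrow> 'z::comm_monoid_add" and x
      by (induction A rule: infinite_finite_induct) auto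
    have "(\<Sum>a<\<gamma>. \<Sum>b<\<gamma>. (\<lambda>x y. if x = a \<and> y = b then F a b else 0)) x y
      = (\<Sum>a<\<gamma>. \<Sum>b<\<gamma>. if x = a \<and> y = b then F a b else 0)" by (simp add: app)
    also have "\<dots> = (\<Sum>a<\<gamma>. if x = a then F a y else 0)"
      using xy by (intro sum.cong refl) (auto simp: sum.delta')
    also have "\<dots> = F x y" using xy by simp
    finally show "(\<Sum>a<\<gamma>. \<Sum>b<\<gamma>. (\<lambda>x y. if x = a \<and> y = b then F a b else 0)) x y = F x y" .
  qed
  then show ?thesis by (simp add: order_bounded_def)
qed

end

section \<open>Positive functionals\<close>

context archimedean_constraints
begin

text \<open>
  Separation gives a real functional \<open>l\<close>, the real part of $L(F) = l(F) - i\,l(i F)$. As both \<open>A\<close> and \<open>- A\<close>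
  belong to the cone for antihermitian \<open>A\<close>, the functional \<open>l\<close> only depends on hermitian parts, whence \<open>L\<close>
  is compatible with the involution.
\<close>

theorem separating_functional:
  assumes q: "q \<notin> cone \<gamma>"
  obtains L :: "(nat \<Rightarrow> nat \<Rightarrow> wz_poly) \<Rightarrow> complex" where
    "\<And>F G. L (F + G) = L F + L G" "\<And>a F. L (fscale a F) = a * L F"
    "\<And>F. L (fstar F) = cnj (L F)" "\<And>F. F \<in> cone \<gamma> \<Longrightarrow> 0 \<le> Re (L F)"
    "Re (L funit) = 1" "Re (L q) \<le> 0"
proof -
  obtain l where l: "\<And>F G. l (F + G) = l F + l G" "\<And>r F. l (fscale (of_real r) F) = r * l F"
    "\<And>F. F \<in> cone \<gamma> \<Longrightarrow> 0 \<le> l F" "l funit = (1::real)" "l q \<le> 0"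
    using cone_separation[OF vector_space_fscale cone_add cone_fscale funit_cone order_unit q] by blast
  define L where "L F = Complex (l F) (- l (fscale \<i> F))" for F
  have l_neg: "l (- F) = - l F" for F by (rule additive_uminus[of l, OF l(1)])
  have l_star: "l (fstar F) = l F" for F
  proof -
    note fstar_diff = additive_diff[of fstar, OF fstar_add]
    have "F - fstar F \<in> cone \<gamma>"
      by (rule antihermitian_cone) (simp only: fstar_diff fstar_fstar, simp add: prune_zero)
    moreover have "fstar F - F \<in> cone \<gamma>"
      by (rule antihermitian_cone) (simp only: fstar_diff fstar_fstar, simp add: prune_zero)
    ultimately have "0 \<le> l (F - fstar F)" "0 \<le> l (fstar F - F)" using l(3) by auto
    then show ?thesis using additive_diff[of l, OF l(1)] by simp
  qed
  have L_scale: "L (fscale a F) = a * L F" for a F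
  proof -
    have "l (fscale b F) = Re b * l F + Im b * l (fscale \<i> F)" for b
    proof -
      have "fscale b F = fscale (of_real (Re b)) F + fscale (of_real (Im b)) (fscale \<i> F)"
        by (simp add: fscale_add_left[symmetric] fscale_mult[symmetric] complex_eq[of b, symmetric] mult.commute)
      then show ?thesis by (simp add: l(1,2))
    qed
    from this[of a] this[of "\<i> * a"] show ?thesis
      by (simp add: L_def complex_eq_iff fscale_mult[symmetric])
  qed
  have L_star: "L (fstar F) = cnj (L F)" for F
  proof -
    have "fscale \<i> (fstar F) = fstar (fscale (- \<i>) F)" by (simp add: fstar_fscale)
    then have "l (fscale \<i> (fstar F)) = - l (fscale \<i> F)"
      by (simp add: l_star fscale_minus_left l_neg)
    then show ?thesis by (simp add: L_def l_star complex_eq_iff)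
  qed
  show ?thesis
  proof (rule that[of L])
    show "L (F + G) = L F + L G" for F G
    proof -
      have "fscale \<i> (F + G) = fscale \<i> F + fscale \<i> G" by (simp add: fscale_def fun_eq_iff distrib_left)
      then show ?thesis by (simp add: L_def l(1) complex_eq_iff)
    qed
  qed (use L_scale L_star l in \<open>auto simp: L_def\<close>)
qed

end

lemma countable_multi_index: "countable (UNIV :: multi_index set)"
proof -
  define graph where "graph \<mu> = {(i, Poly_Mapping.lookup \<mu> i) | i. i \<in> Poly_Mapping.keys \<mu>}" for \<mu> :: multi_index
  have "inj graph"
  proof (rule injI)
    fix \<mu> \<nu> assume eq: "graph \<mu> = graph \<nu>"
    have "Poly_Mapping.lookup \<mu> i = Poly_Mapping.lookup \<nu> i" for i
    proof -
      have "(i, n) \<in> graph \<mu> \<longleftrightarrow> n = Poly_Mapping.lookup \<mu> i \<and> n \<noteq> 0"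
        "(i, n) \<in> graph \<nu> \<longleftrightarrow> n = Poly_Mapping.lookup \<nu> i \<and> n \<noteq> 0" for n
        by (auto simp: graph_def in_keys_iff)
      then show ?thesis using eq by metis
    qed
    then show "\<mu> = \<nu>" by (rule poly_mapping_eqI)
  qed
  moreover have "range graph \<subseteq> {A. finite A}"
  proof -
    have "graph \<mu> = (\<lambda>i. (i, Poly_Mapping.lookup \<mu> i)) ` Poly_Mapping.keys \<mu>" for \<mu>
      by (auto simp: graph_def)
    then show ?thesis by auto
  qed
  moreover have "countable {A :: (nat \<times> nat) set. finite A}" by (rule countable_Collect_finite)
  ultimately show ?thesis by (meson countable_image_inj_on countable_subset)
qed

locale positive_functional = archimedean_constraints +
  fixes \<gamma> :: nat and L :: "(nat \<Rightarrow> nat \<Rightarrow> wz_poly) \<Rightarrow> complex"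
  assumes L_add: "L (F + G) = L F + L G"
    and L_fscale: "L (fscale a F) = a * L F"
    and L_fstar: "L (fstar F) = cnj (L F)"
    and L_cone: "F \<in> cone \<gamma> \<Longrightarrow> 0 \<le> Re (L F)"
begin

lemma L_diff: "L (F - G) = L F - L G"
  by (rule additive_diff[of L, OF L_add])

lemma L_sum: "L (\<Sum>x\<in>A. F x) = (\<Sum>x\<in>A. L (F x))"
  by (rule additive_sum[of L, OF L_add])

text \<open>
  All complex multiples of such an \<open>F\<close> lie in the cone.
\<close>

lemma L_zero_entries:
  assumes "\<And>a b. a < \<gamma> \<Longrightarrow> b < \<gamma> \<Longrightarrow> F a b = 0"
  shows "L F = 0"
proof -
  have nonneg: "0 \<le> Re (L (fscale a F))" for a
    by (rule L_cone, rule antihermitian_cone) (simp add: assms fscale_def fstar_def star_zero prune_zero)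
  show ?thesis
    using nonneg[of 1] nonneg[of "-1"] nonneg[of \<i>] nonneg[of "-\<i>"]
    by (simp add: L_fscale complex_eq_iff)
qed

lemma L_cong_entries:
  assumes "\<And>a b. a < \<gamma> \<Longrightarrow> b < \<gamma> \<Longrightarrow> F a b = G a b"
  shows "L F = L G"
  using L_zero_entries[of "F - G"] assms by (simp add: L_diff)

definition B :: "(nat \<Rightarrow> z_poly) \<Rightarrow> (nat \<Rightarrow> z_poly) \<Rightarrow> complex" where
  "B u v = L (outer v u)"

sublocale semi_inner_space rscale B
proof (rule semi_inner_space.intro[OF vector_space_rscale], unfold_locales)
  show "B (u + u') v = B u v + B u' v" for u u' v by (simp add: B_def outer_add_right L_add)
  show "B (rscale a u) v = a * B u v" for a u v by (simp add: B_def outer_rscale_right L_fscale)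
  show "B v u = cnj (B u v)" for u v by (simp add: B_def fstar_outer flip: L_fstar)
  show "0 \<le> Re (B u u)" for u unfolding B_def by (intro L_cone sos_cone sos_outer)
qed

lemma zmult_add: "zmult i (u + v) = zmult i u + zmult i v"
  by (simp add: zmult_def fun_eq_iff distrib_left)

lemma zmult_rscale: "zmult i (rscale a u) = rscale a (zmult i u)"
  by (simp add: zmult_def rscale_def fun_eq_iff mult.left_commute)

text \<open>
  Positivity of \<open>L\<close> on the polynomial of \<open>zmult_bounded\<close>.
\<close>

lemma seminorm_zmult: "seminorm (zmult i u) \<le> \<bar>c\<bar> * seminorm u"
proof -
  have "0 \<le> Re (L (fscale (of_real (c\<^sup>2)) (outer u u) - outer (zmult i u) (zmult i u)))"
    by (intro L_cone zmult_bounded)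
  then have "Re (B (zmult i u) (zmult i u)) \<le> c\<^sup>2 * Re (B u u)"
    unfolding L_diff L_fscale B_def by simp
  then have "sqrt (Re (B (zmult i u) (zmult i u))) \<le> sqrt (c\<^sup>2 * Re (B u u))" by (rule real_sqrt_le_mono)
  then show ?thesis by (simp add: seminorm_def real_sqrt_mult)
qed

definition monomial_rows :: "(nat \<Rightarrow> z_poly) set" where
  "monomial_rows = range (\<lambda>(a, \<mu>). entry_row a (Poly_Mapping.single \<mu> 1))"

lemma countable_monomial_rows: "countable monomial_rows"
  unfolding monomial_rows_def
  by (rule countable_image) (simp add: countable_multi_index flip: UNIV_Times_UNIV)

text \<open>
  Monomial rows span the rows with finitely many nonzero entries, and changing the entries of a row at
  positions from \<open>\<gamma>\<close> on changes it by a row of seminorm zero.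
\<close>

lemma dual_eq_on_monomial_rows:
  assumes f: "f \<in> dual" and f': "f' \<in> dual" and eq: "\<And>u. u \<in> monomial_rows \<Longrightarrow> f u = f' u"
  shows "f = f'"
proof
  fix u
  have entry_row: "f (entry_row a p) = f' (entry_row a p)" for a p
  proof (induction p rule: poly_mapping_sum_induct)
    case zero
    have "entry_row a 0 = 0" by (simp add: entry_row_def fun_eq_iff)
    then show ?case
      using additive_zero[of f, OF dual_add[OF f]] additive_zero[of f', OF dual_add[OF f']] by (simp only:)
  next
    case (single \<mu> e)
    have "entry_row a (Poly_Mapping.single \<mu> e) = rscale e (entry_row a (Poly_Mapping.single \<mu> 1))"
      by (auto simp: entry_row_def rscale_def fun_eq_iff mult_single)
    moreover have "entry_row a (Poly_Mapping.single \<mu> 1) \<in> monomial_rows"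
      unfolding monomial_rows_def by (rule range_eqI[of _ _ "(a, \<mu>)"]) simp
    ultimately show ?case using eq by (simp add: dual_scale[OF f] dual_scale[OF f'])
  next
    case (add p q)
    have "entry_row a (p + q) = entry_row a p + entry_row a q" by (auto simp: entry_row_def fun_eq_iff)
    then show ?case using add by (simp only: dual_add[OF f] dual_add[OF f'])
  qed
  \<comment> \<open>\<open>u\<close> with the entries from position \<open>\<gamma>\<close> on replaced by zero\<close>
  define s where "s = (\<Sum>a<\<gamma>. entry_row a (u a))"
  have s: "s x = u x" if "x < \<gamma>" for x
  proof -
    have "(\<Sum>a\<in>A. entry_row a (u a)) x = (\<Sum>a\<in>A. entry_row a (u a) x)" for A
      by (induction A rule: infinite_finite_induct) auto
    then have "s x = (\<Sum>a<\<gamma>. if x = a then u a else 0)" by (simp add: s_def entry_row_def)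
    then show ?thesis using that by simp
  qed
  have vanish: "h (u - s) = 0" if h: "h \<in> dual" for h
  proof -
    have "B (u - s) (u - s) = 0"
      unfolding B_def by (rule L_zero_entries) (simp add: outer_def s star_w_zero)
    then have "seminorm (u - s) = 0" by (simp add: seminorm_def)
    then show ?thesis using le_dnorm[OF h, of "u - s"] by simp
  qed
  have "f s = f' s"
    unfolding s_def additive_sum[of f, OF dual_add[OF f]] additive_sum[of f', OF dual_add[OF f']] by (simp add: entry_row)
  then show "f u = f' u" using vanish[OF f] vanish[OF f'] by (simp add: dual_diff[OF f] dual_diff[OF f'])
qed

end

section \<open>Operators and hereditary evaluation on a Hilbert space\<close>

context complex_hilbert_space
begin

lemma hinner_add_right:
  "x \<in> carrier H \<Longrightarrow> y \<in> carrier H \<Longrightarrow> z \<in> carrier H \<Longrightarrow> hinner H x (y \<oplus>\<^bsub>H\<^esub> z) = hinner H x y + hinner H x z"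
  using hinner_add[of y z x] hinner_commute[of x "y \<oplus>\<^bsub>H\<^esub> z"] hinner_commute[of x y] hinner_commute[of x z]
    hinner_commute[of "y \<oplus>\<^bsub>H\<^esub> z" x] hinner_commute[of y x] hinner_commute[of z x]
  by (metis a_closed complex_cnj_add)

lemma smult_carrier: "x \<in> carrier H \<Longrightarrow> a \<odot>\<^bsub>H\<^esub> x \<in> carrier H"
  by (rule smult_closed) (simp add: class_ring_simps)

lemma hinner_smult_right:
  "x \<in> carrier H \<Longrightarrow> y \<in> carrier H \<Longrightarrow> hinner H x (a \<odot>\<^bsub>H\<^esub> y) = cnj a * hinner H x y"
  using hinner_smult[of y x a] hinner_commute[of "a \<odot>\<^bsub>H\<^esub> y" x] hinner_commute[of y x] smult_carrier[of y a]
  by (metis complex_cnj_mult)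

lemma hinner_zero: "y \<in> carrier H \<Longrightarrow> hinner H \<zero>\<^bsub>H\<^esub> y = 0"
  using hinner_add[of "\<zero>\<^bsub>H\<^esub>" "\<zero>\<^bsub>H\<^esub>" y] by simp

lemma hinner_minus:
  assumes "x \<in> carrier H" "y \<in> carrier H" "z \<in> carrier H"
  shows "hinner H (x \<ominus>\<^bsub>H\<^esub> y) z = hinner H x z - hinner H y z"
proof -
  have "(x \<ominus>\<^bsub>H\<^esub> y) \<oplus>\<^bsub>H\<^esub> y = x"
    using assms by (simp add: a_minus_def a_assoc l_neg)
  then have "hinner H x z = hinner H (x \<ominus>\<^bsub>H\<^esub> y) z + hinner H y z"
    using hinner_add[of "x \<ominus>\<^bsub>H\<^esub> y" y z] assms by (metis minus_closed)
  then show ?thesis by simp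
qed

lemma hinner_minus_right:
  assumes "x \<in> carrier H" "y \<in> carrier H" "z \<in> carrier H"
  shows "hinner H x (y \<ominus>\<^bsub>H\<^esub> z) = hinner H x y - hinner H x z"
  using hinner_minus[OF assms(2,3,1)] assms
    hinner_commute[of "y \<ominus>\<^bsub>H\<^esub> z" x] hinner_commute[of y x] hinner_commute[of z x]
  by simp

lemma hinner_finsum:
  assumes "finite A" "\<And>x. x \<in> A \<Longrightarrow> f x \<in> carrier H" "y \<in> carrier H"
  shows "hinner H (finsum H f A) y = (\<Sum>x\<in>A. hinner H (f x) y)"
  using assms
proof (induction A rule: finite_induct)
  case empty
  then show ?case by (simp add: hinner_zero)
next
  case (insert x A)
  then have "finsum H f (insert x A) = f x \<oplus>\<^bsub>H\<^esub> finsum H f A"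
    by (intro finsum_insert) auto
  moreover have "finsum H f A \<in> carrier H" using insert by (intro finsum_closed) auto
  ultimately show ?case using insert by (simp add: hinner_add)
qed

lemma hinner_self_nonneg: "x \<in> carrier H \<Longrightarrow> 0 \<le> Re (hinner H x x)"
  using hinner_pos[of x] hinner_zero[of x] by (cases "x = \<zero>\<^bsub>H\<^esub>") (auto simp: less_complex_def)

lemma hinner_nondegenerate:
  assumes x: "x \<in> carrier H" and y: "y \<in> carrier H"
    and eq: "\<And>z. z \<in> carrier H \<Longrightarrow> hinner H z x = hinner H z y"
  shows "x = y"
proof (rule ccontr)
  assume "x \<noteq> y"
  then have "x \<ominus>\<^bsub>H\<^esub> y \<noteq> \<zero>\<^bsub>H\<^esub>" using x y by simp
  then have "0 < hinner H (x \<ominus>\<^bsub>H\<^esub> y) (x \<ominus>\<^bsub>H\<^esub> y)" using x y by (intro hinner_pos) auto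
  moreover have "hinner H (x \<ominus>\<^bsub>H\<^esub> y) (x \<ominus>\<^bsub>H\<^esub> y) = 0"
    using eq[of "x \<ominus>\<^bsub>H\<^esub> y"] hinner_minus_right[of "x \<ominus>\<^bsub>H\<^esub> y" x y] x y by simp
  ultimately show False by simp
qed

lemma hinner_perturb:
  assumes x: "x \<in> carrier H" and y: "y \<in> carrier H"
  shows "Re (hinner H (x \<oplus>\<^bsub>H\<^esub> a \<odot>\<^bsub>H\<^esub> y) (x \<oplus>\<^bsub>H\<^esub> a \<odot>\<^bsub>H\<^esub> y))
    = Re (hinner H x x) + (cmod a)\<^sup>2 * Re (hinner H y y) + 2 * Re (cnj a * hinner H x y)"
proof -
  have "hinner H (x \<oplus>\<^bsub>H\<^esub> a \<odot>\<^bsub>H\<^esub> y) (x \<oplus>\<^bsub>H\<^esub> a \<odot>\<^bsub>H\<^esub> y)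
    = hinner H x x + cnj a * hinner H x y + (a * hinner H y x + a * cnj a * hinner H y y)"
    using x y by (simp add: hinner_add hinner_add_right hinner_smult hinner_smult_right smult_carrier algebra_simps)
  moreover have "a * cnj a = of_real ((cmod a)\<^sup>2)" by (rule complex_norm_square[symmetric])
  moreover have "a * hinner H y x = cnj (cnj a * hinner H x y)" using hinner_commute[OF x y] by simp
  ultimately show ?thesis by simp
qed

lemma hinner_Cauchy_Schwarz:
  assumes x: "x \<in> carrier H" and y: "y \<in> carrier H"
  shows "cmod (hinner H x y) \<le> hnorm H x * hnorm H y"
proof -
  let ?b = "hinner H x y"
  have "(cmod ?b)\<^sup>2 \<le> Re (hinner H x x) * Re (hinner H y y)"
  proof (rule discriminant_bound)
    fix t :: real
    have "cnj (- of_real t * ?b) * ?b = - of_real (t * (cmod ?b)\<^sup>2)"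
      using complex_norm_square[of ?b] by (simp add: mult.commute)
    from arg_cong[OF this, of Re]
    have "Re (cnj (- of_real t * ?b) * ?b) = - (t * (cmod ?b)\<^sup>2)"
      by (simp only: uminus_complex.simps Re_complex_of_real)
    then show "0 \<le> t\<^sup>2 * (cmod ?b)\<^sup>2 * Re (hinner H y y) - 2 * t * (cmod ?b)\<^sup>2 + Re (hinner H x x)"
      using hinner_perturb[OF x y, of "- of_real t * ?b"]
        hinner_self_nonneg[of "x \<oplus>\<^bsub>H\<^esub> (- of_real t * ?b) \<odot>\<^bsub>H\<^esub> y"] smult_carrier[OF y] x
      by (simp add: norm_mult power_mult_distrib)
  qed (use hinner_self_nonneg x y in auto)
  then have "(cmod ?b)\<^sup>2 \<le> (hnorm H x * hnorm H y)\<^sup>2"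
    using x y by (simp add: hnorm_def power_mult_distrib hinner_self_nonneg)
  then show ?thesis
    by (rule power2_le_imp_le) (simp add: hnorm_def hinner_self_nonneg x y)
qed

definition converges :: "(nat \<Rightarrow> 'h) \<Rightarrow> 'h \<Rightarrow> bool" where
  "converges s x \<longleftrightarrow> range s \<subseteq> carrier H \<and> x \<in> carrier H \<and> (\<lambda>n. hnorm H (s n \<ominus>\<^bsub>H\<^esub> x)) \<longlonglongrightarrow> 0"

lemma hinner_tendsto:
  assumes s: "converges s x" and t: "converges t y"
  shows "(\<lambda>n. hinner H (s n) (t n)) \<longlonglongrightarrow> hinner H x y"
proof -
  have c: "s n \<in> carrier H" "t n \<in> carrier H" "x \<in> carrier H" "y \<in> carrier H" for n
    using s t by (auto simp: converges_def)
  let ?e = "\<lambda>n. hnorm H (s n \<ominus>\<^bsub>H\<^esub> x)" and ?f = "\<lambda>n. hnorm H (t n \<ominus>\<^bsub>H\<^esub> y)"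
  have "(\<lambda>n. ?e n * ?f n + ?e n * hnorm H y + hnorm H x * ?f n) \<longlonglongrightarrow> 0 * 0 + 0 * hnorm H y + hnorm H x * 0"
    using s t by (intro tendsto_intros) (auto simp: converges_def)
  then have lim: "(\<lambda>n. ?e n * ?f n + ?e n * hnorm H y + hnorm H x * ?f n) \<longlonglongrightarrow> 0" by simp
  have "(\<lambda>n. hinner H (s n) (t n) - hinner H x y) \<longlonglongrightarrow> 0"
  proof (rule Lim_null_comparison[OF _ lim], rule always_eventually, rule allI)
    fix n
    have eq: "hinner H (s n) (t n) - hinner H x y = hinner H (s n \<ominus>\<^bsub>H\<^esub> x) (t n \<ominus>\<^bsub>H\<^esub> y)
        + hinner H (s n \<ominus>\<^bsub>H\<^esub> x) y + hinner H x (t n \<ominus>\<^bsub>H\<^esub> y)"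
      using c by (simp add: hinner_minus hinner_minus_right)
    show "norm (hinner H (s n) (t n) - hinner H x y) \<le> ?e n * ?f n + ?e n * hnorm H y + hnorm H x * ?f n"
      unfolding eq using c
      by (intro norm_triangle_mono hinner_Cauchy_Schwarz) auto
  qed
  then show ?thesis by (simp add: LIM_zero_iff)
qed

lemma converges_const: "x \<in> carrier H \<Longrightarrow> converges (\<lambda>_. x) x"
  by (auto simp: converges_def hnorm_def hinner_minus)

lemma converges_unique:
  assumes "converges s x" "converges s y"
  shows "x = y"
proof (rule hinner_nondegenerate)
  show "x \<in> carrier H" "y \<in> carrier H" using assms by (auto simp: converges_def)
  fix z assume z: "z \<in> carrier H"
  show "hinner H z x = hinner H z y"
    by (rule LIMSEQ_unique[OF hinner_tendsto[OF converges_const[OF z] assms(1)]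
          hinner_tendsto[OF converges_const[OF z] assms(2)]])
qed

lemma bounded_operator_carrier: "bounded_operator H A \<Longrightarrow> x \<in> carrier H \<Longrightarrow> A x \<in> carrier H"
  by (auto simp: bounded_operator_def)

lemma bounded_operator_minus:
  assumes A: "bounded_operator H A" and x: "x \<in> carrier H" and y: "y \<in> carrier H"
  shows "A (x \<ominus>\<^bsub>H\<^esub> y) = A x \<ominus>\<^bsub>H\<^esub> A y"
proof -
  have xy: "(x \<ominus>\<^bsub>H\<^esub> y) \<oplus>\<^bsub>H\<^esub> y = x" using x y by (simp add: a_minus_def a_assoc l_neg)
  have c: "A x \<in> carrier H" "A y \<in> carrier H" "A (x \<ominus>\<^bsub>H\<^esub> y) \<in> carrier H"
    using A x y by (auto intro: bounded_operator_carrier)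
  have "A ((x \<ominus>\<^bsub>H\<^esub> y) \<oplus>\<^bsub>H\<^esub> y) = A (x \<ominus>\<^bsub>H\<^esub> y) \<oplus>\<^bsub>H\<^esub> A y"
    using A x y by (simp add: bounded_operator_def)
  then have "A x = A (x \<ominus>\<^bsub>H\<^esub> y) \<oplus>\<^bsub>H\<^esub> A y" using xy by simp
  then show ?thesis using c by (simp add: a_minus_def a_assoc r_neg)
qed

lemma converges_bounded_operator:
  assumes A: "bounded_operator H A" and s: "converges s x"
  shows "converges (\<lambda>n. A (s n)) (A x)"
proof -
  have c: "s n \<in> carrier H" "x \<in> carrier H" for n using s by (auto simp: converges_def)
  obtain C where C: "\<And>x. x \<in> carrier H \<Longrightarrow> hnorm H (A x) \<le> C * hnorm H x"
    using A unfolding bounded_operator_def by blast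
  have "(\<lambda>n. C * hnorm H (s n \<ominus>\<^bsub>H\<^esub> x)) \<longlonglongrightarrow> C * 0"
    using s by (intro tendsto_intros) (auto simp: converges_def)
  then have lim: "(\<lambda>n. C * hnorm H (s n \<ominus>\<^bsub>H\<^esub> x)) \<longlonglongrightarrow> 0" by simp
  have "(\<lambda>n. hnorm H (A (s n) \<ominus>\<^bsub>H\<^esub> A x)) \<longlonglongrightarrow> 0"
  proof (rule Lim_null_comparison[OF _ lim], rule always_eventually, rule allI)
    fix n
    have "hnorm H (A (s n) \<ominus>\<^bsub>H\<^esub> A x) \<le> C * hnorm H (s n \<ominus>\<^bsub>H\<^esub> x)"
      using C[of "s n \<ominus>\<^bsub>H\<^esub> x"] c by (simp add: bounded_operator_minus[OF A])
    moreover have "0 \<le> hnorm H (A (s n) \<ominus>\<^bsub>H\<^esub> A x)"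
      unfolding hnorm_def
      by (intro real_sqrt_ge_zero hinner_self_nonneg minus_closed bounded_operator_carrier[OF A] c)
    ultimately show "norm (hnorm H (A (s n) \<ominus>\<^bsub>H\<^esub> A x)) \<le> C * hnorm H (s n \<ominus>\<^bsub>H\<^esub> x)" by simp
  qed
  then show ?thesis using c bounded_operator_carrier[OF A] by (auto simp: converges_def)
qed

lemma hadjoint_eq:
  assumes T': "\<And>y. y \<in> carrier H \<Longrightarrow> T' y \<in> carrier H"
    and adj: "\<And>x y. x \<in> carrier H \<Longrightarrow> y \<in> carrier H \<Longrightarrow> hinner H (T x) y = hinner H x (T' y)"
    and y: "y \<in> carrier H"
  shows "hadjoint H T y = T' y"
  unfolding hadjoint_def
proof (rule the_equality)
  show "T' y \<in> carrier H \<and> (\<forall>x\<in>carrier H. hinner H (T x) y = hinner H x (T' y))"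
    using T' adj y by simp
  fix z assume "z \<in> carrier H \<and> (\<forall>x\<in>carrier H. hinner H (T x) y = hinner H x z)"
  then show "z = T' y" using T' adj y by (intro hinner_nondegenerate) auto
qed

end

text \<open>
  The product over an arbitrary list of indices generalises \<open>op_monom\<close>: passing to adjoints reverses
  the order of the factors.
\<close>

definition op_product :: "(nat \<Rightarrow> 'h \<Rightarrow> 'h) \<Rightarrow> (nat \<Rightarrow> nat) \<Rightarrow> nat list \<Rightarrow> 'h \<Rightarrow> 'h" where
  "op_product T e is = foldr (\<lambda>i A. (T i ^^ e i) \<circ> A) is id"

lemma op_product_Nil [simp]: "op_product T e [] = id"
  and op_product_Cons [simp]: "op_product T e (i # is) = (T i ^^ e i) \<circ> op_product T e is"
  by (simp_all add: op_product_def)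

lemma op_product_append: "op_product T e (is @ js) = op_product T e is \<circ> op_product T e js"
  by (induction "is") (auto simp: comp_assoc)

lemma op_monom_eq: "op_monom d T \<mu> = op_product T (Poly_Mapping.lookup \<mu>) [0..<d]"
  by (simp add: op_monom_def op_product_def)

lemma op_product_closed:
  assumes "\<And>i x. i \<in> set is \<Longrightarrow> x \<in> S \<Longrightarrow> T i x \<in> S" "x \<in> S"
  shows "op_product T e is x \<in> S"
proof -
  have pow: "(T i ^^ n) y \<in> S" if "i \<in> set is" "y \<in> S" for i n y
    using that assms(1) by (induction n) auto
  show ?thesis using assms pow by (induction "is") auto
qed

lemma op_product_intertwine:
  assumes "\<And>i u. i \<in> set is \<Longrightarrow> T i (j u) = j (A i u)"
  shows "op_product T e is (j u) = j (op_product A e is u)"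
proof -
  have pow: "(T i ^^ n) (j u) = j ((A i ^^ n) u)" if "i \<in> set is" for i n u
    using that assms by (induction n) auto
  show ?thesis using assms pow by (induction "is") auto
qed

context complex_hilbert_space
begin

lemma op_product_adjoint:
  assumes T: "\<And>i x. i \<in> set is \<Longrightarrow> x \<in> carrier H \<Longrightarrow> T i x \<in> carrier H"
    and S: "\<And>i x. i \<in> set is \<Longrightarrow> x \<in> carrier H \<Longrightarrow> S i x \<in> carrier H"
    and adj: "\<And>i x y. i \<in> set is \<Longrightarrow> x \<in> carrier H \<Longrightarrow> y \<in> carrier H \<Longrightarrow> hinner H (S i y) x = hinner H y (T i x)"
    and x: "x \<in> carrier H" and y: "y \<in> carrier H"
  shows "hinner H (op_product S e is y) x = hinner H y (op_product T e (rev is) x)"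
  using T S adj x
proof (induction "is" arbitrary: x)
  case (Cons i "is")
  have pow: "(T i ^^ n) x \<in> carrier H" if "x \<in> carrier H" for n x
    using that Cons.prems(1) by (induction n) auto
  have powS: "hinner H ((S i ^^ n) z) x = hinner H z ((T i ^^ n) x)"
    if "z \<in> carrier H" "x \<in> carrier H" for n z x
    using that(1)
  proof (induction n arbitrary: z)
    case (Suc n)
    have "hinner H ((S i ^^ Suc n) z) x = hinner H ((S i ^^ n) (S i z)) x" by (simp add: funpow_swap1)
    also have "\<dots> = hinner H (S i z) ((T i ^^ n) x)" using Suc Cons.prems(2) by simp
    also have "\<dots> = hinner H z (T i ((T i ^^ n) x))" using Suc Cons.prems(3) pow that(2) by simp
    finally show ?case by simp
  qed simp
  have c: "op_product S e is y \<in> carrier H"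
    by (rule op_product_closed) (use Cons.prems(2) y in auto)
  have "hinner H (op_product S e (i # is) y) x = hinner H (op_product S e is y) ((T i ^^ e i) x)"
    using powS[OF c Cons.prems(4)] by simp
  also have "\<dots> = hinner H y (op_product T e (rev is) ((T i ^^ e i) x))"
    using Cons.prems pow by (intro Cons.IH) auto
  finally show ?case by (simp add: op_product_append)
qed simp

lemma converges_op_product:
  assumes "\<And>i. i \<in> set is \<Longrightarrow> bounded_operator H (T i)" "converges s x"
  shows "converges (\<lambda>n. op_product T e is (s n)) (op_product T e is x)"
proof -
  have pow: "converges (\<lambda>n. (T i ^^ m) (t n)) ((T i ^^ m) y)" if "i \<in> set is" "converges t y" for i m t y
    using that converges_bounded_operator[OF assms(1)] by (induction m) auto
  show ?thesis using assms pow by (induction "is") auto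
qed

end

lemma hpower_simps:
  "carrier (hpower m H) = {..<m} \<rightarrow>\<^sub>E carrier H"
  "zero (hpower m H) = (\<lambda>b\<in>{..<m}. \<zero>\<^bsub>H\<^esub>)"
  "add (hpower m H) = (\<lambda>x y. \<lambda>b\<in>{..<m}. x b \<oplus>\<^bsub>H\<^esub> y b)"
  "hinner (hpower m H) = (\<lambda>x y. \<Sum>b<m. hinner H (x b) (y b))"
  by (simp_all add: hpower_def)

lemma abelian_monoid_hpower:
  assumes "abelian_monoid H"
  shows "abelian_monoid (hpower m H)"
proof -
  interpret abelian_monoid H by (rule assms)
  show ?thesis
  proof (rule abelian_monoidI)
    fix x y z assume x: "x \<in> carrier (hpower m H)" and y: "y \<in> carrier (hpower m H)"
    show "x \<oplus>\<^bsub>hpower m H\<^esub> y \<in> carrier (hpower m H)"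
      using x y by (auto simp: hpower_simps)
    show "x \<oplus>\<^bsub>hpower m H\<^esub> y = y \<oplus>\<^bsub>hpower m H\<^esub> x"
      using x y by (auto simp: hpower_simps restrict_def fun_eq_iff PiE_mem intro!: a_comm)
    assume z: "z \<in> carrier (hpower m H)"
    show "x \<oplus>\<^bsub>hpower m H\<^esub> y \<oplus>\<^bsub>hpower m H\<^esub> z = x \<oplus>\<^bsub>hpower m H\<^esub> (y \<oplus>\<^bsub>hpower m H\<^esub> z)"
      using x y z by (auto simp: hpower_simps restrict_def fun_eq_iff PiE_mem intro!: a_assoc)
  next
    show "\<zero>\<^bsub>hpower m H\<^esub> \<in> carrier (hpower m H)" by (auto simp: hpower_simps)
    fix x assume x: "x \<in> carrier (hpower m H)"
    show "\<zero>\<^bsub>hpower m H\<^esub> \<oplus>\<^bsub>hpower m H\<^esub> x = x"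
    proof
      fix b
      show "(\<zero>\<^bsub>hpower m H\<^esub> \<oplus>\<^bsub>hpower m H\<^esub> x) b = x b"
        using x PiE_arb[of x "{..<m}" "\<lambda>_. carrier H" b] PiE_mem[of x "{..<m}" "\<lambda>_. carrier H" b]
        by (cases "b < m") (simp_all add: hpower_simps)
    qed
  qed
qed

text \<open>
  Unfolds the tensor products of the hereditary evaluation, so that only inner products in \<open>H\<close> remain, in
  which adjoints can be moved to the other side and limits can be taken.
\<close>

lemma hinner_hereditary_eval:
  fixes H :: "'h hilbert"
  assumes H: "complex_hilbert_space H" and P: "P \<in> carrier_mat m m"
    and x: "x \<in> carrier (hpower m H)"
    and S: "\<And>\<kappa> \<mu> y. y \<in> carrier H \<Longrightarrow> op_monom d (\<lambda>i. hadjoint H (T i)) \<kappa> (op_monom d T \<mu> y) \<in> carrier H"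
  shows "hinner (hpower m H) (hereditary_eval H d T P x) x
    = (\<Sum>(\<kappa>, \<mu>)\<in>(\<Union>p\<in>elements_mat P. Poly_Mapping.keys p). \<Sum>a<m. \<Sum>b<m.
        Poly_Mapping.lookup (P $$ (a, b)) (\<kappa>, \<mu>)
        * hinner H (op_monom d (\<lambda>i. hadjoint H (T i)) \<kappa> (op_monom d T \<mu> (x b))) (x a))"
proof -
  interpret complex_hilbert_space H by (rule H)
  interpret P: abelian_monoid "hpower m H" by (rule abelian_monoid_hpower) (rule abelian_monoid_axioms)
  let ?S = "\<lambda>\<kappa> \<mu> y. op_monom d (\<lambda>i. hadjoint H (T i)) \<kappa> (op_monom d T \<mu> y)"
  let ?I = "\<Union>p\<in>elements_mat P. Poly_Mapping.keys p"
  define f where "f = (\<lambda>(\<kappa>, \<mu>). tensor_op H (mat_coeff P \<kappa> \<mu>)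
        (op_monom d (\<lambda>i. hadjoint H (T i)) \<kappa> \<circ> op_monom d T \<mu>) x)"
  have "finite ?I"
    by (intro finite_UN_I) (auto simp: elements_mat_def)
  have xb: "x b \<in> carrier H" if "b < m" for b using x that by (auto simp: hpower_simps)
  have dims: "dim_row (mat_coeff P \<kappa> \<mu>) = m" "dim_col (mat_coeff P \<kappa> \<mu>) = m" for \<kappa> \<mu>
    using P by (auto simp: mat_coeff_def)
  have sm: "a \<odot>\<^bsub>H\<^esub> ?S \<kappa> \<mu> (x b) \<in> carrier H" if "b < m" for a \<kappa> \<mu> b
    by (intro smult_carrier S xb that)
  have f_eq: "f (\<kappa>, \<mu>) = (\<lambda>a\<in>{..<m}. finsum H (\<lambda>b. (mat_coeff P \<kappa> \<mu> $$ (a, b)) \<odot>\<^bsub>H\<^esub> ?S \<kappa> \<mu> (x b)) {..<m})" for \<kappa> \<mu>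
    by (simp add: f_def tensor_op_def dims)
  have f_carrier: "f k \<in> carrier (hpower m H)" for k
  proof (cases k)
    case (Pair \<kappa> \<mu>)
    show ?thesis unfolding Pair f_eq by (auto simp: hpower_simps intro!: finsum_closed sm)
  qed
  have f_inner: "hinner (hpower m H) (f (\<kappa>, \<mu>)) x
     = (\<Sum>a<m. \<Sum>b<m. Poly_Mapping.lookup (P $$ (a, b)) (\<kappa>, \<mu>) * hinner H (?S \<kappa> \<mu> (x b)) (x a))" for \<kappa> \<mu>
  proof -
    have "hinner (hpower m H) (f (\<kappa>, \<mu>)) x
      = (\<Sum>a<m. hinner H (finsum H (\<lambda>b. (mat_coeff P \<kappa> \<mu> $$ (a, b)) \<odot>\<^bsub>H\<^esub> ?S \<kappa> \<mu> (x b)) {..<m}) (x a))"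
      unfolding f_eq by (simp add: hpower_simps)
    also have "\<dots> = (\<Sum>a<m. \<Sum>b<m. hinner H ((mat_coeff P \<kappa> \<mu> $$ (a, b)) \<odot>\<^bsub>H\<^esub> ?S \<kappa> \<mu> (x b)) (x a))"
      by (intro sum.cong refl hinner_finsum) (auto intro: sm xb)
    also have "\<dots> = (\<Sum>a<m. \<Sum>b<m. Poly_Mapping.lookup (P $$ (a, b)) (\<kappa>, \<mu>) * hinner H (?S \<kappa> \<mu> (x b)) (x a))"
      using P by (intro sum.cong refl) (simp add: hinner_smult S xb mat_coeff_def)
    finally show ?thesis .
  qed
  have inner_sum: "hinner (hpower m H) (finsum (hpower m H) f A) x = (\<Sum>k\<in>A. hinner (hpower m H) (f k) x)"
    if "finite A" for A
    using that
  proof (induction A rule: finite_induct)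
    case empty
    have "hinner (hpower m H) \<zero>\<^bsub>hpower m H\<^esub> x = 0"
      by (simp add: hpower_simps hinner_zero xb)
    then show ?case by simp
  next
    case (insert k A)
    have c: "finsum (hpower m H) f A \<in> carrier (hpower m H)" by (intro P.finsum_closed) (use f_carrier in auto)
    have "finsum (hpower m H) f (insert k A) = f k \<oplus>\<^bsub>hpower m H\<^esub> finsum (hpower m H) f A"
      using insert.hyps f_carrier by (intro P.finsum_insert) auto
    moreover have "hinner (hpower m H) (y \<oplus>\<^bsub>hpower m H\<^esub> z) x = hinner (hpower m H) y x + hinner (hpower m H) z x"
      if "y \<in> carrier (hpower m H)" "z \<in> carrier (hpower m H)" for y z
    proof -
      have "y b \<in> carrier H" "z b \<in> carrier H" if "b < m" for b
        using \<open>y \<in> _\<close> \<open>z \<in> _\<close> that by (auto simp: hpower_simps)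
      then show ?thesis by (simp add: hpower_simps hinner_add xb sum.distrib)
    qed
    ultimately show ?case using insert f_carrier c by simp
  qed
  have "dim_row P = m" using P by simp
  then have "hinner (hpower m H) (hereditary_eval H d T P x) x = (\<Sum>k\<in>?I. hinner (hpower m H) (f k) x)"
    unfolding hereditary_eval_def f_def[symmetric] using inner_sum[OF \<open>finite ?I\<close>] by simp
  also have "\<dots> = (\<Sum>(\<kappa>, \<mu>)\<in>?I. \<Sum>a<m. \<Sum>b<m. Poly_Mapping.lookup (P $$ (a, b)) (\<kappa>, \<mu>) * hinner H (?S \<kappa> \<mu> (x b)) (x a))"
  proof (rule sum.cong[OF refl])
    fix k :: "multi_index \<times> multi_index"
    obtain \<kappa> \<mu> where k: "k = (\<kappa>, \<mu>)" by (cases k)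
    show "hinner (hpower m H) (f k) x = (case k of (\<kappa>, \<mu>) \<Rightarrow> \<Sum>a<m. \<Sum>b<m. Poly_Mapping.lookup (P $$ (a, b)) (\<kappa>, \<mu>) * hinner H (?S \<kappa> \<mu> (x b)) (x a))"
      unfolding k f_inner by simp
  qed
  finally show ?thesis .
qed

section \<open>The tuple of multiplication operators\<close>

definition monom_times :: "multi_index \<Rightarrow> (nat \<Rightarrow> z_poly) \<Rightarrow> nat \<Rightarrow> z_poly" where
  "monom_times \<mu> u = (\<lambda>a. Poly_Mapping.single \<mu> 1 * u a)"

lemma op_product_zmult:
  "distinct is \<Longrightarrow> op_product zmult e is u = monom_times (\<Sum>i\<in>set is. Poly_Mapping.single i (e i)) u"
proof (induction "is")
  case Nil
  then show ?case by (simp add: monom_times_def)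
next
  case (Cons i "is")
  have "(zmult i ^^ n) v = monom_times (Poly_Mapping.single i n) v" for n v
    by (induction n) (simp_all add: monom_times_def zmult_def mult.assoc[symmetric] mult_single single_add[symmetric])
  then show ?case using Cons
    by (simp add: monom_times_def mult.assoc[symmetric] mult_single)
qed

text \<open>
  Fails for exponents with other variables, which \<open>op_monom d\<close> ignores.
\<close>

lemma sum_single_lookup:
  assumes "\<mu> \<in> multi_indices d"
  shows "(\<Sum>i<d. Poly_Mapping.single i (Poly_Mapping.lookup \<mu> i)) = \<mu>"
proof (rule poly_mapping_eqI)
  fix l
  have "Poly_Mapping.lookup (\<Sum>i<d. Poly_Mapping.single i (Poly_Mapping.lookup \<mu> i)) l
     = (\<Sum>i<d. if i = l then Poly_Mapping.lookup \<mu> l else 0)"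
    unfolding lookup_sum by (intro sum.cong refl) (auto simp: lookup_single when_def)
  also have "\<dots> = Poly_Mapping.lookup \<mu> l"
    using assms by (auto simp: multi_indices_def in_keys_iff subset_iff)
  finally show "Poly_Mapping.lookup (\<Sum>i<d. Poly_Mapping.single i (Poly_Mapping.lookup \<mu> i)) l = Poly_Mapping.lookup \<mu> l" .
qed

lemma op_product_zmult_multi_index:
  assumes "\<mu> \<in> multi_indices d" "distinct is" "set is = {..<d}"
  shows "op_product zmult (Poly_Mapping.lookup \<mu>) is u = monom_times \<mu> u"
  using assms by (simp add: op_product_zmult sum_single_lookup)

context positive_functional
begin

text \<open>
  The core of the construction: hereditary evaluation at the multiplication operators, paired with
  polynomial rows, is \<open>L\<close> of the congruence $X^* R X$. Here $z^\mu$ acts on the right-hand row of the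
  form \<open>B\<close> and $w^\kappa$ comes from the adjoint.
\<close>

lemma L_gram_expansion:
  fixes X :: "nat \<Rightarrow> nat \<Rightarrow> z_poly"
  assumes R: "R \<in> carrier_mat m m"
  shows "(\<Sum>(\<kappa>, \<mu>)\<in>(\<Union>p\<in>elements_mat R. Poly_Mapping.keys p). \<Sum>a<m. \<Sum>b<m.
      Poly_Mapping.lookup (R $$ (a, b)) (\<kappa>, \<mu>) * B (monom_times \<mu> (X b)) (monom_times \<kappa> (X a)))
    = L (gram m (\<lambda>i j. R $$ (i, j)) X)"
proof -
  let ?I = "\<Union>p\<in>elements_mat R. Poly_Mapping.keys p"
  have fin: "finite ?I" by (intro finite_UN_I) (auto simp: elements_mat_def)
  define F where "F a b k = fscale (Poly_Mapping.lookup (R $$ (a, b)) k)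
      (outer (monom_times (fst k) (X a)) (monom_times (snd k) (X b)))" for a b k
  have "(\<Sum>(\<kappa>, \<mu>)\<in>?I. \<Sum>a<m. \<Sum>b<m. Poly_Mapping.lookup (R $$ (a, b)) (\<kappa>, \<mu>) * B (monom_times \<mu> (X b)) (monom_times \<kappa> (X a)))
     = (\<Sum>k\<in>?I. \<Sum>a<m. \<Sum>b<m. L (F a b k))"
    by (intro sum.cong refl) (auto simp: F_def B_def L_fscale)
  also have "\<dots> = (\<Sum>a<m. \<Sum>k\<in>?I. \<Sum>b<m. L (F a b k))" by (rule sum.swap)
  also have "\<dots> = (\<Sum>a<m. \<Sum>b<m. \<Sum>k\<in>?I. L (F a b k))" by (intro sum.cong refl sum.swap)
  also have "\<dots> = L (\<Sum>a<m. \<Sum>b<m. \<Sum>k\<in>?I. F a b k)" by (simp only: L_sum)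
  also have "(\<Sum>a<m. \<Sum>b<m. \<Sum>k\<in>?I. F a b k) = gram m (\<lambda>i j. R $$ (i, j)) X"
  proof (intro ext)
    fix x y
    have app: "(\<Sum>a\<in>A. G a) z = (\<Sum>a\<in>A. G a z)"
      for A :: "'i set" and G :: "'i \<Rightarrow> nat \<Rightarrow> 'z::comm_monoid_add" and z
      by (induction A rule: infinite_finite_induct) auto
    have "(\<Sum>a<m. \<Sum>b<m. \<Sum>k\<in>?I. F a b k) x y = (\<Sum>a<m. \<Sum>b<m. \<Sum>k\<in>?I. F a b k x y)"
      by (simp only: app)
    also have "\<dots> = (\<Sum>a<m. \<Sum>b<m. star_w (X a x) * R $$ (a, b) * in_z (X b y))"
    proof (intro sum.cong refl)
      fix a b assume ab: "a \<in> {..<m}" "b \<in> {..<m}"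
      have keys: "Poly_Mapping.keys (R $$ (a, b)) \<subseteq> ?I"
        using R ab by (intro UN_upper elements_matI[of _ m m]) auto
      have "(\<Sum>k\<in>?I. F a b k x y)
         = (\<Sum>k\<in>?I. star_w (X a x) * Poly_Mapping.single k (Poly_Mapping.lookup (R $$ (a, b)) k) * in_z (X b y))"
      proof (rule sum.cong[OF refl])
        fix k
        let ?c = "poly_const (Poly_Mapping.lookup (R $$ (a, b)) k)"
        let ?s = "Poly_Mapping.single (fst k, 0) 1 :: wz_poly" and ?z = "Poly_Mapping.single (0, snd k) 1 :: wz_poly"
        have monomial: "?c * (?s * ?z) = Poly_Mapping.single k (Poly_Mapping.lookup (R $$ (a, b)) k)"
          by (cases k) (simp add: poly_const_def mult_single zero_prod_def)
        have "F a b k x y = ?c * ((?s * star_w (X a x)) * (?z * in_z (X b y)))"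
          by (simp add: F_def fscale_def outer_def monom_times_def star_w_mult in_z_mult star_w_single in_z_single)
        also have "\<dots> = star_w (X a x) * (?c * (?s * ?z)) * in_z (X b y)"
          by (simp only: ac_simps)
        finally show "F a b k x y = star_w (X a x) * Poly_Mapping.single k (Poly_Mapping.lookup (R $$ (a, b)) k) * in_z (X b y)"
          by (simp only: monomial)
      qed
      also have "\<dots> = star_w (X a x) * (\<Sum>k\<in>?I. Poly_Mapping.single k (Poly_Mapping.lookup (R $$ (a, b)) k)) * in_z (X b y)"
        by (simp only: sum_distrib_left sum_distrib_right)
      also have "(\<Sum>k\<in>?I. Poly_Mapping.single k (Poly_Mapping.lookup (R $$ (a, b)) k)) = R $$ (a, b)"
      proof (rule poly_mapping_eqI)
        fix l
        have "Poly_Mapping.lookup (\<Sum>k\<in>?I. Poly_Mapping.single k (Poly_Mapping.lookup (R $$ (a, b)) k)) l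
           = (\<Sum>k\<in>?I. if k = l then Poly_Mapping.lookup (R $$ (a, b)) l else 0)"
          unfolding lookup_sum by (intro sum.cong refl) (auto simp: lookup_single when_def)
        also have "\<dots> = (if l \<in> ?I then Poly_Mapping.lookup (R $$ (a, b)) l else 0)" by (rule sum.delta[OF fin])
        also have "\<dots> = Poly_Mapping.lookup (R $$ (a, b)) l"
        proof (cases "l \<in> ?I")
          case False
          with subsetD[OF keys, of l] have "l \<notin> Poly_Mapping.keys (R $$ (a, b))" by (rule_tac notI) simp
          then show ?thesis using False by (simp only: if_False in_keys_iff not_not)
        qed (simp only: if_True)
        finally show "Poly_Mapping.lookup (\<Sum>k\<in>?I. Poly_Mapping.single k (Poly_Mapping.lookup (R $$ (a, b)) k)) l
            = Poly_Mapping.lookup (R $$ (a, b)) l" .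
      qed
      finally show "(\<Sum>k\<in>?I. F a b k x y) = star_w (X a x) * R $$ (a, b) * in_z (X b y)" .
    qed
    finally show "(\<Sum>a<m. \<Sum>b<m. \<Sum>k\<in>?I. F a b k) x y = gram m (\<lambda>i j. R $$ (i, j)) X x y"
      by (simp add: gram_def)
  qed
  finally show ?thesis .
qed

end

text \<open>
  A Hilbert space with a dense image \<open>j\<close> of the polynomial rows, on which \<open>T i\<close> extends multiplication by
  the variable \<open>i\<close> and \<open>T' i\<close> is its adjoint.
\<close>

locale gns_space = positive_functional + hs: complex_hilbert_space H for H :: "'h hilbert" +
  fixes j :: "(nat \<Rightarrow> z_poly) \<Rightarrow> 'h" and T T' :: "nat \<Rightarrow> 'h \<Rightarrow> 'h"
  assumes j_carrier: "j u \<in> carrier H"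
    and hinner_j: "hinner H (j u) (j v) = B u v"
    and j_dense: "x \<in> carrier H \<Longrightarrow> \<exists>s. hs.converges (\<lambda>n. j (s n)) x"
    and T_bounded: "bounded_operator H (T i)"
    and T'_carrier: "x \<in> carrier H \<Longrightarrow> T' i x \<in> carrier H"
    and T_adjoint: "x \<in> carrier H \<Longrightarrow> y \<in> carrier H \<Longrightarrow> hinner H (T i x) y = hinner H x (T' i y)"
    and T_j: "T i (j u) = j (zmult i u)"
begin

lemma T_carrier: "x \<in> carrier H \<Longrightarrow> T i x \<in> carrier H"
  by (rule hs.bounded_operator_carrier[OF T_bounded])

lemma hadjoint_T: "y \<in> carrier H \<Longrightarrow> hadjoint H (T i) y = T' i y"
  by (rule hs.hadjoint_eq[OF T'_carrier T_adjoint])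

lemma commuting: "commuting_tuple H d T"
  unfolding commuting_tuple_def
proof (intro conjI allI impI ballI)
  fix i l x assume x: "x \<in> carrier H"
  obtain s where s: "hs.converges (\<lambda>n. j (s n)) x" using j_dense[OF x] by blast
  have comm: "zmult i (zmult l u) = zmult l (zmult i u)" for u
    by (simp add: zmult_def mult.left_commute)
  have "hs.converges (\<lambda>n. T i (T l (j (s n)))) (T i (T l x))"
    by (rule hs.converges_bounded_operator[OF T_bounded hs.converges_bounded_operator[OF T_bounded s]])
  moreover have "hs.converges (\<lambda>n. T l (T i (j (s n)))) (T l (T i x))"
    by (rule hs.converges_bounded_operator[OF T_bounded hs.converges_bounded_operator[OF T_bounded s]])
  ultimately show "T i (T l x) = T l (T i x)"
    by (intro hs.converges_unique) (simp_all add: T_j comm)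
qed (rule T_bounded)

lemma op_monom_carrier: "x \<in> carrier H \<Longrightarrow> op_monom d T \<mu> x \<in> carrier H"
  unfolding op_monom_eq by (rule op_product_closed) (auto intro: T_carrier)

lemma op_monom_adjoint_carrier: "x \<in> carrier H \<Longrightarrow> op_monom d (\<lambda>i. hadjoint H (T i)) \<mu> x \<in> carrier H"
  unfolding op_monom_eq by (rule op_product_closed) (auto simp: hadjoint_T intro: T'_carrier)

text \<open>
  The powers of the adjoints are moved to the other side of the inner product. There the factors appear
  in reverse order, which does not matter on polynomial rows.
\<close>

lemma hinner_op_monom:
  assumes x: "x \<in> carrier H" and y: "y \<in> carrier H"
  shows "hinner H (op_monom d (\<lambda>i. hadjoint H (T i)) \<kappa> (op_monom d T \<mu> y)) x
    = hinner H (op_product T (Poly_Mapping.lookup \<mu>) [0..<d] y) (op_product T (Poly_Mapping.lookup \<kappa>) (rev [0..<d]) x)"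
proof -
  have "hinner H (hadjoint H (T i) z) w = hinner H z (T i w)" if "w \<in> carrier H" "z \<in> carrier H" for i z w
  proof -
    have "hinner H (T' i z) w = cnj (hinner H w (T' i z))" using hs.hinner_commute that T'_carrier by blast
    also have "\<dots> = cnj (hinner H (T i w) z)" using T_adjoint that by simp
    also have "\<dots> = hinner H z (T i w)" using hs.hinner_commute[of "T i w" z] that T_carrier by simp
    finally show ?thesis using that by (simp add: hadjoint_T)
  qed
  then show ?thesis unfolding op_monom_eq
    using op_monom_carrier[OF y, of \<mu>] x
    by (intro hs.op_product_adjoint) (auto simp: hadjoint_T op_monom_eq intro: T_carrier T'_carrier)
qed

lemma hinner_hereditary_eval_limit:
  assumes R: "R \<in> wz_mat_polys d m m" and x: "x \<in> carrier (hpower m H)"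
    and s: "\<And>b. b < m \<Longrightarrow> hs.converges (\<lambda>n. j (s b n)) (x b)"
  shows "(\<lambda>n. L (gram m (\<lambda>i j. R $$ (i, j)) (\<lambda>i. s i n)))
    \<longlonglongrightarrow> hinner (hpower m H) (hereditary_eval H d T R x) x"
proof -
  let ?I = "\<Union>p\<in>elements_mat R. Poly_Mapping.keys p"
  have Pc: "R \<in> carrier_mat m m" using R by (simp add: wz_mat_polys_def)
  have I: "\<kappa> \<in> multi_indices d" "\<mu> \<in> multi_indices d" if "(\<kappa>, \<mu>) \<in> ?I" for \<kappa> \<mu>
    using R that by (auto simp: wz_mat_polys_def)
  have xb: "x b \<in> carrier H" if "b < m" for b using x that by (auto simp: hpower_simps)
  define V where "V \<kappa> = op_product T (Poly_Mapping.lookup \<kappa>) (rev [0..<d])" for \<kappa>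
  define W where "W \<mu> = op_product T (Poly_Mapping.lookup \<mu>) [0..<d]" for \<mu>
  have Vj: "V \<kappa> (j u) = j (monom_times \<kappa> u)" if "\<kappa> \<in> multi_indices d" for \<kappa> u
    unfolding V_def using that
    by (subst op_product_intertwine[of _ T j zmult]) (auto simp: T_j op_product_zmult_multi_index atLeast0LessThan)
  have Wj: "W \<mu> (j u) = j (monom_times \<mu> u)" if "\<mu> \<in> multi_indices d" for \<mu> u
    unfolding W_def using that
    by (subst op_product_intertwine[of _ T j zmult]) (auto simp: T_j op_product_zmult_multi_index atLeast0LessThan)
  have eval_eq: "hinner (hpower m H) (hereditary_eval H d T R x) x
     = (\<Sum>(\<kappa>, \<mu>)\<in>?I. \<Sum>a<m. \<Sum>b<m. Poly_Mapping.lookup (R $$ (a, b)) (\<kappa>, \<mu>) * hinner H (W \<mu> (x b)) (V \<kappa> (x a)))"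
    by (subst hinner_hereditary_eval[OF hs.complex_hilbert_space_axioms Pc x])
       (auto intro!: op_monom_adjoint_carrier op_monom_carrier sum.cong simp: V_def W_def hinner_op_monom xb)
  have L_value: "L (gram m (\<lambda>i j. R $$ (i, j)) (\<lambda>i. s i n))
     = (\<Sum>(\<kappa>, \<mu>)\<in>?I. \<Sum>a<m. \<Sum>b<m. Poly_Mapping.lookup (R $$ (a, b)) (\<kappa>, \<mu>) * hinner H (W \<mu> (j (s b n))) (V \<kappa> (j (s a n))))" for n
    unfolding L_gram_expansion[OF Pc, symmetric]
  proof (rule sum.cong[OF refl], simp only: split_paired_all prod.case)
    fix \<kappa> \<mu> assume "(\<kappa>, \<mu>) \<in> ?I"
    from I[OF this] show "(\<Sum>a<m. \<Sum>b<m. Poly_Mapping.lookup (R $$ (a, b)) (\<kappa>, \<mu>) * B (monom_times \<mu> (s b n)) (monom_times \<kappa> (s a n)))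
      = (\<Sum>a<m. \<Sum>b<m. Poly_Mapping.lookup (R $$ (a, b)) (\<kappa>, \<mu>) * hinner H (W \<mu> (j (s b n))) (V \<kappa> (j (s a n))))"
      by (simp add: Vj Wj hinner_j)
  qed
  show ?thesis unfolding eval_eq L_value split_def
    by (intro tendsto_sum tendsto_mult tendsto_const hs.hinner_tendsto)
       (auto simp: V_def W_def intro!: hs.converges_op_product T_bounded s)
qed

text \<open>
  Along polynomial approximations of \<open>x\<close> the values are \<open>L\<close> of elements of the cone that are hermitian, thus
  real and nonnegative.
\<close>

lemma hereditary_eval_pos_semidefinite:
  assumes l: "l \<in> {1..k}"
  shows "pos_semidefinite (hpower (g l) H) (hereditary_eval H d T (P l))"
  unfolding pos_semidefinite_def
proof
  fix x assume x: "x \<in> carrier (hpower (g l) H)"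
  have P: "P l \<in> wz_mat_polys d (g l) (g l)" using hermitian[OF l] by (simp add: hermitian_polys_def)
  have "\<exists>s. hs.converges (\<lambda>n. j (s n)) (x b)" if "b < g l" for b
    using x that by (intro j_dense) (auto simp: hpower_simps)
  then obtain s where s: "\<And>b. b < g l \<Longrightarrow> hs.converges (\<lambda>n. j (s b n)) (x b)" by metis
  define f where "f n = L (gram (g l) (\<lambda>i j. P l $$ (i, j)) (\<lambda>i. s i n))" for n
  have lim: "f \<longlonglongrightarrow> hinner (hpower (g l) H) (hereditary_eval H d T (P l) x) x"
    unfolding f_def by (rule hinner_hereditary_eval_limit[OF P x s])
  have f: "f n = L (gram (form_size l) (form l) (\<lambda>i. s i n))" for n
  proof -
    have "form l = (\<lambda>i j. P l $$ (i, j))" "form_size l = g l" using l by (auto simp: form_def form_size_def fun_eq_iff)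
    then show ?thesis by (simp add: f_def)
  qed
  have sos: "gram (form_size l) (form l) (\<lambda>i. s i n) \<in> sos" for n using l by (intro sos_gram) simp
  have "0 \<le> Re (f n)" for n unfolding f by (intro L_cone sos_cone sos)
  moreover have "Im (f n) = 0" for n
  proof -
    \<comment> \<open>elements of \<open>sos\<close> are invariant under the involution\<close>
    have "f n = cnj (f n)" unfolding f L_fstar[symmetric] fstar_sos[OF sos] ..
    then have "Im (f n) = Im (cnj (f n))" by (rule arg_cong)
    then show ?thesis by simp
  qed
  ultimately show "0 \<le> hinner (hpower (g l) H) (hereditary_eval H d T (P l) x) x"
    using LIMSEQ_le_const[OF tendsto_Re[OF lim], of 0] LIMSEQ_unique[OF tendsto_Im[OF lim], of 0]
    by (simp add: less_eq_complex_def)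
qed

text \<open>
  The constant unit rows, for which $X^* Q X = Q$.
\<close>

lemma cyclic_vector:
  assumes Q: "Q \<in> wz_mat_polys d \<gamma> \<gamma>"
  defines "\<xi> \<equiv> (\<lambda>b\<in>{..<\<gamma>}. j (entry_row b 1))"
  shows "\<xi> \<in> carrier (hpower \<gamma> H)"
    and "hinner (hpower \<gamma> H) (hereditary_eval H d T Q \<xi>) \<xi> = L (\<lambda>a b. Q $$ (a, b))"
    and "hinner (hpower \<gamma> H) \<xi> \<xi> = L funit"
proof -
  show \<xi>: "\<xi> \<in> carrier (hpower \<gamma> H)" by (auto simp: \<xi>_def hpower_simps j_carrier)
  have "(\<lambda>n. L (gram \<gamma> (\<lambda>i j. Q $$ (i, j)) (\<lambda>i. entry_row i 1))) \<longlonglongrightarrow> hinner (hpower \<gamma> H) (hereditary_eval H d T Q \<xi>) \<xi>"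
    by (rule hinner_hereditary_eval_limit[OF Q \<xi>]) (simp add: \<xi>_def hs.converges_const j_carrier)
  then have "hinner (hpower \<gamma> H) (hereditary_eval H d T Q \<xi>) \<xi> = L (gram \<gamma> (\<lambda>i j. Q $$ (i, j)) (\<lambda>i. entry_row i 1))"
    by (simp add: LIMSEQ_const_iff)
  also have "\<dots> = L (\<lambda>a b. Q $$ (a, b))"
  proof (rule L_cong_entries)
    fix a b assume ab: "a < \<gamma>" "b < \<gamma>"
    have "(\<Sum>l<\<gamma>. star_w (entry_row i 1 a) * Q $$ (i, l) * in_z (entry_row l 1 b)) = (if i = a then Q $$ (a, b) else 0)" for i
    proof -
      have "(\<Sum>l<\<gamma>. star_w (entry_row i 1 a) * Q $$ (i, l) * in_z (entry_row l 1 b))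
        = (\<Sum>l<\<gamma>. if l = b then star_w (entry_row i 1 a) * Q $$ (i, b) else 0)"
        by (intro sum.cong refl) (simp add: entry_row_def in_z_one in_z_zero)
      then show ?thesis using ab by (simp add: entry_row_def star_w_one star_w_zero)
    qed
    then show "gram \<gamma> (\<lambda>i j. Q $$ (i, j)) (\<lambda>i. entry_row i 1) a b = Q $$ (a, b)"
      using ab by (simp add: gram_def)
  qed
  finally show "hinner (hpower \<gamma> H) (hereditary_eval H d T Q \<xi>) \<xi> = L (\<lambda>a b. Q $$ (a, b))" .
  have "hinner (hpower \<gamma> H) \<xi> \<xi> = L (\<Sum>b<\<gamma>. outer (entry_row b 1) (entry_row b 1))"
    by (simp add: hpower_simps \<xi>_def hinner_j B_def L_sum)
  also have "\<dots> = L funit"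
  proof (rule L_cong_entries)
    fix a b assume a: "a < \<gamma>"
    have app: "(\<Sum>a\<in>A. G a) z = (\<Sum>a\<in>A. G a z)"
      for A :: "nat set" and G :: "nat \<Rightarrow> nat \<Rightarrow> 'z::comm_monoid_add" and z
      by (induction A rule: infinite_finite_induct) auto
    show "(\<Sum>b<\<gamma>. outer (entry_row b 1) (entry_row b 1)) a b = funit a b"
      using diagonal_sum[OF a, where A = "{}" and p = 1 and b = b] by (simp add: app funit_def star_w_one in_z_one)
  qed
  finally show "hinner (hpower \<gamma> H) \<xi> \<xi> = L funit" .
qed

end

context positive_functional
begin

text \<open>
  The completion of the polynomial rows, relabelled by elements of \<open>'h\<close>.
\<close>

theorem gns_construction:
  assumes big: "(UNIV :: real set) \<lesssim> (UNIV :: 'h set)"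
  obtains H :: "'h hilbert" and j T T' where "gns_space d k g P c \<gamma> L H j T T'"
proof -
  obtain \<iota> :: "((nat \<Rightarrow> z_poly) \<Rightarrow> complex) \<Rightarrow> 'h" where inj: "inj_on \<iota> dual"
    using inj_on_functions_determined_on_countable[OF big countable_monomial_rows dual_eq_on_monomial_rows] by blast
  let ?H = "completion \<iota>" and ?j = "embed \<iota>"
  interpret hs: complex_hilbert_space ?H by (rule complex_hilbert_space_completion[OF inj])
  have "\<exists>T T'. bounded_operator ?H T \<and> T' \<in> carrier ?H \<rightarrow> carrier ?H \<and>
      (\<forall>x\<in>carrier ?H. \<forall>y\<in>carrier ?H. hinner ?H (T x) y = hinner ?H x (T' y)) \<and>
      (\<forall>u. T (?j u) = ?j (zmult i u))" for i
  proof (rule operator_extension[OF inj, of "zmult i" "\<bar>c\<bar>"])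
    fix T T'
    assume "bounded_operator ?H T" "T' \<in> carrier ?H \<rightarrow> carrier ?H" "\<And>u. T (?j u) = ?j (zmult i u)"
      "\<And>x y. x \<in> carrier ?H \<Longrightarrow> y \<in> carrier ?H \<Longrightarrow> hinner ?H (T x) y = hinner ?H x (T' y)"
    then show ?thesis by blast
  qed (simp_all only: zmult_add zmult_rscale seminorm_zmult abs_ge_zero)
  then obtain T T' where T: "\<And>i. bounded_operator ?H (T i)" "\<And>i. T' i \<in> carrier ?H \<rightarrow> carrier ?H"
    "\<And>i. \<forall>x\<in>carrier ?H. \<forall>y\<in>carrier ?H. hinner ?H (T i x) y = hinner ?H x (T' i y)"
    "\<And>i u. T i (?j u) = ?j (zmult i u)" by metis
  have dense: "\<exists>s. hs.converges (\<lambda>n. ?j (s n)) x" if x: "x \<in> carrier ?H" for x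
  proof -
    have "\<exists>u. hnorm ?H (x \<ominus>\<^bsub>?H\<^esub> ?j u) < inverse (real (Suc n))" for n
      by (rule embed_dense[OF inj x]) simp
    then obtain s where s: "\<And>n. hnorm ?H (x \<ominus>\<^bsub>?H\<^esub> ?j (s n)) < inverse (real (Suc n))" by metis
    have sc: "?j (s n) \<in> carrier ?H" for n by (rule embed_carrier[OF inj])
    have sym: "hnorm ?H (?j (s n) \<ominus>\<^bsub>?H\<^esub> x) = hnorm ?H (x \<ominus>\<^bsub>?H\<^esub> ?j (s n))" for n
      using x sc by (simp add: hnorm_def hs.hinner_minus hs.hinner_minus_right algebra_simps)
    have "(\<lambda>n. hnorm ?H (?j (s n) \<ominus>\<^bsub>?H\<^esub> x)) \<longlonglongrightarrow> 0"
    proof (rule Lim_null_comparison[OF _ LIMSEQ_inverse_real_of_nat], rule always_eventually, rule allI)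
      fix n
      have "0 \<le> hnorm ?H (?j (s n) \<ominus>\<^bsub>?H\<^esub> x)"
        unfolding hnorm_def by (intro real_sqrt_ge_zero hs.hinner_self_nonneg hs.minus_closed x sc)
      then show "norm (hnorm ?H (?j (s n) \<ominus>\<^bsub>?H\<^esub> x)) \<le> inverse (real (Suc n))"
        using s[of n] sym[of n] unfolding real_norm_def by linarith
    qed
    then show ?thesis using x sc by (auto simp: hs.converges_def)
  qed
  have "gns_space d k g P c \<gamma> L ?H ?j T T'"
    by unfold_locales
       (use T dense in \<open>auto simp: embed_carrier[OF inj] hinner_embed[OF inj]\<close>)
  then show ?thesis by (rule that)
qed

end

section \<open>The Positivstellensatz\<close>

theorem theorem2p3:
  fixes d k \<gamma> :: nat
    and g :: "nat \<Rightarrow> nat"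
    and P :: "nat \<Rightarrow> wz_poly mat"
    and Q :: "wz_poly mat"
  assumes universe: "(UNIV :: real set) \<lesssim> (UNIV :: 'h set)"
    and d: "d \<ge> 1"
    and P: "\<forall>j\<in>{1..k}. g j \<ge> 1 \<and> P j \<in> hermitian_polys d (g j)"
    and archimedean: "\<exists>c::real. c > 0 \<and> (\<forall>i<d.
      mat 1 1 (\<lambda>_. poly_const (of_real (c^2)) - var_w i * var_z i) \<in> generated_set d k g P 1)"
    and \<gamma>: "\<gamma> \<ge> 1"
    and Q: "Q \<in> hermitian_polys d \<gamma>"
    and positive: "\<forall>(H :: 'h hilbert) T.
      complex_hilbert_space H \<and> commuting_tuple H d T \<and>
      (\<forall>j\<in>{1..k}. pos_semidefinite (hpower (g j) H) (hereditary_eval H d T (P j))) \<longrightarrow>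
      pos_definite (hpower \<gamma> H) (hereditary_eval H d T Q)"
  shows "Q \<in> generated_set d k g P \<gamma>"
proof -
  obtain c :: real where c: "\<forall>i<d.
      mat 1 1 (\<lambda>_. poly_const (of_real (c^2)) - var_w i * var_z i) \<in> generated_set d k g P 1"
    using archimedean by blast
  interpret archimedean_constraints d k g P c
    by unfold_locales (use P c in auto)
  have Qp: "Q \<in> wz_mat_polys d \<gamma> \<gamma>" using Q by (simp add: hermitian_polys_def)
  have keys: "Poly_Mapping.keys (Q $$ (a, b)) \<subseteq> multi_indices d \<times> multi_indices d"
    if "a < \<gamma>" "b < \<gamma>" for a b
  proof -
    have "Q $$ (a, b) \<in> elements_mat Q"
      using that Qp by (intro elements_matI[of _ \<gamma> \<gamma>]) (auto simp: wz_mat_polys_def)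
    then show ?thesis using Qp by (simp add: wz_mat_polys_def)
  qed
  define q where "q = (\<lambda>a b. Q $$ (a, b))"
  have "q \<in> cone \<gamma>"
  proof (rule ccontr)
    assume "q \<notin> cone \<gamma>"
    then obtain L where L: "\<And>F G. L (F + G) = L F + L G" "\<And>a F. L (fscale a F) = a * L F"
      "\<And>F. L (fstar F) = cnj (L F)" "\<And>F. F \<in> cone \<gamma> \<Longrightarrow> 0 \<le> Re (L F)"
      and unit: "Re (L funit) = 1" and Lq: "Re (L q) \<le> 0"
      by (rule separating_functional) blast
    interpret positive_functional d k g P c \<gamma> L
      by unfold_locales (fact L)+
    obtain H :: "'h hilbert" and j T T' where gns: "gns_space d k g P c \<gamma> L H j T T'"
      using gns_construction[OF universe] by blast
    interpret gns_space d k g P c \<gamma> L H j T T' by (rule gns)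
    define \<xi> where "\<xi> = (\<lambda>b\<in>{..<\<gamma>}. j (entry_row b 1))"
    note cyclic = cyclic_vector[OF Qp, folded \<xi>_def]
    have "pos_definite (hpower \<gamma> H) (hereditary_eval H d T Q)"
      using positive hs.complex_hilbert_space_axioms commuting hereditary_eval_pos_semidefinite by blast
    \<comment> \<open>the squared norm of \<open>\<xi>\<close> is $L(I)$\<close>
    moreover have "\<xi> \<noteq> \<zero>\<^bsub>hpower \<gamma> H\<^esub>"
    proof
      assume "\<xi> = \<zero>\<^bsub>hpower \<gamma> H\<^esub>"
      then have "hinner (hpower \<gamma> H) \<xi> \<xi> = 0"
        by (simp add: hpower_simps hs.hinner_zero)
      then show False using cyclic(3) unit by simp
    qed
    ultimately have "0 < hinner (hpower \<gamma> H) (hereditary_eval H d T Q \<xi>) \<xi>"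
      using cyclic(1) unfolding pos_definite_def by blast
    then show False using cyclic(2) Lq by (simp add: q_def less_complex_def)
  qed
  then obtain G where G: "G \<in> sos" "\<forall>a<\<gamma>. \<forall>b<\<gamma>. prune d ((q + fstar q) a b) = prune d (G a b)"
    by (auto simp: cone_def)
  show ?thesis
  proof (rule sos_imp_generated_set[OF Q sos_fscale[OF _ G(1), of "1/2"]])
    fix a b assume ab: "a < \<gamma>" "b < \<gamma>"
    have "prune d (Q $$ (a, b)) + prune d (star (Q $$ (b, a))) = prune d (G a b)"
      using G(2)[rule_format, OF ab] by (simp add: q_def fstar_def prune_add)
    then have G_ab: "prune d (G a b) = Q $$ (a, b) + Q $$ (a, b)"
      unfolding star_hermitian_poly[OF Q ab(2,1)] prune_id[OF keys[OF ab]] by (rule sym)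
    have "prune d (fscale (of_real (1/2)) G a b) = poly_const (1/2) * prune d (G a b)"
      by (simp add: fscale_def prune_mult prune_poly_const)
    also have "\<dots> = (poly_const (1/2) + poly_const (1/2)) * Q $$ (a, b)"
      unfolding G_ab by (simp only: distrib_left distrib_right)
    also have "\<dots> = Q $$ (a, b)"
      by (simp flip: poly_const_add)
    finally show "Q $$ (a, b) = prune d (fscale (of_real (1/2)) G a b)" by (rule sym)
  qed simp
qed

end
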